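(* The boundary value problem $L$ has a countable set of eigenvalues. They are real and can be numbered as $\{\lambda_{nk}\}_{n\in\mathbb N,\,k=1,\dots,m}$ (counting multiplicities) so that, with $\rho_{nk}=\sqrt{\lambda_{nk}}$, $$\rho_{n1}=n-1+\frac{\alpha}{\pi}+\varkappa_n,\quad \rho_{n2}=n-\frac{\alpha}{\pi}+\varkappa_n,\quad \rho_{nk}=n-\tfrac12+\varkappa_n\ (k\in\mathcal I_3),\quad \rho_{nk}=n+\varkappa_n\ (k\in\mathcal I_4),$$ where $\mathcal I_3,\mathcal I_4$ are fixed index sets with $\mathcal I_3\cup\mathcal I_4=\{3,\dots,m\}$, $\mathcal I_3\cap\mathcal I_4=\varnothing$, $|\mathcal I_3|=p-1$, $|\mathcal I_4|=m-p-1$.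
   Context: Let $m\ge 4$ and $2\le p\le m-2$ be integers. Let $G$ be a star-shaped graph with $m$ edges $e_1,\dots,e_m$ of length $\pi$; edge $e_j$ is parametrized by $x_j\in[0,\pi]$, where $x_j=0$ is the boundary vertex of $e_j$ and $x_j=\pi$ is the common internal vertex. For $j=1,\dots,m$ let $\sigma_j\in L_2(0,\pi)$ be real-valued (the potentials; formally $q_j=\sigma_j'\in W_2^{-1}(0,\pi)$). For a function $y_j$ on $[0,\pi]$ set $y_j^{[1]}=y_j'-\sigma_j y_j$ (quasi-derivative) and $\ell_j y_j=-(y_j^{[1]})'-\sigma_j y_j^{[1]}-\sigma_j^2 y_j$, with domain $\{y_j\in W_2^1[0,\pi]: y_j^{[1]}\in W_1^1[0,\pi],\ \ell_j y_j\in L_2(0,\pi)\}$. Consider the system $\ell_j y_j=\lambda y_j$, $j=1,\dots,m$. The problem $L$ is this system with the matching conditions $y_1(\pi)=y_j(\pi)$ ($j=2,\dots,m$), $\sum_{j=1}^m y_j^{[1]}(\pi)=0$, and boundary conditions $y_j^{[1]}(0)=0$ for $j=1,\dots,p$, $y_j(0)=0$ for $j=p+1,\dots,m$. Here $\rho=\sqrt\lambda$ with $\operatorname{Re}\rho\ge0$, $\alpha=\arccos\sqrt{p/m}$, and the symbol $\{\varkappa_n\}$ denotes (possibly different in each occurrence) sequences belonging to $\ell_2$. *)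

theory Defs
  imports "HOL-Analysis.Analysis"
begin

text \<open>Star graph with m edges of length pi, edge j parametrized by x in [0,pi]
  (x = 0 boundary vertex, x = pi internal vertex). Potentials sigma j (j = 1..m).\<close>

definition L2_real :: "(real \<Rightarrow> real) \<Rightarrow> bool" where
  "L2_real s \<longleftrightarrow> s absolutely_integrable_on {0..pi} \<and> (\<lambda>x. (s x)\<^sup>2) integrable_on {0..pi}"

text \<open>y j solves l_j y_j = lam y_j on [0,pi] with quasi-derivative w j = y_j' - sigma_j y_j:
  y_j is in W_2^1, y_j^[1] is in W_1^1 (both written out as absolutely continuous functions
  given by the integrals of their derivatives), and
  (y_j^[1])' = - sigma_j y_j^[1] - sigma_j^2 y_j - lam y_j a.e.\<close>
definition edge_sol :: "(real \<Rightarrow> real) \<Rightarrow> complex \<Rightarrow> (real \<Rightarrow> complex) \<Rightarrow> (real \<Rightarrow> complex) \<Rightarrow> bool" where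
  "edge_sol s lam y w \<longleftrightarrow>
     continuous_on {0..pi} y \<and> continuous_on {0..pi} w \<and>
     (\<forall>x\<in>{0..pi}.
        ((\<lambda>t. complex_of_real (s t) * y t + w t) has_integral (y x - y 0)) {0..x} \<and>
        ((\<lambda>t. - complex_of_real (s t) * w t - complex_of_real ((s t)\<^sup>2) * y t - lam * y t)
            has_integral (w x - w 0)) {0..x})"

definition L_sol :: "nat \<Rightarrow> nat \<Rightarrow> (nat \<Rightarrow> real \<Rightarrow> real) \<Rightarrow> complex \<Rightarrow> (nat \<Rightarrow> real \<Rightarrow> complex) \<Rightarrow> bool" where
  "L_sol m p \<sigma> lam y \<longleftrightarrow>
     (\<exists>w :: nat \<Rightarrow> real \<Rightarrow> complex.
        (\<forall>j\<in>{1..m}. edge_sol (\<sigma> j) lam (y j) (w j)) \<and>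
        (\<forall>j\<in>{2..m}. y 1 pi = y j pi) \<and>
        (\<Sum>j=1..m. w j pi) = 0 \<and>
        (\<forall>j\<in>{1..p}. w j 0 = 0) \<and>
        (\<forall>j\<in>{p+1..m}. y j 0 = 0))"

definition L_eigenvalue :: "nat \<Rightarrow> nat \<Rightarrow> (nat \<Rightarrow> real \<Rightarrow> real) \<Rightarrow> complex \<Rightarrow> bool" where
  "L_eigenvalue m p \<sigma> lam \<longleftrightarrow>
     (\<exists>y. L_sol m p \<sigma> lam y \<and> (\<exists>j\<in>{1..m}. \<exists>x\<in>{0..pi}. y j x \<noteq> 0))"

text \<open>Multiplicity of lam: maximal number of linearly independent (over the complex numbers,
  as functions on the graph) solutions of L with parameter lam, i.e. the dimension of the
  eigenspace (0 if lam is not an eigenvalue). The problem is self-adjoint, so this is the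
  multiplicity used in the paper.\<close>
definition L_mult :: "nat \<Rightarrow> nat \<Rightarrow> (nat \<Rightarrow> real \<Rightarrow> real) \<Rightarrow> complex \<Rightarrow> nat" where
  "L_mult m p \<sigma> lam =
     (GREATEST k. \<exists>f :: nat \<Rightarrow> nat \<Rightarrow> real \<Rightarrow> complex.
        (\<forall>i<k. L_sol m p \<sigma> lam (f i)) \<and>
        (\<forall>c :: nat \<Rightarrow> complex.
           (\<forall>j\<in>{1..m}. \<forall>x\<in>{0..pi}. (\<Sum>i<k. c i * f i j x) = 0) \<longrightarrow> (\<forall>i<k. c i = 0)))"

definition l2seq :: "(nat \<Rightarrow> complex) \<Rightarrow> bool" where
  "l2seq \<kappa> \<longleftrightarrow> summable (\<lambda>n. (cmod (\<kappa> (Suc n)))\<^sup>2)"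

end

(*
The Pruefer angle theta_j(lam) at the internal vertex of the solution on edge j satisfying the boundary
condition is continuous and strictly increasing in lam. The number of eigenvalues up to lam is the
number of poles of sum_j cot theta_j, which is sum_j floor(theta_j / pi), plus one if lam is no pole and
sum_j cot theta_j <= 0. This count is a monotone function of the angles. Integrating the
Pruefer equation by parts and applying Bessel's inequality to the Fourier coefficients of sigma_j gives
theta_j(r^2) = theta_j(0 potential, r^2) + eta_n for |r - n| <= 2 with eta in l_2, so the eigenvalue count
is sandwiched between the unperturbed counts at r - eta_n and r + eta_n, and each rho lies within eta_n of
its unperturbed value.
*)
theory Submission
  imports Defs
begin

section \<open>Product and chain rules, Gronwall inequalities, and existence for equations
  integrable in time\<close>

section \<open>Calculus of absolutely continuous functions\<close>

text \<open>The error bound is needed at an eigenvalue whose position is not known beforehand, so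
  one number \<open>\<eta> n\<close> must serve all r within distance 2 of n. For this reason the
  Fourier coefficients are taken at the integer frequency n, the slow remaining phase is
  differentiated in the integration by parts, and the coefficients are needed over every {0..t}, not
  only over {0..pi}. The angles used for monotonicity in lam and those used for the asymptotics have
  different scales. They meet only in the count: at the internal vertex the cotangents differ by a
  positive factor and the floors agree, so both scales give the same number. Multiplicities need no
  separate treatment in the asymptotics: the count jumps at lam by the dimension of the eigenspace,
  so listing its jumps with repetition lists the eigenvalues with multiplicity. The number \<alpha>
  is the zero in (0, pi / 2) of p cot (pi / 2 + x) + (m - p) cot x, the cotangent sum for zero
  potentials: it means tan^2 \<alpha> = (m - p) / p, that is cos^2 \<alpha> = p / m.\<close>

lemma absint_cont_mult:
  fixes f g :: "real \<Rightarrow> 'a::{euclidean_space,real_normed_field}"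
  assumes "continuous_on {0..T} f" "g absolutely_integrable_on {0..T}"
  shows "(\<lambda>x. f x * g x) absolutely_integrable_on {0..T}"
proof (rule absolutely_integrable_bounded_measurable_product[OF bilinear_times _ _ _ assms(2)])
  show "f \<in> borel_measurable (lebesgue_on {0..T})"
    by (intro continuous_imp_measurable_on_sets_lebesgue assms) auto
  show "bounded (f ` {0..T})"
    by (intro compact_imp_bounded compact_continuous_image assms) auto
qed auto

lemma absint_mult_cont:
  fixes f g :: "real \<Rightarrow> 'a::{euclidean_space,real_normed_field}"
  assumes "f absolutely_integrable_on {0..T}" "continuous_on {0..T} g"
  shows "(\<lambda>x. f x * g x) absolutely_integrable_on {0..T}"
  using absint_cont_mult[OF assms(2,1)] by (simp add: mult.commute)

lemma const_absint: "(\<lambda>_. c::real) absolutely_integrable_on {0..T::real}"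
  by (intro absolutely_integrable_continuous_real continuous_intros)

text \<open>\<open>u\<close> is absolutely continuous on \<open>[0,T]\<close> with almost everywhere derivative \<open>a\<close>; there is
  no pointwise differentiability to use, so the calculus below works with the integrals only.\<close>

definition ac :: "real \<Rightarrow> (real \<Rightarrow> 'a::euclidean_space) \<Rightarrow> (real \<Rightarrow> 'a) \<Rightarrow> bool" where
  "ac T u a \<longleftrightarrow> a absolutely_integrable_on {0..T} \<and>
     (\<forall>x\<in>{0..T}. (a has_integral (u x - u 0)) {0..x})"

lemma ac_absint: "ac T u a \<Longrightarrow> a absolutely_integrable_on {0..T}"
  by (simp add: ac_def)

lemma absint_on_subinterval:
  fixes a :: "real \<Rightarrow> 'a::euclidean_space"
  assumes "a absolutely_integrable_on {0..T}" "0 \<le> s" "t \<le> T"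
  shows "a absolutely_integrable_on {s..t}"
  using set_integrable_subset[OF assms(1), of "{s..t}"] assms by auto

lemma absint_integrable:
  fixes a :: "real \<Rightarrow> 'a::euclidean_space"
  assumes "a absolutely_integrable_on {0..T}" "0 \<le> s" "t \<le> T"
  shows "a integrable_on {s..t}"
  using absint_on_subinterval[OF assms] set_lebesgue_integral_eq_integral(1) by blast

lemma ac_interval:
  assumes "ac T u a" "0 \<le> s" "s \<le> t" "t \<le> T"
  shows "(a has_integral (u t - u s)) {s..t}"
proof -
  have i: "(a has_integral (integral {s..t} a)) {s..t}"
    using absint_integrable[OF ac_absint[OF assms(1)]] assms by blast
  have "(a has_integral (u s - u 0 + integral {s..t} a)) {0..t}"
    using assms by (intro has_integral_combine[OF _ _ _ i]) (auto simp: ac_def)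
  moreover have "(a has_integral (u t - u 0)) {0..t}"
    using assms by (auto simp: ac_def)
  ultimately have "u s - u 0 + integral {s..t} a = u t - u 0"
    by (rule has_integral_unique)
  then have "integral {s..t} a = u t - u s" by (simp add: algebra_simps)
  with i show ?thesis by simp
qed

lemma ac_continuous_on: "ac T u a \<Longrightarrow> continuous_on {0..T} u"
proof -
  assume a: "ac T u a"
  have "continuous_on {0..T} (\<lambda>x. u 0 + integral {0..x} a)"
    using absint_integrable[OF ac_absint[OF a]]
    by (intro continuous_intros indefinite_integral_continuous_1) auto
  moreover have "u 0 + integral {0..x} a = u x" if "x \<in> {0..T}" for x
    using a that by (auto simp: ac_def dest!: bspec[of _ _ x] integral_unique)
  ultimately show ?thesis by (rule continuous_on_eq)
qed

lemma ac_I_integral: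
  assumes "a absolutely_integrable_on {0..T}" "\<And>x. x \<in> {0..T} \<Longrightarrow> u x = c + integral {0..x} a"
  shows "ac T u a"
  unfolding ac_def
proof (intro conjI ballI assms(1))
  fix x assume x: "x \<in> {0..T}"
  then have "0 \<in> {0..T}" by auto
  then have "u 0 = c" using assms(2) by fastforce
  with assms(2)[OF x] have "u x - u 0 = integral {0..x} a" by simp
  then show "(a has_integral (u x - u 0)) {0..x}"
    using absint_integrable[OF assms(1)] x by (metis atLeastAtMost_iff has_integral_integral order_refl)
qed

lemma ac_cong:
  assumes "ac T u a" "\<And>x. x \<in> {0..T} \<Longrightarrow> u x = v x" "\<And>x. x \<in> {0..T} \<Longrightarrow> a x = b x"
  shows "ac T v b"
  unfolding ac_def
proof (intro conjI ballI)
  show "b absolutely_integrable_on {0..T}"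
    using assms(1,3) unfolding ac_def by (metis (no_types, lifting) set_integrable_cong)
  fix x assume x: "x \<in> {0..T}"
  then have "0 \<in> {0..T}" by auto
  then have "u x - u 0 = v x - v 0" using assms(2) x by simp
  moreover have "(a has_integral (u x - u 0)) {0..x}" using assms(1) x by (auto simp: ac_def)
  ultimately show "(b has_integral (v x - v 0)) {0..x}"
    using assms(3) x has_integral_eq[of "{0..x}" a b] by auto
qed

lemma ac_const: "ac T (\<lambda>_. c) (\<lambda>_. 0)"
  by (auto simp: ac_def)

lemma ac_id: "ac T (\<lambda>t. t) (\<lambda>_. 1::real)"
  unfolding ac_def
proof (intro conjI ballI)
  show "(\<lambda>_. 1::real) absolutely_integrable_on {0..T}"
    by (intro absolutely_integrable_continuous_real continuous_intros)
  fix x assume "x \<in> {0..T}"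
  then show "((\<lambda>_. 1) has_integral x - 0) {0..x}"
    using has_integral_const_real[of "1::real" 0 x] by simp
qed

lemma ac_add: "ac T u a \<Longrightarrow> ac T v b \<Longrightarrow> ac T (\<lambda>t. u t + v t) (\<lambda>t. a t + b t)"
  unfolding ac_def
proof (intro conjI ballI)
  assume *: "a absolutely_integrable_on {0..T} \<and> (\<forall>x\<in>{0..T}. (a has_integral u x - u 0) {0..x})"
    "b absolutely_integrable_on {0..T} \<and> (\<forall>x\<in>{0..T}. (b has_integral v x - v 0) {0..x})"
  then show "(\<lambda>t. a t + b t) absolutely_integrable_on {0..T}"
    by (intro set_integral_add(1)) auto
  fix x assume "x \<in> {0..T}"
  then have "((\<lambda>t. a t + b t) has_integral (u x - u 0) + (v x - v 0)) {0..x}"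
    using * by (intro has_integral_add) auto
  then show "((\<lambda>t. a t + b t) has_integral u x + v x - (u 0 + v 0)) {0..x}"
    by (simp add: algebra_simps)
qed

lemma ac_bounded_linear:
  assumes "bounded_linear h" "ac T u a"
  shows "ac T (\<lambda>t. h (u t)) (\<lambda>t. h (a t))"
  unfolding ac_def
proof (intro conjI ballI)
  show "(\<lambda>t. h (a t)) absolutely_integrable_on {0..T}"
    using absolutely_integrable_linear[OF ac_absint[OF assms(2)] assms(1)] by (simp add: o_def)
  fix x assume "x \<in> {0..T}"
  then have "(a has_integral u x - u 0) {0..x}" using assms(2) by (auto simp: ac_def)
  from has_integral_linear[OF this assms(1)]
  show "((\<lambda>t. h (a t)) has_integral h (u x) - h (u 0)) {0..x}"
    by (simp add: o_def linear_diff[OF bounded_linear.linear[OF assms(1)]])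
qed

lemma ac_minus: "ac T u a \<Longrightarrow> ac T (\<lambda>t. - u t) (\<lambda>t. - a t)"
  by (rule ac_bounded_linear[OF bounded_linear_minus[OF bounded_linear_ident]])

lemma ac_diff: "ac T u a \<Longrightarrow> ac T v b \<Longrightarrow> ac T (\<lambda>t. u t - v t) (\<lambda>t. a t - b t)"
  using ac_add[OF _ ac_minus] by fastforce

lemma ac_cmult:
  fixes u :: "real \<Rightarrow> 'a::{euclidean_space,real_normed_field}"
  shows "ac T u a \<Longrightarrow> ac T (\<lambda>t. c * u t) (\<lambda>t. c * a t)"
  by (rule ac_bounded_linear[OF bounded_linear_mult_right])

lemma ac_nonneg_mono:
  fixes u :: "real \<Rightarrow> real"
  assumes "ac T u a" "0 \<le> s" "s \<le> t" "t \<le> T" "\<And>x. x \<in> {s..t} \<Longrightarrow> 0 \<le> a x"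
  shows "u s \<le> u t"
  using has_integral_nonneg[OF ac_interval[OF assms(1-4)]] assms(5) by simp

text \<open>Replaces the differentiation theorem for absolutely continuous functions in the proofs of the
  product and chain rules.\<close>

lemma const_of_small_increments:
  fixes D :: "real \<Rightarrow> 'a::real_normed_vector" and A :: "real \<Rightarrow> real"
  assumes small: "\<And>e. e > 0 \<Longrightarrow> \<exists>\<delta>>0. \<forall>s t. 0 \<le> s \<longrightarrow> s \<le> t \<longrightarrow> t \<le> T \<longrightarrow> t - s < \<delta> \<longrightarrow>
                  norm (D t - D s) \<le> e * (A t - A s)"
    and t: "t \<in> {0..T}"
  shows "D t = D 0"
proof -
  have *: "norm (D t - D 0) \<le> e * (A t - A 0)" if "e > 0" for e
  proof -
    from small[OF that] obtain \<delta> where \<delta>: "\<delta> > 0"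
      "\<And>s t. 0 \<le> s \<Longrightarrow> s \<le> t \<Longrightarrow> t \<le> T \<Longrightarrow> t - s < \<delta> \<Longrightarrow> norm (D t - D s) \<le> e * (A t - A s)"
      by blast
    have step: "\<forall>t\<in>{0..T}. t \<le> real n * (\<delta>/2) \<longrightarrow> norm (D t - D 0) \<le> e * (A t - A 0)" for n
    proof (induction n)
      case 0
      then show ?case using \<delta>(2)[of 0 0] \<delta>(1) by auto
    next
      case (Suc n)
      show ?case
      proof (intro ballI impI)
        fix t assume t: "t \<in> {0..T}" "t \<le> real (Suc n) * (\<delta>/2)"
        show "norm (D t - D 0) \<le> e * (A t - A 0)"
        proof (cases "t \<le> real n * (\<delta>/2)")
          case True then show ?thesis using Suc t by auto
        next
          case False
          define s where "s = real n * (\<delta>/2)"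
          have s: "0 \<le> s" "s \<le> t" "s \<le> T" "t - s < \<delta>"
            using False t \<delta>(1) by (auto simp: s_def field_simps)
          have "norm (D s - D 0) \<le> e * (A s - A 0)" using Suc s by (auto simp: s_def)
          moreover have "norm (D t - D s) \<le> e * (A t - A s)" using \<delta>(2) s t by auto
          moreover have "norm (D t - D 0) \<le> norm (D t - D s) + norm (D s - D 0)"
            using norm_triangle_ineq[of "D t - D s" "D s - D 0"] by simp
          ultimately show ?thesis by (simp add: algebra_simps)
        qed
      qed
    qed
    obtain n :: nat where "t / (\<delta>/2) \<le> real n" using real_arch_simple by blast
    then have "t \<le> real n * (\<delta>/2)" using \<delta>(1) by (simp add: field_simps)
    with step t show ?thesis by blast
  qed
  have "norm (D t - D 0) \<le> 0"
  proof (rule field_le_epsilon)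
    fix e :: real assume e: "e > 0"
    define c where "c = e / (\<bar>A t - A 0\<bar> + 1)"
    have c: "c > 0" using e by (simp add: c_def add_nonneg_pos)
    have "norm (D t - D 0) \<le> c * (A t - A 0)" by (rule *[OF c])
    also have "\<dots> \<le> c * (\<bar>A t - A 0\<bar> + 1)" using c by (intro mult_left_mono) auto
    also have "\<dots> = e" unfolding c_def by (simp add: add_nonneg_pos[THEN less_imp_neq, symmetric])
    finally show "norm (D t - D 0) \<le> 0 + e" by simp
  qed
  then show ?thesis by simp
qed

lemma uniform_cont_interval:
  fixes f :: "real \<Rightarrow> 'a::real_normed_vector"
  assumes "continuous_on {0..T} f" "e > 0"
  obtains \<delta> where "\<delta> > 0" "\<And>s t. s \<in> {0..T} \<Longrightarrow> t \<in> {0..T} \<Longrightarrow> \<bar>t - s\<bar> < \<delta> \<Longrightarrow> norm (f t - f s) < e"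
  using compact_uniformly_continuous[OF assms(1)] assms(2)
  unfolding uniformly_continuous_on_def dist_norm real_norm_def
  by (metis compact_Icc)

lemma ac_norm_integral:
  assumes "a absolutely_integrable_on {0..T}"
  shows "ac T (\<lambda>t. integral {0..t} (\<lambda>x. norm (a x))) (\<lambda>x. norm (a x))"
  using set_integrable_norm[OF assms]
  by (intro ac_I_integral[where c = 0]) auto

text \<open>The errors e * (A t - A s) add up over a partition, so the difference between
  \<open>u\<close> and the integral of \<open>a\<close> cannot drift. The integrand \<open>c\<close>
  may depend on the interval, which suits the product and chain rules: they freeze the continuous
  factors at one point of a short interval.\<close>

lemma ac_eq_I:
  fixes u :: "real \<Rightarrow> 'a::euclidean_space"
  assumes a: "a absolutely_integrable_on {0..T}" and A: "ac T A b"
    and small: "\<And>e. e > 0 \<Longrightarrow> \<exists>\<delta>>0. \<forall>s t. 0 \<le> s \<longrightarrow> s \<le> t \<longrightarrow> t \<le> T \<longrightarrow> t - s < \<delta> \<longrightarrow>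
                  (\<exists>c. (c has_integral (u t - u s)) {s..t} \<and> (\<forall>r\<in>{s..t}. norm (c r - a r) \<le> e * b r))"
  shows "ac T u a"
proof -
  define D where "D t = u t - integral {0..t} a" for t
  have D: "D t = D 0" if "t \<in> {0..T}" for t
  proof (rule const_of_small_increments[OF _ that, of D A])
    fix e :: real assume "e > 0"
    from small[OF this] obtain \<delta> where \<delta>: "\<delta> > 0"
      "\<And>s t. 0 \<le> s \<Longrightarrow> s \<le> t \<Longrightarrow> t \<le> T \<Longrightarrow> t - s < \<delta> \<Longrightarrow>
        \<exists>c. (c has_integral (u t - u s)) {s..t} \<and> (\<forall>r\<in>{s..t}. norm (c r - a r) \<le> e * b r)"
      by metis
    have "norm (D t - D s) \<le> e * (A t - A s)" if st: "0 \<le> s" "s \<le> t" "t \<le> T" "t - s < \<delta>" for s t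
    proof -
      obtain c where c: "(c has_integral (u t - u s)) {s..t}" "\<And>r. r\<in>{s..t} \<Longrightarrow> norm (c r - a r) \<le> e * b r"
        using \<delta>(2)[OF st] by blast
      have "((\<lambda>r. e * b r) has_integral (e * (A t - A s))) {s..t}"
        by (intro has_integral_mult_right ac_interval[OF A] st)
      moreover have "((\<lambda>r. c r - a r) has_integral ((u t - u s) - integral {s..t} a)) {s..t}"
        using c(1) absint_integrable[OF a st(1,3)] by (intro has_integral_diff) auto
      ultimately have "norm ((u t - u s) - integral {s..t} a) \<le> e * (A t - A s)" (is "norm ?x \<le> ?y")
        using c(2) integral_norm_bound_integral[of "\<lambda>r. c r - a r" "{s..t}" "\<lambda>r. e * b r"]
        unfolding has_integral_iff by metis
      moreover have "integral {0..s} a + integral {s..t} a = integral {0..t} a"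
        using absint_integrable[OF a] st by (intro Henstock_Kurzweil_Integration.integral_combine) auto
      then have "D t - D s = (u t - u s) - integral {s..t} a" by (simp add: D_def algebra_simps)
      ultimately show ?thesis by simp
    qed
    with \<delta>(1) show "\<exists>\<delta>>0. \<forall>s t. 0 \<le> s \<longrightarrow> s \<le> t \<longrightarrow> t \<le> T \<longrightarrow> t - s < \<delta> \<longrightarrow>
                  norm (D t - D s) \<le> e * (A t - A s)" by blast
  qed
  show ?thesis
  proof (rule ac_I_integral[OF a])
    fix x assume "x \<in> {0..T}"
    from D[OF this] show "u x = u 0 + integral {0..x} a" by (simp add: D_def diff_eq_eq)
  qed
qed

lemma ac_mult:
  fixes u v :: "real \<Rightarrow> 'a::{euclidean_space,real_normed_field}"
  assumes u: "ac T u a" and v: "ac T v b"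
  shows "ac T (\<lambda>t. u t * v t) (\<lambda>t. a t * v t + u t * b t)"
proof (rule ac_eq_I)
  show "(\<lambda>t. a t * v t + u t * b t) absolutely_integrable_on {0..T}"
    by (intro set_integral_add absint_mult_cont absint_cont_mult ac_absint[OF u] ac_absint[OF v]
        ac_continuous_on[OF u] ac_continuous_on[OF v])
  show "ac T (\<lambda>t. integral {0..t} (\<lambda>x. norm (a x)) + integral {0..t} (\<lambda>x. norm (b x))) (\<lambda>x. norm (a x) + norm (b x))"
    by (intro ac_add ac_norm_integral ac_absint[OF u] ac_absint[OF v])
  fix e :: real assume e: "e > 0"
  obtain d1 where d1: "d1 > 0"
    "\<And>s t. s \<in> {0..T} \<Longrightarrow> t \<in> {0..T} \<Longrightarrow> \<bar>t - s\<bar> < d1 \<Longrightarrow> norm (u t - u s) < e"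
    using uniform_cont_interval[OF ac_continuous_on[OF u] e] by blast
  obtain d2 where d2: "d2 > 0"
    "\<And>s t. s \<in> {0..T} \<Longrightarrow> t \<in> {0..T} \<Longrightarrow> \<bar>t - s\<bar> < d2 \<Longrightarrow> norm (v t - v s) < e"
    using uniform_cont_interval[OF ac_continuous_on[OF v] e] by blast
  have "\<exists>c. (c has_integral (u t * v t - u s * v s)) {s..t} \<and>
            (\<forall>r\<in>{s..t}. norm (c r - (a r * v r + u r * b r)) \<le> e * (norm (a r) + norm (b r)))"
    if st: "0 \<le> s" "s \<le> t" "t \<le> T" "t - s < min d1 d2" for s t
  \<comment> \<open>Freezing \<open>v\<close> at the right end and \<open>u\<close> at the left end
    makes the increment of the product exact, without a second-order remainder.\<close>
  proof (intro exI[of _ "\<lambda>r. a r * v t + u s * b r"] conjI ballI)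
    have "((\<lambda>r. a r * v t + u s * b r) has_integral ((u t - u s) * v t + u s * (v t - v s))) {s..t}"
      by (intro has_integral_add has_integral_mult_left has_integral_mult_right
          ac_interval[OF u] ac_interval[OF v] st)
    then show "((\<lambda>r. a r * v t + u s * b r) has_integral u t * v t - u s * v s) {s..t}"
      by (simp add: algebra_simps)
    fix r assume r: "r \<in> {s..t}"
    have 1: "norm (v t - v r) \<le> e" using d2(2)[of r t] r st by force
    have 2: "norm (u s - u r) \<le> e" using d1(2)[of r s] r st by force
    have "a r * v t + u s * b r - (a r * v r + u r * b r) = a r * (v t - v r) + (u s - u r) * b r"
      by (simp add: algebra_simps)
    then have "norm (a r * v t + u s * b r - (a r * v r + u r * b r)) \<le> norm (a r) * norm (v t - v r) + norm (u s - u r) * norm (b r)"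
      by (metis norm_mult norm_triangle_ineq)
    also have "\<dots> \<le> norm (a r) * e + e * norm (b r)"
      using 1 2 by (intro add_mono mult_left_mono mult_right_mono) auto
    finally show "norm (a r * v t + u s * b r - (a r * v r + u r * b r)) \<le> e * (norm (a r) + norm (b r))"
      by (simp add: algebra_simps)
  qed
  moreover have "min d1 d2 > 0" using d1 d2 by simp
  ultimately show "\<exists>\<delta>>0. \<forall>s t. 0 \<le> s \<longrightarrow> s \<le> t \<longrightarrow> t \<le> T \<longrightarrow> t - s < \<delta> \<longrightarrow>
            (\<exists>c. (c has_integral (u t * v t - u s * v s)) {s..t} \<and>
            (\<forall>r\<in>{s..t}. norm (c r - (a r * v r + u r * b r)) \<le> e * (norm (a r) + norm (b r))))"
    by blast
qed

lemma ac_chain: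
  fixes u f f' :: "real \<Rightarrow> real"
  assumes u: "ac T u a" and f: "\<And>x. (f has_real_derivative f' x) (at x)"
    and f': "continuous_on UNIV f'"
  shows "ac T (\<lambda>t. f (u t)) (\<lambda>t. f' (u t) * a t)"
proof (rule ac_eq_I)
  have cu: "continuous_on {0..T} u" by (rule ac_continuous_on[OF u])
  have c: "continuous_on {0..T} (\<lambda>t. f' (u t))"
    using continuous_on_compose2[OF f' cu] by auto
  show "(\<lambda>t. f' (u t) * a t) absolutely_integrable_on {0..T}"
    by (rule absint_cont_mult[OF c ac_absint[OF u]])
  show "ac T (\<lambda>t. integral {0..t} (\<lambda>x. norm (a x))) (\<lambda>x. norm (a x))"
    by (rule ac_norm_integral[OF ac_absint[OF u]])
  fix e :: real assume e: "e > 0"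
  obtain d where d: "d > 0"
    "\<And>s t. s \<in> {0..T} \<Longrightarrow> t \<in> {0..T} \<Longrightarrow> \<bar>t - s\<bar> < d \<Longrightarrow> norm (f' (u t) - f' (u s)) < e"
    using uniform_cont_interval[OF c e] by blast
  have "\<exists>c. (c has_integral (f (u t) - f (u s))) {s..t} \<and>
            (\<forall>r\<in>{s..t}. norm (c r - f' (u r) * a r) \<le> e * norm (a r))"
    if st: "0 \<le> s" "s \<le> t" "t \<le> T" "t - s < d" for s t
  proof -
    have cst: "continuous_on {s..t} u" by (rule continuous_on_subset[OF cu]) (use st in auto)
    \<comment> \<open>The mean value theorem gives a value between u s and u t, and continuity of
      \<open>u\<close> attains it at some \<open>r0\<close>; freezing the derivative there is
      exact.\<close>
    obtain r0 where r0: "r0 \<in> {s..t}" "f (u t) - f (u s) = f' (u r0) * (u t - u s)"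
    proof (cases "u s" "u t" rule: linorder_cases)
      case less
      from MVT2[OF less, of f f'] f obtain z where z: "u s < z" "z < u t" "f (u t) - f (u s) = (u t - u s) * f' z"
        by blast
      obtain r where "r \<in> {s..t}" "u r = z" using IVT'[of u s z t] z st cst by auto
      with z that show ?thesis by (simp add: mult.commute)
    next
      case equal
      then show ?thesis using that[of s] st by auto
    next
      case greater
      from MVT2[OF greater, of f f'] f obtain z where z: "u t < z" "z < u s" "f (u s) - f (u t) = (u s - u t) * f' z"
        by blast
      obtain r where r: "r \<in> {s..t}" "u r = z" using IVT2'[of u t z s] z st cst by auto
      have "f (u t) - f (u s) = - ((u s - u t) * f' z)" using z(3) by simp
      also have "\<dots> = f' (u r) * (u t - u s)" using r by (simp add: algebra_simps)
      finally show ?thesis using that[OF r(1)] by simp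
    qed
    show ?thesis
    proof (intro exI[of _ "\<lambda>r. f' (u r0) * a r"] conjI ballI)
      show "((\<lambda>r. f' (u r0) * a r) has_integral f (u t) - f (u s)) {s..t}"
        unfolding r0(2) by (intro has_integral_mult_right ac_interval[OF u] st)
      fix r assume r: "r \<in> {s..t}"
      have "\<bar>f' (u r0) - f' (u r)\<bar> \<le> e" using d(2)[of r r0] r r0(1) st by force
      moreover have "f' (u r0) * a r - f' (u r) * a r = (f' (u r0) - f' (u r)) * a r"
        by (simp add: algebra_simps)
      ultimately show "norm (f' (u r0) * a r - f' (u r) * a r) \<le> e * norm (a r)"
        by (simp add: abs_mult mult_right_mono)
    qed
  qed
  with d(1) show "\<exists>\<delta>>0. \<forall>s t. 0 \<le> s \<longrightarrow> s \<le> t \<longrightarrow> t \<le> T \<longrightarrow> t - s < \<delta> \<longrightarrow>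
            (\<exists>c. (c has_integral (f (u t) - f (u s))) {s..t} \<and>
            (\<forall>r\<in>{s..t}. norm (c r - f' (u r) * a r) \<le> e * norm (a r)))"
    by blast
qed

lemma ac_unique_const:
  fixes u :: "real \<Rightarrow> 'a::euclidean_space"
  assumes "ac T u a" "\<And>x. x \<in> {0..T} \<Longrightarrow> a x = 0" "t \<in> {0..T}"
  shows "u t = u 0"
proof -
  have "(a has_integral (u t - u 0)) {0..t}" using assms by (auto simp: ac_def)
  moreover have "(a has_integral 0) {0..t}" using assms by (intro has_integral_is_0) auto
  ultimately have "u t - u 0 = 0" by (rule has_integral_unique)
  then show ?thesis by simp
qed

lemma has_real_derivative_min_square:
  "((\<lambda>x::real. (min x 0)\<^sup>2) has_real_derivative 2 * min x 0) (at x)"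
proof (cases x "0::real" rule: linorder_cases)
  case less
  have "((\<lambda>x::real. x\<^sup>2) has_real_derivative 2 * x) (at x)"
    by (auto intro!: derivative_eq_intros)
  then have "((\<lambda>x::real. (min x 0)\<^sup>2) has_real_derivative 2 * x) (at x)"
    by (rule has_field_derivative_transform_within_open[of _ _ _ "{..<0}"]) (use less in auto)
  then show ?thesis using less by simp
next
  case equal
  have "((\<lambda>h::real. (min h 0)\<^sup>2 / h) \<longlongrightarrow> 0) (at 0)"
  proof (rule Lim_null_comparison)
    show "\<forall>\<^sub>F h::real in at 0. norm ((min h 0)\<^sup>2 / h) \<le> \<bar>h\<bar>"
      by (auto simp: eventually_at_filter min_def power2_eq_square)
    show "((\<lambda>h::real. \<bar>h\<bar>) \<longlongrightarrow> 0) (at 0)" by (auto intro!: tendsto_eq_intros)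
  qed
  then show ?thesis using equal by (simp add: DERIV_def)
next
  case greater
  have "((\<lambda>x::real. 0) has_real_derivative 0) (at x)" by simp
  then have "((\<lambda>x::real. (min x 0)\<^sup>2) has_real_derivative 0) (at x)"
    by (rule has_field_derivative_transform_within_open[of _ _ _ "{0<..}"]) (use greater in auto)
  then show ?thesis using greater by simp
qed

lemma ac_exp:
  fixes A :: "real \<Rightarrow> real"
  assumes "ac T A a"
  shows "ac T (\<lambda>t. exp (c * A t)) (\<lambda>t. c * exp (c * A t) * a t)"
proof -
  have "ac T (\<lambda>t. exp (c * A t)) (\<lambda>t. (\<lambda>x. exp (c * x) * c) (A t) * a t)"
    by (rule ac_chain[OF assms]) (auto intro!: derivative_eq_intros continuous_intros)
  then show ?thesis by (simp add: mult_ac)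
qed

lemma ac_integral:
  "a absolutely_integrable_on {0..T} \<Longrightarrow> ac T (\<lambda>t. integral {0..t} a) a"
  by (rule ac_I_integral[where c = 0]) auto

lemma absint_integral_nonneg:
  fixes a :: "real \<Rightarrow> real"
  assumes "a absolutely_integrable_on {0..T}" "\<And>t. t \<in> {0..T} \<Longrightarrow> 0 \<le> a t" "t \<in> {0..T}"
  shows "0 \<le> integral {0..t} a"
  using assms absint_integrable[OF assms(1), of 0 t] by (intro integral_nonneg) auto

text \<open>Where \<open>d\<close> is negative, the derivative of (min d 0)^2 is at most 2 a times
  that square, so with the integrating factor exp (- 2 A) it cannot rise above its initial value
  0.\<close>

lemma comparison_nonneg:
  fixes d e a :: "real \<Rightarrow> real"
  assumes d: "ac T d e" and a: "a absolutely_integrable_on {0..T}"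
    and ineq: "\<And>t. t \<in> {0..T} \<Longrightarrow> - a t * \<bar>d t\<bar> \<le> e t"
    and d0: "0 \<le> d 0" and t: "t \<in> {0..T}"
  shows "0 \<le> d t"
proof -
  define A where "A t = integral {0..t} a" for t
  have A: "ac T A a" unfolding A_def by (rule ac_integral[OF a])
  \<comment> \<open>The square of the negative part is continuously differentiable, as
    \<open>ac_chain\<close> demands.\<close>
  define n where "n t = min (d t) 0" for t
  have f: "ac T (\<lambda>t. (n t)\<^sup>2) (\<lambda>t. 2 * n t * e t)"
    unfolding n_def by (rule ac_chain[OF d has_real_derivative_min_square]) (intro continuous_intros)
  define H' where "H' t = - 2 * exp (- 2 * A t) * a t * (n t)\<^sup>2 + exp (- 2 * A t) * (2 * n t * e t)" for t
  have H: "ac T (\<lambda>t. exp (- 2 * A t) * (n t)\<^sup>2) H'"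
    unfolding H'_def by (rule ac_mult[OF ac_exp[OF A] f])
  have neg: "H' x \<le> 0" if x: "x \<in> {0..T}" for x
  proof -
    have "n x * e x \<le> n x * (- a x * \<bar>d x\<bar>)"
      by (rule mult_left_mono_neg[OF ineq[OF x]]) (simp add: n_def)
    also have "\<dots> = a x * (n x)\<^sup>2" by (simp add: n_def min_def power2_eq_square abs_if)
    finally have "n x * e x - a x * (n x)\<^sup>2 \<le> 0" by simp
    then have "2 * exp (- 2 * A x) * (n x * e x - a x * (n x)\<^sup>2) \<le> 0"
      by (intro mult_nonneg_nonpos) auto
    then show ?thesis by (simp add: H'_def algebra_simps)
  qed
  have "- (exp (- 2 * A 0) * (n 0)\<^sup>2) \<le> - (exp (- 2 * A t) * (n t)\<^sup>2)"
    by (rule ac_nonneg_mono[OF ac_minus[OF H]]) (use t neg in auto)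
  moreover have "n 0 = 0" using d0 by (simp add: n_def)
  ultimately have "exp (- 2 * A t) * (n t)\<^sup>2 \<le> 0" by simp
  then have "n t = 0" by (simp add: mult_le_0_iff)
  then show ?thesis by (simp add: n_def min_def split: if_splits)
qed

text \<open>Once \<open>d\<close> is known to be nonnegative, |d| is d and the integrating factor
  exp A, which is at least 1, applies. A positive integral of \<open>b\<close> makes
  \<open>d\<close> strictly positive; the strict inequalities between angles come from here.\<close>

lemma comparison_lower:
  fixes d e a b :: "real \<Rightarrow> real"
  assumes d: "ac T d e" and a: "a absolutely_integrable_on {0..T}" "\<And>t. t \<in> {0..T} \<Longrightarrow> 0 \<le> a t"
    and b: "b absolutely_integrable_on {0..T}" "\<And>t. t \<in> {0..T} \<Longrightarrow> 0 \<le> b t"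
    and ineq: "\<And>t. t \<in> {0..T} \<Longrightarrow> b t - a t * \<bar>d t\<bar> \<le> e t"
    and d0: "0 \<le> d 0" and t: "t \<in> {0..T}"
  shows "d 0 + integral {0..t} b \<le> exp (integral {0..t} a) * d t"
proof -
  define A where "A t = integral {0..t} a" for t
  have A: "ac T A a" unfolding A_def by (rule ac_integral[OF a(1)])
  have dn: "0 \<le> d x" if "x \<in> {0..T}" for x
  proof (rule comparison_nonneg[OF d a(1) _ d0 that])
    fix t assume "t \<in> {0..T}"
    with ineq[OF this] b(2)[OF this] show "- a t * \<bar>d t\<bar> \<le> e t" by simp
  qed
  have K: "ac T (\<lambda>t. exp (1 * A t) * d t - integral {0..t} b)
        (\<lambda>t. (1 * exp (1 * A t) * a t * d t + exp (1 * A t) * e t) - b t)"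
    by (intro ac_diff ac_mult ac_exp A d ac_integral b)
  have "exp (1 * A 0) * d 0 - integral {0..0} b \<le> exp (1 * A t) * d t - integral {0..t} b"
  proof (rule ac_nonneg_mono[OF K])
    fix x assume "x \<in> {0..t}"
    then have x: "x \<in> {0..T}" using t by auto
    have "0 \<le> A x" unfolding A_def by (rule absint_integral_nonneg[OF a x])
    then have 1: "b x \<le> exp (A x) * b x" using b(2)[OF x] by (simp add: mult_le_cancel_right1)
    have "b x - a x * d x \<le> e x" using ineq[OF x] dn[OF x] by simp
    then have "exp (A x) * (b x - a x * d x) \<le> exp (A x) * e x" by simp
    with 1 show "0 \<le> (1 * exp (1 * A x) * a x * d x + exp (1 * A x) * e x) - b x"
      by (simp add: algebra_simps)
  qed (use t in auto)
  then show ?thesis by (simp add: A_def)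
qed

lemma gronwall_upper:
  fixes d e a b :: "real \<Rightarrow> real"
  assumes d: "ac T d e" and a: "a absolutely_integrable_on {0..T}" "\<And>t. t \<in> {0..T} \<Longrightarrow> 0 \<le> a t"
    and b: "b absolutely_integrable_on {0..T}" "\<And>t. t \<in> {0..T} \<Longrightarrow> 0 \<le> b t"
    and ineq: "\<And>t. t \<in> {0..T} \<Longrightarrow> e t \<le> b t + a t * d t"
    and t: "t \<in> {0..T}"
  shows "d t \<le> exp (integral {0..t} a) * (d 0 + integral {0..t} b)"
proof -
  define A where "A t = integral {0..t} a" for t
  have A: "ac T A a" unfolding A_def by (rule ac_integral[OF a(1)])
  have K: "ac T (\<lambda>t. integral {0..t} b - exp (-1 * A t) * d t)
        (\<lambda>t. b t - (-1 * exp (-1 * A t) * a t * d t + exp (-1 * A t) * e t))"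
    by (intro ac_diff ac_mult ac_exp A d ac_integral b)
  have "integral {0..0} b - exp (-1 * A 0) * d 0 \<le> integral {0..t} b - exp (-1 * A t) * d t"
  proof (rule ac_nonneg_mono[OF K])
    fix x assume "x \<in> {0..t}"
    then have x: "x \<in> {0..T}" using t by auto
    have "0 \<le> A x" unfolding A_def by (rule absint_integral_nonneg[OF a x])
    then have "exp (- A x) * b x \<le> b x" using b(2)[OF x] by (simp add: mult_le_cancel_right1 mult_le_cancel_right2)
    moreover have "exp (- A x) * e x \<le> exp (- A x) * (b x + a x * d x)" using ineq[OF x] by simp
    ultimately show "0 \<le> b x - (-1 * exp (-1 * A x) * a x * d x + exp (-1 * A x) * e x)"
      by (simp add: algebra_simps)
  qed (use t in auto)
  then have "exp (- A t) * d t \<le> d 0 + integral {0..t} b" by (simp add: A_def)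
  then have "exp (A t) * (exp (- A t) * d t) \<le> exp (A t) * (d 0 + integral {0..t} b)" by simp
  moreover have "exp (A t) * (exp (- A t) * d t) = d t" by (simp add: exp_minus)
  ultimately have "d t \<le> exp (A t) * (d 0 + integral {0..t} b)" by simp
  then show ?thesis by (simp add: A_def)
qed

text \<open>The right-hand side is merely integrable in time and its Lipschitz constant
  \<open>a t\<close> may be unbounded, so the solution is obtained as a fixed point of the integral
  operator.\<close>

lemma caratheodory_exists:
  fixes F :: "real \<Rightarrow> real \<Rightarrow> real"
  assumes T: "0 \<le> T"
    and a: "a absolutely_integrable_on {0..T}" "\<And>t. t \<in> {0..T} \<Longrightarrow> 0 \<le> a t"
    and F: "\<And>u. continuous_on {0..T} u \<Longrightarrow> (\<lambda>t. F t (u t)) absolutely_integrable_on {0..T}"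
    and lip: "\<And>t x y. t \<in> {0..T} \<Longrightarrow> \<bar>F t x - F t y\<bar> \<le> a t * \<bar>x - y\<bar>"
  shows "\<exists>u. ac T u (\<lambda>t. F t (u t)) \<and> u 0 = u0"
proof -
  define A where "A t = integral {0..t} a" for t
  have A: "ac T A a" unfolding A_def by (rule ac_integral[OF a(1)])
  have cA: "continuous_on {0..T} A" by (rule ac_continuous_on[OF A])
  \<comment> \<open>Bounded continuous functions live on the whole line here; clamping the time to
    {0..T} extends each iterate to one of them.\<close>
  define c where "c t = max 0 (min T t)" for t :: real
  have c: "c t \<in> {0..T}" for t using T by (auto simp: c_def)
  have c_id: "c t = t" if "t \<in> {0..T}" for t using that by (auto simp: c_def)
  have cc: "continuous_on UNIV c" unfolding c_def by (intro continuous_intros)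
  define \<Phi> where "\<Phi> v r = F r (exp (2 * A r) * apply_bcontfun v r)" for v r
  define I where "I v t = integral {0..t} (\<Phi> v)" for v t
  define G where "G v t = exp (- 2 * A t) * (u0 + I v t)" for v t
  \<comment> \<open>The weight \<open>exp (- 2 A)\<close> makes the Picard operator a contraction on the whole interval.\<close>
  define Op where "Op v = Bcontfun (\<lambda>t. G v (c t))" for v :: "real \<Rightarrow>\<^sub>C real"
  have cv: "continuous_on S (apply_bcontfun v)" for v :: "real \<Rightarrow>\<^sub>C real" and S
    by (rule continuous_on_apply_bcontfun)
  have Fv: "(\<Phi> v) absolutely_integrable_on {0..T}" for v
    unfolding \<Phi>_def by (intro F continuous_intros cA cv)
  have mem: "(\<lambda>t. G v (c t)) \<in> bcontfun" for v :: "real \<Rightarrow>\<^sub>C real"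
  proof -
    have cG: "continuous_on {0..T} (G v)"
      unfolding G_def I_def
      by (intro continuous_intros cA ac_continuous_on[OF ac_integral] Fv)
    have "continuous_on UNIV (\<lambda>t. G v (c t))"
      by (rule continuous_on_compose2[OF cG cc]) (use c in auto)
    moreover have "bounded (range (\<lambda>t. G v (c t)))"
      by (rule bounded_subset[OF compact_imp_bounded[OF compact_continuous_image[OF cG compact_Icc]]])
        (use c in auto)
    ultimately show ?thesis by (simp add: bcontfun_def)
  qed
  have Op: "apply_bcontfun (Op v) t = G v (c t)" for v t
    unfolding Op_def using mem[of v] by (simp add: Bcontfun_inverse)
  have contr: "dist (Op v) (Op w) \<le> 1/2 * dist v w" for v w
  proof (rule dist_bound)
    fix t0
    define t where "t = c t0"
    have t: "t \<in> {0..T}" using c by (simp add: t_def)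
    define D where "D = dist v w"
    have D: "D \<ge> 0" "\<And>r. \<bar>apply_bcontfun v r - apply_bcontfun w r\<bar> \<le> D"
      using dist_bounded[of v _ w] by (auto simp: D_def dist_real_def)
    \<comment> \<open>The derivative of D / 2 * exp (2 * A) is the bound D * exp (2 * A) * a on the
      integrand below; its denominator 2 becomes the contraction factor.\<close>
    have ch: "ac T (\<lambda>t. D / 2 * exp (2 * A t)) (\<lambda>t. D / 2 * (2 * exp (2 * A t) * a t))"
      by (intro ac_cmult ac_exp A)
    have ig: "((\<lambda>t. D / 2 * (2 * exp (2 * A t) * a t)) has_integral (D / 2 * exp (2 * A t) - D / 2)) {0..t}"
      using ac_interval[OF ch, of 0 t] t by (simp add: A_def)
    have "\<bar>I v t - I w t\<bar> \<le> D / 2 * exp (2 * A t) - D / 2"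
    proof -
      have i: "(\<Phi> x) integrable_on {0..t}" for x
        using absint_integrable[OF Fv] t by auto
      have "I v t - I w t = integral {0..t} (\<lambda>r. \<Phi> v r - \<Phi> w r)"
        unfolding I_def by (intro integral_diff[symmetric] i)
      also have "norm \<dots> \<le> integral {0..t} (\<lambda>t. D / 2 * (2 * exp (2 * A t) * a t))"
      proof (rule integral_norm_bound_integral)
        fix r assume "r \<in> {0..t}"
        then have r: "r \<in> {0..T}" using t by auto
        have "norm (\<Phi> v r - \<Phi> w r) \<le> a r * \<bar>exp (2 * A r) * apply_bcontfun v r - exp (2 * A r) * apply_bcontfun w r\<bar>"
          using lip[OF r] by (simp add: \<Phi>_def)
        also have "\<dots> = a r * (exp (2 * A r) * \<bar>apply_bcontfun v r - apply_bcontfun w r\<bar>)"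
          by (simp add: right_diff_distrib[symmetric] abs_mult)
        also have "\<dots> \<le> a r * (exp (2 * A r) * D)"
          by (intro mult_left_mono D a(2) r) auto
        finally show "norm (\<Phi> v r - \<Phi> w r) \<le> D / 2 * (2 * exp (2 * A r) * a r)"
          by (simp add: mult_ac)
      qed (use i ig in \<open>auto intro!: integrable_diff\<close>)
      also have "\<dots> = D / 2 * exp (2 * A t) - D / 2" using ig by (rule integral_unique)
      finally show ?thesis by simp
    qed
    then have "exp (- 2 * A t) * \<bar>I v t - I w t\<bar> \<le> exp (- 2 * A t) * (D / 2 * exp (2 * A t) - D / 2)"
      by (intro mult_left_mono) auto
    also have "\<dots> = D / 2 - D / 2 * exp (- 2 * A t)"
      by (simp add: algebra_simps exp_minus field_simps)
    also have "\<dots> \<le> D / 2" using D by simp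
    finally have "exp (- 2 * A t) * \<bar>I v t - I w t\<bar> \<le> D / 2" .
    moreover have "\<bar>G v t - G w t\<bar> = exp (- 2 * A t) * \<bar>I v t - I w t\<bar>"
      unfolding G_def by (simp add: right_diff_distrib[symmetric] abs_mult)
    ultimately show "dist (apply_bcontfun (Op v) t0) (apply_bcontfun (Op w) t0) \<le> 1/2 * dist v w"
      by (simp add: Op dist_real_def t_def[symmetric] D_def)
  qed
  have "\<exists>!v. Op v = v"
    by (rule banach_fix_type[of "1/2"]) (use contr in auto)
  then obtain v where v: "Op v = v" by blast
  define u where "u t = exp (2 * A t) * apply_bcontfun v t" for t
  have "u t = u0 + integral {0..t} (\<lambda>t. F t (u t))" if t: "t \<in> {0..T}" for t
  proof -
    have "apply_bcontfun v t = G v t" using Op[of v t] v c_id[OF t] by simp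
    then have "u t = exp (2 * A t) * exp (- 2 * A t) * (u0 + I v t)"
      by (simp add: u_def G_def)
    then have "u t = u0 + I v t" by (simp add: exp_add[symmetric])
    then show ?thesis by (simp add: I_def \<Phi>_def[abs_def] u_def)
  qed
  moreover have "(\<lambda>t. F t (u t)) absolutely_integrable_on {0..T}"
    using Fv[of v] by (simp add: \<Phi>_def[abs_def] u_def)
  ultimately have "ac T u (\<lambda>t. F t (u t))" by (intro ac_I_integral)
  moreover have "u 0 = u0" using Op[of v 0] v c_id[of 0] T by (simp add: u_def A_def G_def I_def)
  ultimately show ?thesis by blast
qed

section \<open>The Pruefer equation, its linear counterpart, and dependence on the spectral
  parameter\<close>

section \<open>Pruefer angles\<close>

lemma abs_sin_diff_le: "\<bar>sin x - sin y\<bar> \<le> \<bar>x - y\<bar>" for x y :: real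
proof -
  have "\<bar>sin x - sin y\<bar> = 2 * \<bar>sin ((x - y) / 2)\<bar> * \<bar>cos ((x + y) / 2)\<bar>"
    by (simp add: sin_diff_sin abs_mult)
  also have "\<dots> \<le> 2 * \<bar>(x - y) / 2\<bar> * 1"
    by (intro mult_mono abs_sin_x_le_abs_x abs_cos_le_one) auto
  finally show ?thesis by simp
qed

lemma abs_cos_diff_le: "\<bar>cos x - cos y\<bar> \<le> \<bar>x - y\<bar>" for x y :: real
  using abs_sin_diff_le[of "pi/2 - x" "pi/2 - y"] by (simp add: cos_sin_eq abs_minus_commute)

lemma abs_cos_square_diff_le: "\<bar>(cos x)\<^sup>2 - (cos y)\<^sup>2\<bar> \<le> \<bar>x - y\<bar>" for x y :: real
  using abs_cos_diff_le[of "2 * x" "2 * y"] by (simp add: cos_double_cos)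

lemma abs_sin_square_diff_le: "\<bar>(sin x)\<^sup>2 - (sin y)\<^sup>2\<bar> \<le> \<bar>x - y\<bar>" for x y :: real
  using abs_cos_square_diff_le[of x y] by (simp add: sin_squared_eq abs_minus_commute)

lemma ac_sin: "ac T u a \<Longrightarrow> ac T (\<lambda>t. sin (u t)) (\<lambda>t. cos (u t) * a t)" for u :: "real \<Rightarrow> real"
  by (rule ac_chain) (auto intro: DERIV_sin continuous_intros)

lemma ac_cos: "ac T u a \<Longrightarrow> ac T (\<lambda>t. cos (u t)) (\<lambda>t. - sin (u t) * a t)" for u :: "real \<Rightarrow> real"
  by (rule ac_chain[where f' = "\<lambda>x. - sin x"]) (auto intro!: derivative_eq_intros continuous_intros)

lemma ac_cmod_square:
  assumes "ac T y a"
  shows "ac T (\<lambda>t. (cmod (y t))\<^sup>2) (\<lambda>t. 2 * Re (cnj (y t) * a t))"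
proof -
  have "ac T (\<lambda>t. Re (y t * cnj (y t))) (\<lambda>t. Re (a t * cnj (y t) + y t * cnj (a t)))"
    by (intro ac_bounded_linear[OF bounded_linear_Re] ac_mult assms
        ac_bounded_linear[OF bounded_linear_cnj])
  then show ?thesis
    by (rule ac_cong) (auto simp: complex_norm_square[symmetric] complex_mult_cnj cmod_power2 simp flip: of_real_power)
qed

text \<open>Writing \<open>y = (r / k) sin \<theta>\<close> and \<open>y\<^sup>[\<^sup>1\<^sup>] = r cos \<theta>\<close>, the edge equation becomes
  \<open>\<theta>' = prufer_rhs s k lam t \<theta>\<close>. The scale \<open>k = 1\<close> gives monotonicity in \<open>lam\<close>,
  the scale \<open>k = sqrt lam\<close> gives the asymptotics.\<close>

definition prufer_rhs :: "(real \<Rightarrow> real) \<Rightarrow> real \<Rightarrow> real \<Rightarrow> real \<Rightarrow> real \<Rightarrow> real" where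
  "prufer_rhs s k lam t x = k * (cos x)\<^sup>2 + s t * sin (2 * x) + ((s t)\<^sup>2 + lam) / k * (sin x)\<^sup>2"

text \<open>A Lipschitz constant of \<open>prufer_rhs\<close> in the angle. It is integrable in t
  because s and its square are, and it is the coefficient in every comparison of two angles.\<close>

definition prufer_lip :: "(real \<Rightarrow> real) \<Rightarrow> real \<Rightarrow> real \<Rightarrow> real \<Rightarrow> real" where
  "prufer_lip s k lam t = k + 2 * \<bar>s t\<bar> + ((s t)\<^sup>2 + \<bar>lam\<bar>) / k"

lemma prufer_rhs_lipschitz:
  assumes "k > 0" "\<bar>lam\<bar> \<le> M"
  shows "\<bar>prufer_rhs s k lam t x - prufer_rhs s k lam t y\<bar> \<le> prufer_lip s k M t * \<bar>x - y\<bar>"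
proof -
  have "prufer_rhs s k lam t x - prufer_rhs s k lam t y =
      k * ((cos x)\<^sup>2 - (cos y)\<^sup>2) + s t * (sin (2*x) - sin (2*y)) + ((s t)\<^sup>2 + lam) / k * ((sin x)\<^sup>2 - (sin y)\<^sup>2)"
    by (simp add: prufer_rhs_def algebra_simps)
  also have "\<bar>\<dots>\<bar> \<le> \<bar>k * ((cos x)\<^sup>2 - (cos y)\<^sup>2)\<bar> + \<bar>s t * (sin (2*x) - sin (2*y))\<bar> + \<bar>((s t)\<^sup>2 + lam) / k * ((sin x)\<^sup>2 - (sin y)\<^sup>2)\<bar>"
    by (intro order_trans[OF abs_triangle_ineq add_right_mono] abs_triangle_ineq)
  also have "\<dots> \<le> k * \<bar>x - y\<bar> + \<bar>s t\<bar> * (2 * \<bar>x - y\<bar>) + ((s t)\<^sup>2 + \<bar>M\<bar>) / k * \<bar>x - y\<bar>"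
  proof (intro add_mono)
    show "\<bar>k * ((cos x)\<^sup>2 - (cos y)\<^sup>2)\<bar> \<le> k * \<bar>x - y\<bar>"
      using abs_cos_square_diff_le[of x y] assms by (simp add: abs_mult)
    show "\<bar>s t * (sin (2*x) - sin (2*y))\<bar> \<le> \<bar>s t\<bar> * (2 * \<bar>x - y\<bar>)"
    proof -
      have "\<bar>2 * x - 2 * y\<bar> = 2 * \<bar>x - y\<bar>"
        using abs_mult[of 2 "x - y"] by (simp add: right_diff_distrib)
      then show ?thesis using abs_sin_diff_le[of "2*x" "2*y"] by (simp only: abs_mult mult_left_mono abs_ge_zero)
    qed
    have "\<bar>(s t)\<^sup>2 + lam\<bar> \<le> (s t)\<^sup>2 + \<bar>M\<bar>" using assms by (smt (verit) zero_le_power2)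
    then have "\<bar>((s t)\<^sup>2 + lam) / k\<bar> \<le> ((s t)\<^sup>2 + \<bar>M\<bar>) / k"
      using assms by (simp add: divide_right_mono)
    then show "\<bar>((s t)\<^sup>2 + lam) / k * ((sin x)\<^sup>2 - (sin y)\<^sup>2)\<bar> \<le> ((s t)\<^sup>2 + \<bar>M\<bar>) / k * \<bar>x - y\<bar>"
      unfolding abs_mult[of "((s t)\<^sup>2 + lam) / k"]
      by (intro mult_mono abs_sin_square_diff_le) (use assms in auto)
  qed
  finally show ?thesis by (simp add: prufer_lip_def algebra_simps)
qed

lemma prufer_lip_nonneg: "k > 0 \<Longrightarrow> 0 \<le> prufer_lip s k M t"
  by (simp add: prufer_lip_def)

text \<open>The edge equation as a first-order system, over a general field so that the real
  solutions built from angles and the complex eigenfunctions share one notion.\<close>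

definition qsol :: "(real \<Rightarrow> real) \<Rightarrow> 'a::{euclidean_space,real_normed_field} \<Rightarrow> (real \<Rightarrow> 'a) \<Rightarrow> (real \<Rightarrow> 'a) \<Rightarrow> bool" where
  "qsol s lam y w \<longleftrightarrow> ac pi y (\<lambda>t. of_real (s t) * y t + w t) \<and>
     ac pi w (\<lambda>t. - of_real (s t) * w t - of_real ((s t)\<^sup>2) * y t - lam * y t)"

text \<open>All terms containing \<open>s\<close> cancel, since the system matrices have trace zero
  and differ only in the entry with the parameter. Equal parameters give a constant Wronskian; a
  conjugate pair gives the identity that excludes nonreal eigenvalues.\<close>

lemma qsol_wronskian:
  assumes "qsol s lam y w" "qsol s mu y' w'"
  shows "ac pi (\<lambda>t. y t * w' t - w t * y' t) (\<lambda>t. (lam - mu) * (y t * y' t))"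
proof -
  have "ac pi (\<lambda>t. y t * w' t - w t * y' t)
     (\<lambda>t. ((of_real (s t) * y t + w t) * w' t + y t * (- of_real (s t) * w' t - of_real ((s t)\<^sup>2) * y' t - mu * y' t))
        - ((- of_real (s t) * w t - of_real ((s t)\<^sup>2) * y t - lam * y t) * y' t + w t * (of_real (s t) * y' t + w' t)))"
    using assms unfolding qsol_def by (intro ac_diff ac_mult) auto
  then show ?thesis by (rule ac_cong) (auto simp: algebra_simps)
qed

lemma qsol_cnj:
  assumes "qsol s lam y w"
  shows "qsol s (cnj lam) (\<lambda>t. cnj (y t)) (\<lambda>t. cnj (w t))"
  using assms[unfolded qsol_def, THEN conjunct1, THEN ac_bounded_linear[OF bounded_linear_cnj]]
    assms[unfolded qsol_def, THEN conjunct2, THEN ac_bounded_linear[OF bounded_linear_cnj]]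
  by (simp add: qsol_def)

lemma qsol_of_real:
  assumes "qsol s (lam::real) y w"
  shows "qsol s (complex_of_real lam) (\<lambda>t. of_real (y t)) (\<lambda>t. of_real (w t))"
  using assms[unfolded qsol_def, THEN conjunct1, THEN ac_bounded_linear[OF bounded_linear_of_real[where 'a = complex]]]
    assms[unfolded qsol_def, THEN conjunct2, THEN ac_bounded_linear[OF bounded_linear_of_real[where 'a = complex]]]
  by (simp add: qsol_def)

lemma qsol_cmult:
  assumes "qsol s lam y w"
  shows "qsol s lam (\<lambda>t. c * y t) (\<lambda>t. c * w t)"
  using assms[unfolded qsol_def, THEN conjunct1, THEN ac_cmult[of _ _ _ c]]
    assms[unfolded qsol_def, THEN conjunct2, THEN ac_cmult[of _ _ _ c]]
  by (simp add: qsol_def algebra_simps)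

lemma qsol_add:
  assumes "qsol s lam y w" "qsol s lam y' w'"
  shows "qsol s lam (\<lambda>t. y t + y' t) (\<lambda>t. w t + w' t)"
  using ac_add[OF qsol_def[THEN iffD1, OF assms(1), THEN conjunct1] qsol_def[THEN iffD1, OF assms(2), THEN conjunct1]]
    ac_add[OF qsol_def[THEN iffD1, OF assms(1), THEN conjunct2] qsol_def[THEN iffD1, OF assms(2), THEN conjunct2]]
  by (simp add: qsol_def algebra_simps)

locale l2_potential =
  fixes s :: "real \<Rightarrow> real"
  assumes s_absint: "s absolutely_integrable_on {0..pi}"
    and s2_absint: "(\<lambda>t. (s t)\<^sup>2) absolutely_integrable_on {0..pi}"
begin

lemma prufer_lip_absint: "prufer_lip s k M absolutely_integrable_on {0..pi}"
proof -
  have "(\<lambda>t. k + 2 * \<bar>s t\<bar> + ((s t)\<^sup>2 + \<bar>M\<bar>) / k) absolutely_integrable_on {0..pi}"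
    by (intro set_integral_add set_integrable_mult_right const_absint set_integrable_abs
        s_absint s2_absint set_integrable_divide)
  then show ?thesis unfolding prufer_lip_def[abs_def] .
qed

lemma prufer_rhs_absint:
  assumes u: "continuous_on {0..pi} u"
  shows "(\<lambda>t. prufer_rhs s k lam t (u t)) absolutely_integrable_on {0..pi}"
  unfolding prufer_rhs_def
  by (intro set_integral_add absint_mult_cont absolutely_integrable_continuous_real
      continuous_intros u s_absint s2_absint const_absint set_integrable_divide)

definition prufer :: "real \<Rightarrow> real \<Rightarrow> (real \<Rightarrow> real) \<Rightarrow> bool" where
  "prufer k lam \<theta> \<longleftrightarrow> ac pi \<theta> (\<lambda>t. prufer_rhs s k lam t (\<theta> t))"

lemma prufer_exists: "k > 0 \<Longrightarrow> \<exists>\<theta>. prufer k lam \<theta> \<and> \<theta> 0 = \<theta>0"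
  unfolding prufer_def
  by (rule caratheodory_exists[where a = "prufer_lip s k \<bar>lam\<bar>"])
    (auto intro: prufer_lip_absint prufer_lip_nonneg prufer_rhs_absint prufer_rhs_lipschitz)

text \<open>The angle equation does not involve the amplitude. Given the angle, the amplitude solves
  r' = e * r, so it is an exponential and positive everywhere.\<close>

lemma prufer_qsol:
  assumes k: "k > 0" and p: "prufer k lam \<theta>"
  shows "\<exists>r. (\<forall>t. r t > 0) \<and> qsol s lam (\<lambda>t. r t / k * sin (\<theta> t)) (\<lambda>t. r t * cos (\<theta> t))"
proof -
  define q where "q t = ((s t)\<^sup>2 + lam) / k" for t
  \<comment> \<open>The logarithmic derivative of the amplitude, found by differentiating r^2 = (k
    y)^2 + w^2.\<close>
  define e where "e t = s t * ((sin (\<theta> t))\<^sup>2 - (cos (\<theta> t))\<^sup>2) + (k - q t) * (sin (\<theta> t) * cos (\<theta> t))" for t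
  have th: "ac pi \<theta> (\<lambda>t. k * (cos (\<theta> t))\<^sup>2 + s t * (2 * sin (\<theta> t) * cos (\<theta> t)) + q t * (sin (\<theta> t))\<^sup>2)"
    using p unfolding prufer_def prufer_rhs_def sin_double q_def .
  have c: "continuous_on {0..pi} \<theta>" by (rule ac_continuous_on[OF th])
  have "e absolutely_integrable_on {0..pi}"
    unfolding e_def[abs_def] q_def[abs_def]
    by (intro set_integral_add set_integral_diff absint_mult_cont s_absint s2_absint const_absint set_integrable_divide
        continuous_intros c)
  then have E: "ac pi (\<lambda>t. integral {0..t} e) e" by (rule ac_integral)
  define r where "r t = exp (1 * integral {0..t} e)" for t
  have r: "ac pi r (\<lambda>t. 1 * r t * e t)" unfolding r_def by (rule ac_exp[OF E])
  have y: "ac pi (\<lambda>t. 1 / k * (r t * sin (\<theta> t))) (\<lambda>t. of_real (s t) * (r t / k * sin (\<theta> t)) + r t * cos (\<theta> t))"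
  proof (rule ac_cong[OF ac_cmult[OF ac_mult[OF r ac_sin[OF th]]]])
    fix t
    have 1: "(sin (\<theta> t))\<^sup>2 + (cos (\<theta> t))\<^sup>2 = 1" by simp
    have "r t * e t * sin (\<theta> t) + r t * (cos (\<theta> t) * (k * (cos (\<theta> t))\<^sup>2 + s t * (2 * sin (\<theta> t) * cos (\<theta> t)) + q t * (sin (\<theta> t))\<^sup>2))
      = s t * (r t * sin (\<theta> t)) + k * (r t * cos (\<theta> t))"
      using 1 unfolding e_def by algebra
    then have "1 / k * (r t * e t * sin (\<theta> t) + r t * (cos (\<theta> t) * (k * (cos (\<theta> t))\<^sup>2 + s t * (2 * sin (\<theta> t) * cos (\<theta> t)) + q t * (sin (\<theta> t))\<^sup>2)))
      = 1 / k * (s t * (r t * sin (\<theta> t)) + k * (r t * cos (\<theta> t)))" by simp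
    also have "\<dots> = of_real (s t) * (r t / k * sin (\<theta> t)) + r t * cos (\<theta> t)"
      using k by (simp add: field_simps)
    finally show "1 / k * (1 * r t * e t * sin (\<theta> t) + r t * (cos (\<theta> t) * (k * (cos (\<theta> t))\<^sup>2 + s t * (2 * sin (\<theta> t) * cos (\<theta> t)) + q t * (sin (\<theta> t))\<^sup>2)))
      = of_real (s t) * (r t / k * sin (\<theta> t)) + r t * cos (\<theta> t)" by simp
  qed simp
  have w: "ac pi (\<lambda>t. r t * cos (\<theta> t)) (\<lambda>t. - of_real (s t) * (r t * cos (\<theta> t)) - of_real ((s t)\<^sup>2) * (r t / k * sin (\<theta> t)) - lam * (r t / k * sin (\<theta> t)))"
  proof (rule ac_cong[OF ac_mult[OF r ac_cos[OF th]]])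
    fix t
    have 1: "(sin (\<theta> t))\<^sup>2 + (cos (\<theta> t))\<^sup>2 = 1" by simp
    have "1 * r t * e t * cos (\<theta> t) + r t * (- sin (\<theta> t) * (k * (cos (\<theta> t))\<^sup>2 + s t * (2 * sin (\<theta> t) * cos (\<theta> t)) + q t * (sin (\<theta> t))\<^sup>2))
      = - s t * (r t * cos (\<theta> t)) - q t * (r t * sin (\<theta> t))"
      using 1 unfolding e_def by algebra
    also have "\<dots> = - of_real (s t) * (r t * cos (\<theta> t)) - of_real ((s t)\<^sup>2) * (r t / k * sin (\<theta> t)) - lam * (r t / k * sin (\<theta> t))"
      by (simp add: q_def add_divide_distrib distrib_left distrib_right)
    finally show "1 * r t * e t * cos (\<theta> t) + r t * (- sin (\<theta> t) * (k * (cos (\<theta> t))\<^sup>2 + s t * (2 * sin (\<theta> t) * cos (\<theta> t)) + q t * (sin (\<theta> t))\<^sup>2))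
      = - of_real (s t) * (r t * cos (\<theta> t)) - of_real ((s t)\<^sup>2) * (r t / k * sin (\<theta> t)) - lam * (r t / k * sin (\<theta> t))" .
  qed simp
  show ?thesis
    by (rule exI[of _ r]) (use y w in \<open>auto simp: qsol_def r_def\<close>)
qed

text \<open>An angle that is a multiple of pi / 2 describes the same initial ray at every scale, so
  both angles belong to proportional solutions and their Wronskian vanishes identically; this is the
  first claim. A distance of exactly pi / 2 would then force k cos^2 + sin^2 or k sin^2 + cos^2 to
  vanish, so by continuity the distance never reaches pi / 2.\<close>

lemma prufer_rescale:
  assumes k: "k > 0" and p: "prufer 1 lam \<theta>" "prufer k lam \<phi>" and eq: "\<theta> 0 = \<phi> 0"
    and st: "sin (\<theta> 0) = 0 \<or> cos (\<theta> 0) = 0" and t: "t \<in> {0..pi}"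
  shows "k * sin (\<theta> t) * cos (\<phi> t) = cos (\<theta> t) * sin (\<phi> t)" "\<bar>\<theta> t - \<phi> t\<bar> < pi / 2"
proof -
  obtain r where r: "\<And>t. r t > 0" "qsol s lam (\<lambda>t. r t / 1 * sin (\<theta> t)) (\<lambda>t. r t * cos (\<theta> t))"
    using prufer_qsol[of 1, OF _ p(1)] by auto
  obtain r' where r': "\<And>t. r' t > 0" "qsol s lam (\<lambda>t. r' t / k * sin (\<phi> t)) (\<lambda>t. r' t * cos (\<phi> t))"
    using prufer_qsol[OF k p(2)] by auto
  define W where "W t = r t / 1 * sin (\<theta> t) * (r' t * cos (\<phi> t)) - r t * cos (\<theta> t) * (r' t / k * sin (\<phi> t))" for t
  have W: "ac pi W (\<lambda>t. (lam - lam) * (r t / 1 * sin (\<theta> t) * (r' t / k * sin (\<phi> t))))"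
    unfolding W_def by (rule qsol_wronskian[OF r(2) r'(2)])
  have key: "k * sin (\<theta> t) * cos (\<phi> t) = cos (\<theta> t) * sin (\<phi> t)" if "t \<in> {0..pi}" for t
  proof -
    have "W t = W 0" by (rule ac_unique_const[OF W _ that]) simp
    also have "\<dots> = 0" using eq st by (auto simp: W_def)
    finally have "r t * r' t * (k * sin (\<theta> t) * cos (\<phi> t) - cos (\<theta> t) * sin (\<phi> t)) = 0"
      using k by (simp add: W_def field_simps)
    then show ?thesis using r(1)[of t] r'(1)[of t] by simp
  qed
  show "k * sin (\<theta> t) * cos (\<phi> t) = cos (\<theta> t) * sin (\<phi> t)" by (rule key[OF t])
  have neq: "\<bar>\<theta> t - \<phi> t\<bar> \<noteq> pi / 2" if "t \<in> {0..pi}" for t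
  proof
    assume "\<bar>\<theta> t - \<phi> t\<bar> = pi / 2"
    then have "\<theta> t = \<phi> t + pi/2 \<or> \<phi> t = \<theta> t + pi/2" by linarith
    then have "k * (cos (\<phi> t))\<^sup>2 + (sin (\<phi> t))\<^sup>2 = 0 \<or> k * (sin (\<theta> t))\<^sup>2 + (cos (\<theta> t))\<^sup>2 = 0"
      using key[OF that] by (auto simp: sin_add cos_add power2_eq_square)
    then have "(cos (\<phi> t))\<^sup>2 = 0 \<and> (sin (\<phi> t))\<^sup>2 = 0 \<or> (sin (\<theta> t))\<^sup>2 = 0 \<and> (cos (\<theta> t))\<^sup>2 = 0"
      using k by (metis add_nonneg_eq_0_iff mult_eq_0_iff mult_nonneg_nonneg not_less_iff_gr_or_eq order.order_iff_strict zero_le_power2)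
    then show False using sin_cos_squared_add[of "\<phi> t"] sin_cos_squared_add[of "\<theta> t"] by linarith
  qed
  show "\<bar>\<theta> t - \<phi> t\<bar> < pi / 2"
  proof (rule ccontr)
    assume "\<not> ?thesis"
    moreover have "continuous_on {0..t} (\<lambda>t. \<bar>\<theta> t - \<phi> t\<bar>)"
      using t p unfolding prufer_def
      by (intro continuous_intros continuous_on_subset[OF ac_continuous_on]) auto
    ultimately obtain x where "x \<in> {0..t}" "\<bar>\<theta> x - \<phi> x\<bar> = pi / 2"
      using IVT'[of "\<lambda>t. \<bar>\<theta> t - \<phi> t\<bar>" 0 "pi/2" t] eq t by auto
    then show False using neq[of x] t by auto
  qed
qed

text \<open>If the sine vanished throughout, the angle would move with speed 1 and turn by pi / 2 on
  {0..pi/2}, and sine and cosine of the initial angle would both be zero.\<close>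

lemma prufer_sin_nonzero:
  assumes p: "prufer 1 lam \<phi>"
  shows "\<exists>t\<in>{0..pi}. sin (\<phi> t) \<noteq> 0"
proof (rule ccontr)
  assume "\<not> ?thesis"
  then have s0: "sin (\<phi> t) = 0" if "t \<in> {0..pi}" for t using that by blast
  have "prufer_rhs s 1 lam t (\<phi> t) = 1" if "t \<in> {0..pi}" for t
  proof -
    have "(cos (\<phi> t))\<^sup>2 = 1" using s0[OF that] by (simp add: cos_squared_eq)
    then show ?thesis using s0[OF that] by (simp add: prufer_rhs_def sin_double)
  qed
  then have "ac pi \<phi> (\<lambda>_. 1)" using ac_cong[OF p[unfolded prufer_def], of \<phi> "\<lambda>_. 1"] by blast
  from ac_unique_const[OF ac_diff[OF this ac_id], of "pi/2"] have "\<phi> (pi/2) = \<phi> 0 + pi/2" by simp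
  then have "cos (\<phi> 0) = 0" using s0[of "pi/2"] by (simp add: sin_add)
  then show False using s0[of 0] sin_cos_squared_add[of "\<phi> 0"] by simp
qed

text \<open>At scale 1, raising lam to mu adds (mu - lam) sin^2 to the angular velocity. This is
  nonnegative, continuous in t and, by \<open>prufer_sin_nonzero\<close>, not identically
  zero.\<close>

lemma prufer_mono:
  assumes p: "prufer 1 lam \<theta>" "prufer 1 mu \<phi>" and eq: "\<theta> 0 = \<phi> 0" and lt: "lam < mu"
  shows "\<theta> pi < \<phi> pi"
proof -
  have d: "ac pi (\<lambda>t. \<phi> t - \<theta> t) (\<lambda>t. prufer_rhs s 1 mu t (\<phi> t) - prufer_rhs s 1 lam t (\<theta> t))"
    using p unfolding prufer_def by (intro ac_diff)
  have c: "continuous_on {0..pi} \<phi>" using p(2) unfolding prufer_def by (rule ac_continuous_on)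
  define b where "b t = (mu - lam) * (sin (\<phi> t))\<^sup>2" for t
  have cb: "continuous_on {0..pi} b" unfolding b_def by (intro continuous_intros c)
  have b: "b absolutely_integrable_on {0..pi}"
    by (rule absolutely_integrable_continuous_real[OF cb])
  have le: "(\<phi> 0 - \<theta> 0) + integral {0..pi} b \<le> exp (integral {0..pi} (prufer_lip s 1 \<bar>lam\<bar>)) * (\<phi> pi - \<theta> pi)"
  proof (rule comparison_lower[OF d prufer_lip_absint _ b])
    fix t :: real
    show "0 \<le> prufer_lip s 1 \<bar>lam\<bar> t" by (rule prufer_lip_nonneg) simp
    show "0 \<le> b t" using lt by (simp add: b_def)
    have "prufer_rhs s 1 mu t (\<phi> t) = prufer_rhs s 1 lam t (\<phi> t) + b t"
      by (simp add: prufer_rhs_def b_def algebra_simps)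
    with prufer_rhs_lipschitz[of 1 lam "\<bar>lam\<bar>" s t "\<phi> t" "\<theta> t"]
    show "b t - prufer_lip s 1 \<bar>lam\<bar> t * \<bar>\<phi> t - \<theta> t\<bar> \<le> prufer_rhs s 1 mu t (\<phi> t) - prufer_rhs s 1 lam t (\<theta> t)"
      by simp
  qed (use eq in auto)
  have "integral {0..pi} b > 0"
  proof (rule ccontr)
    assume "\<not> ?thesis"
    moreover have "0 \<le> integral {0..pi} b"
      using absint_integral_nonneg[OF b, of pi] lt by (simp add: b_def)
    ultimately have "integral {0..pi} b = 0" by simp
    then have "\<forall>t\<in>{0..pi}. b t = 0"
      using integral_eq_0_iff[OF cb] lt by (simp add: b_def)
    then have "\<forall>t\<in>{0..pi}. sin (\<phi> t) = 0" using lt by (auto simp: b_def)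
    with prufer_sin_nonzero[OF p(2)] show False by blast
  qed
  with le eq have "0 < exp (integral {0..pi} (prufer_lip s 1 \<bar>lam\<bar>)) * (\<phi> pi - \<theta> pi)" by simp
  then show ?thesis by (simp add: zero_less_mult_iff)
qed

text \<open>The additional velocity is at most mu - lam, so Gronwall's inequality bounds the gap.
  The constant depends only on \<open>M\<close>, which yields local Lipschitz continuity of the end
  angle in lam.\<close>

lemma prufer_lipschitz_lam:
  assumes p: "prufer 1 lam \<theta>" "prufer 1 mu \<phi>" and eq: "\<theta> 0 = \<phi> 0" and lt: "lam < mu"
    and M: "\<bar>lam\<bar> \<le> M" "\<bar>mu\<bar> \<le> M"
  shows "\<phi> pi - \<theta> pi \<le> exp (integral {0..pi} (prufer_lip s 1 M)) * pi * (mu - lam)"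
proof -
  have d: "ac pi (\<lambda>t. \<phi> t - \<theta> t) (\<lambda>t. prufer_rhs s 1 mu t (\<phi> t) - prufer_rhs s 1 lam t (\<theta> t))"
    using p unfolding prufer_def by (intro ac_diff)
  have rhs: "prufer_rhs s 1 mu t x = prufer_rhs s 1 lam t x + (mu - lam) * (sin x)\<^sup>2" for t x
    by (simp add: prufer_rhs_def algebra_simps)
  have dn: "0 \<le> \<phi> t - \<theta> t" if "t \<in> {0..pi}" for t
  proof (rule comparison_nonneg[OF d prufer_lip_absint _ _ that])
    fix t :: real
    have "0 \<le> (mu - lam) * (sin (\<phi> t))\<^sup>2" using lt by simp
    with rhs[of t "\<phi> t"] prufer_rhs_lipschitz[OF _ M(1), of 1 s t "\<phi> t" "\<theta> t"]
    show "- prufer_lip s 1 M t * \<bar>\<phi> t - \<theta> t\<bar> \<le> prufer_rhs s 1 mu t (\<phi> t) - prufer_rhs s 1 lam t (\<theta> t)"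
      by simp
  qed (use eq in auto)
  have "\<phi> pi - \<theta> pi \<le> exp (integral {0..pi} (prufer_lip s 1 M)) * ((\<phi> 0 - \<theta> 0) + integral {0..pi} (\<lambda>_. mu - lam))"
  proof (rule gronwall_upper[OF d prufer_lip_absint _ const_absint])
    fix t :: real
    show "0 \<le> prufer_lip s 1 M t" by (rule prufer_lip_nonneg) simp
    show "0 \<le> mu - lam" using lt by simp
    assume t: "t \<in> {0..pi}"
    have "(sin (\<phi> t))\<^sup>2 \<le> 1" by (simp add: abs_square_le_1)
    then have "(mu - lam) * (sin (\<phi> t))\<^sup>2 \<le> mu - lam" using lt by (simp add: mult_le_cancel_left1 mult_le_cancel_left2)
    with rhs[of t "\<phi> t"] prufer_rhs_lipschitz[OF _ M(1), of 1 s t "\<phi> t" "\<theta> t"] dn[OF t]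
    show "prufer_rhs s 1 mu t (\<phi> t) - prufer_rhs s 1 lam t (\<theta> t) \<le> mu - lam + prufer_lip s 1 M t * (\<phi> t - \<theta> t)"
      by simp
  qed simp
  then show ?thesis using eq by (simp add: mult_ac)
qed

text \<open>At angle 0 the velocity is 1, so the angle compares strictly with the constant
  0.\<close>

lemma prufer_pos:
  assumes p: "prufer 1 lam \<theta>" and nn: "\<theta> 0 \<ge> 0"
  shows "\<theta> pi > 0"
proof -
  have "\<theta> 0 + integral {0..pi} (\<lambda>_. 1) \<le> exp (integral {0..pi} (prufer_lip s 1 \<bar>lam\<bar>)) * \<theta> pi"
  proof (rule comparison_lower[OF p[unfolded prufer_def] prufer_lip_absint _ const_absint])
    fix t :: real
    show "0 \<le> prufer_lip s 1 \<bar>lam\<bar> t" by (rule prufer_lip_nonneg) simp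
    have "prufer_rhs s 1 lam t 0 = 1" by (simp add: prufer_rhs_def)
    with prufer_rhs_lipschitz[of 1 lam "\<bar>lam\<bar>" s t "\<theta> t" 0]
    show "1 - prufer_lip s 1 \<bar>lam\<bar> t * \<bar>\<theta> t\<bar> \<le> prufer_rhs s 1 lam t (\<theta> t)" by simp
  qed (use nn in auto)
  moreover have "integral {0..pi} (\<lambda>_. 1::real) = pi" by simp
  ultimately have "0 < exp (integral {0..pi} (prufer_lip s 1 \<bar>lam\<bar>)) * \<theta> pi" using nn pi_gt_zero by linarith
  then show ?thesis by (simp add: zero_less_mult_iff)
qed

text \<open>The cotangent u of the angle satisfies the Riccati equation u' = - (u + s)^2 - lam.
  Since (q + s)^2 \<le> 2 q^2 + 2 s^2, a function with q' = \<epsilon> - 2 s^2 satisfies q' \<le> -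
  (q + s)^2 - lam as soon as lam \<le> - (\<epsilon> + 2 q^2). This dictates \<open>q\<close> and
  \<open>lam\<close>, and the comparison angle is the one with cotangent \<open>q\<close>.\<close>

lemma prufer_small_lam:
  "\<exists>lam. \<forall>\<theta>. prufer 1 lam \<theta> \<and> \<theta> 0 \<le> pi / 2 \<longrightarrow> \<theta> pi < pi / 2"
proof -
  define S where "S t = integral {0..t} (\<lambda>t. (s t)\<^sup>2)" for t
  have S: "ac pi S (\<lambda>t. (s t)\<^sup>2)" unfolding S_def by (rule ac_integral[OF s2_absint])
  \<comment> \<open>Makes q pi = pi > 0, so the comparison angle ends below pi / 2; it starts at pi
    / 2 because q 0 = 0.\<close>
  define \<epsilon> where "\<epsilon> = 2 * S pi / pi + 1"
  define q where "q t = \<epsilon> * t - 2 * S t" for t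
  have q: "ac pi q (\<lambda>t. \<epsilon> * 1 - 2 * (s t)\<^sup>2)" unfolding q_def by (intro ac_diff ac_cmult ac_id S)
  have "bounded (q ` {0..pi})"
    by (intro compact_imp_bounded compact_continuous_image ac_continuous_on[OF q]) auto
  then obtain Q where Q: "\<And>t. t \<in> {0..pi} \<Longrightarrow> \<bar>q t\<bar> \<le> Q" unfolding bounded_iff by (metis image_eqI real_norm_def)
  define lam where "lam = - (\<epsilon> + 2 * Q\<^sup>2)"
  \<comment> \<open>\<open>v\<close> is a supersolution of the Pruefer equation lying below \<open>pi / 2\<close> at the end point.\<close>
  define v where "v t = pi / 2 - arctan (q t)" for t
  have "ac pi (\<lambda>t. arctan (q t)) (\<lambda>t. (\<lambda>x. inverse (1 + x\<^sup>2)) (q t) * (\<epsilon> * 1 - 2 * (s t)\<^sup>2))"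
  proof (rule ac_chain[OF q])
    show "continuous_on UNIV (\<lambda>x::real. inverse (1 + x\<^sup>2))"
      by (intro continuous_intros) (metis add_nonneg_eq_0_iff one_neq_zero zero_le_one zero_le_power2)
  qed (rule DERIV_arctan)
  then have v: "ac pi v (\<lambda>t. 0 - inverse (1 + (q t)\<^sup>2) * (\<epsilon> * 1 - 2 * (s t)\<^sup>2))"
    unfolding v_def by (intro ac_diff ac_const)
  have v_super: "prufer_rhs s 1 lam t (v t) \<le> 0 - inverse (1 + (q t)\<^sup>2) * (\<epsilon> * 1 - 2 * (s t)\<^sup>2)"
    if t: "t \<in> {0..pi}" for t
  proof -
    have p: "1 + (q t)\<^sup>2 > 0" by (simp add: add_pos_nonneg)
    have sv: "sin (v t) = 1 / sqrt (1 + (q t)\<^sup>2)" "cos (v t) = q t / sqrt (1 + (q t)\<^sup>2)"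
      by (simp_all add: v_def sin_diff cos_diff sin_arctan cos_arctan)
    have "prufer_rhs s 1 lam t (v t) = (q t)\<^sup>2 / (1 + (q t)\<^sup>2) + s t * (2 * q t) / (1 + (q t)\<^sup>2) + ((s t)\<^sup>2 + lam) / (1 + (q t)\<^sup>2)"
      using p by (simp add: prufer_rhs_def sin_double sv power_divide)
    also have "\<dots> = inverse (1 + (q t)\<^sup>2) * ((q t)\<^sup>2 + 2 * s t * q t + (s t)\<^sup>2 + lam)"
      by (simp add: divide_inverse algebra_simps)
    also have "\<dots> \<le> inverse (1 + (q t)\<^sup>2) * (- (\<epsilon> - 2 * (s t)\<^sup>2))"
    proof (rule mult_left_mono)
      have "(q t)\<^sup>2 \<le> Q\<^sup>2" using Q[OF t] by (metis abs_ge_zero power2_abs power_mono)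
      moreover have "0 \<le> (q t - s t)\<^sup>2" by simp
      ultimately show "(q t)\<^sup>2 + 2 * s t * q t + (s t)\<^sup>2 + lam \<le> - (\<epsilon> - 2 * (s t)\<^sup>2)"
        unfolding power2_diff lam_def by (simp add: algebra_simps)
      show "0 \<le> inverse (1 + (q t)\<^sup>2)" using p by simp
    qed
    finally show ?thesis by (simp add: minus_mult_right)
  qed
  have "\<theta> pi < pi / 2" if \<theta>: "prufer 1 lam \<theta>" "\<theta> 0 \<le> pi / 2" for \<theta>
  proof -
    have "0 \<le> v pi - \<theta> pi"
    proof (rule comparison_nonneg[OF ac_diff[OF v \<theta>(1)[unfolded prufer_def]] prufer_lip_absint])
      fix t assume "t \<in> {0..pi}"
      from v_super[OF this] prufer_rhs_lipschitz[of 1 lam "\<bar>lam\<bar>" s t "v t" "\<theta> t"]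
      show "- prufer_lip s 1 \<bar>lam\<bar> t * \<bar>v t - \<theta> t\<bar> \<le> (0 - inverse (1 + (q t)\<^sup>2) * (\<epsilon> * 1 - 2 * (s t)\<^sup>2)) - prufer_rhs s 1 lam t (\<theta> t)"
        by simp
    qed (use \<theta> in \<open>auto simp: v_def q_def S_def\<close>)
    moreover have "q pi > 0" by (simp add: q_def \<epsilon>_def field_simps)
    then have "arctan (q pi) > 0" by simp
    ultimately show ?thesis unfolding v_def by linarith
  qed
  then show ?thesis by blast
qed

text \<open>The growth rate of |y|^2 + |w|^2 is bounded by an integrable function, so Gronwall's
  inequality keeps this energy at zero.\<close>

lemma qsol_zero:
  assumes y: "qsol s (complex_of_real lam) y w" and "y 0 = 0" "w 0 = 0" and t: "t \<in> {0..pi}"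
  shows "y t = 0" "w t = 0"
proof -
  define a where "a t = prufer_lip s 1 lam t + (\<bar>lam\<bar> + (s t)\<^sup>2)" for t
  have a: "a absolutely_integrable_on {0..pi}"
    unfolding a_def[abs_def] by (intro set_integral_add prufer_lip_absint s2_absint const_absint)
  let ?y' = "\<lambda>t. of_real (s t) * y t + w t"
  let ?w' = "\<lambda>t. - of_real (s t) * w t - of_real ((s t)\<^sup>2) * y t - complex_of_real lam * y t"
  have u: "ac pi (\<lambda>t. (cmod (y t))\<^sup>2 + (cmod (w t))\<^sup>2) (\<lambda>t. 2 * Re (cnj (y t) * ?y' t) + 2 * Re (cnj (w t) * ?w' t))"
    using y unfolding qsol_def by (intro ac_add ac_cmod_square) auto
  have bound: "2 * Re (cnj (y t) * ?y' t) + 2 * Re (cnj (w t) * ?w' t) \<le> a t * ((cmod (y t))\<^sup>2 + (cmod (w t))\<^sup>2)" for t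
  proof -
    define Y W where "Y = cmod (y t)" and "W = cmod (w t)"
    have yw: "2 * (Y * W) \<le> Y\<^sup>2 + W\<^sup>2" using sum_squares_bound[of Y W] by simp
    have ny: "cmod (?y' t) \<le> \<bar>s t\<bar> * Y + W"
      unfolding Y_def W_def by (metis norm_mult norm_of_real norm_triangle_ineq)
    have nw: "cmod (?w' t) \<le> \<bar>s t\<bar> * W + ((s t)\<^sup>2 + \<bar>lam\<bar>) * Y"
    proof -
      have "cmod (?w' t) \<le> cmod (- of_real (s t) * w t) + cmod (of_real ((s t)\<^sup>2) * y t) + cmod (complex_of_real lam * y t)"
        by (meson add_right_mono norm_triangle_ineq4 order_trans)
      then show ?thesis by (simp add: norm_mult Y_def W_def norm_power algebra_simps)
    qed
    have "Re (cnj (y t) * ?y' t) \<le> cmod (cnj (y t) * ?y' t)" by (rule complex_Re_le_cmod)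
    also have "\<dots> \<le> Y * (\<bar>s t\<bar> * Y + W)" using ny by (simp add: norm_mult Y_def mult_left_mono)
    finally have 1: "Re (cnj (y t) * ?y' t) \<le> \<bar>s t\<bar> * Y\<^sup>2 + Y * W" by (simp add: algebra_simps power2_eq_square)
    have "Re (cnj (w t) * ?w' t) \<le> cmod (cnj (w t) * ?w' t)" by (rule complex_Re_le_cmod)
    also have "\<dots> \<le> W * (\<bar>s t\<bar> * W + ((s t)\<^sup>2 + \<bar>lam\<bar>) * Y)" using nw by (simp add: norm_mult W_def mult_left_mono)
    finally have 2: "Re (cnj (w t) * ?w' t) \<le> \<bar>s t\<bar> * W\<^sup>2 + ((s t)\<^sup>2 + \<bar>lam\<bar>) * (Y * W)" by (simp add: algebra_simps power2_eq_square)
    have "((s t)\<^sup>2 + \<bar>lam\<bar>) * (2 * (Y * W)) \<le> ((s t)\<^sup>2 + \<bar>lam\<bar>) * (Y\<^sup>2 + W\<^sup>2)"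
      by (intro mult_left_mono yw) auto
    moreover have "0 \<le> ((s t)\<^sup>2 + \<bar>lam\<bar>) * (Y\<^sup>2 + W\<^sup>2)" by simp
    moreover have "a t * (Y\<^sup>2 + W\<^sup>2) = (Y\<^sup>2 + W\<^sup>2) + 2 * (\<bar>s t\<bar> * Y\<^sup>2) + 2 * (\<bar>s t\<bar> * W\<^sup>2) + 2 * (((s t)\<^sup>2 + \<bar>lam\<bar>) * (Y\<^sup>2 + W\<^sup>2))"
      by (simp add: a_def prufer_lip_def algebra_simps)
    ultimately show ?thesis using 1 2 yw unfolding Y_def[symmetric] W_def[symmetric] by linarith
  qed
  have "(cmod (y t))\<^sup>2 + (cmod (w t))\<^sup>2 \<le> exp (integral {0..t} a) * (((cmod (y 0))\<^sup>2 + (cmod (w 0))\<^sup>2) + integral {0..t} (\<lambda>_. 0))"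
  proof (rule gronwall_upper[OF u a _ const_absint _ _ t])
    fix t show "0 \<le> a t" by (simp add: a_def prufer_lip_def)
    show "2 * Re (cnj (y t) * ?y' t) + 2 * Re (cnj (w t) * ?w' t) \<le> 0 + a t * ((cmod (y t))\<^sup>2 + (cmod (w t))\<^sup>2)"
      using bound[of t] by simp
  qed auto
  then have "(cmod (y t))\<^sup>2 + (cmod (w t))\<^sup>2 \<le> 0" using assms by simp
  then show "y t = 0" "w t = 0" by (auto simp: sum_power2_le_zero_iff)
qed

lemma qsol_proportional:
  assumes Y: "qsol s (complex_of_real lam) Y W" and y: "qsol s lam y w"
    and nz: "y 0 \<noteq> 0 \<or> w 0 \<noteq> 0" and eq: "Y 0 * of_real (w 0) = W 0 * of_real (y 0)"
  shows "\<exists>c. \<forall>t\<in>{0..pi}. Y t = c * of_real (y t) \<and> W t = c * of_real (w t)"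
proof -
  define c where "c = (if y 0 \<noteq> 0 then Y 0 / of_real (y 0) else W 0 / of_real (w 0))"
  have "qsol s (complex_of_real lam) (\<lambda>t. Y t + - c * of_real (y t)) (\<lambda>t. W t + - c * of_real (w t))"
    by (intro qsol_add qsol_cmult qsol_of_real Y y)
  moreover have "Y 0 + - c * of_real (y 0) = 0" "W 0 + - c * of_real (w 0) = 0"
    using nz eq by (auto simp: c_def field_simps)
  ultimately have "Y t + - c * of_real (y t) = 0 \<and> W t + - c * of_real (w t) = 0" if "t \<in> {0..pi}" for t
    using qsol_zero[OF _ _ _ that] by blast
  then show ?thesis by (intro exI[of _ c]) (auto simp: add_eq_0_iff)
qed

end

section \<open>Bessel's inequality and square-summable errors of the angles\<close>

section \<open>Asymptotics of Pruefer angles\<close>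

text \<open>This is Bessel's inequality for \<open>f\<close> cut off at \<open>t\<close>, while the
  system is orthogonal on the whole of {0..T}. With \<open>g\<close> the projection of the cut-off
  function, the square of f - g is expanded over {0..t} and the integral of g^2 is enlarged to
  {0..T}. The right-hand side grows with \<open>t\<close>, so its value at T bounds all cut-offs at
  once.\<close>

lemma bessel_inequality:
  fixes f :: "real \<Rightarrow> real" and e :: "'i \<Rightarrow> real \<Rightarrow> real"
  assumes N: "finite N" and c: "c > 0" and t: "t \<in> {0..T}"
    and f: "f absolutely_integrable_on {0..T}" "(\<lambda>x. (f x)\<^sup>2) absolutely_integrable_on {0..T}"
    and e: "\<And>i. i \<in> N \<Longrightarrow> continuous_on {0..T} (e i)"
    and orth: "\<And>i j. i \<in> N \<Longrightarrow> j \<in> N \<Longrightarrow>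
        ((\<lambda>x. e i x * e j x) has_integral (if i = j then c else 0)) {0..T}"
  shows "(\<Sum>i\<in>N. (integral {0..t} (\<lambda>x. f x * e i x))\<^sup>2) \<le> c * integral {0..t} (\<lambda>x. (f x)\<^sup>2)"
proof -
  define b where "b i = integral {0..t} (\<lambda>x. f x * e i x)" for i
  define g where "g x = (\<Sum>i\<in>N. b i / c * e i x)" for x
  have cg: "continuous_on {0..T} g" unfolding g_def by (intro continuous_intros e) (use c in auto)
  have fe: "((\<lambda>x. f x * e i x) has_integral b i) {0..t}" if "i \<in> N" for i
    unfolding b_def using absint_integrable[OF absint_mult_cont[OF f(1) e[OF that]]] t
    by (intro integrable_integral) auto
  have fg: "((\<lambda>x. f x * g x) has_integral (\<Sum>i\<in>N. b i / c * b i)) {0..t}"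
  proof -
    have "((\<lambda>x. \<Sum>i\<in>N. b i / c * (f x * e i x)) has_integral (\<Sum>i\<in>N. b i / c * b i)) {0..t}"
      by (intro has_integral_sum N has_integral_mult_right fe)
    then show ?thesis by (simp add: g_def sum_distrib_left mult_ac)
  qed
  have gg: "((\<lambda>x. (g x)\<^sup>2) has_integral (\<Sum>i\<in>N. b i / c * b i)) {0..T}"
  proof -
    have "((\<lambda>x. \<Sum>i\<in>N. \<Sum>j\<in>N. b i / c * (b j / c) * (e i x * e j x)) has_integral
       (\<Sum>i\<in>N. \<Sum>j\<in>N. b i / c * (b j / c) * (if i = j then c else 0))) {0..T}"
      by (intro has_integral_sum N has_integral_mult_right orth)
    moreover have "(\<Sum>j\<in>N. b i / c * (b j / c) * (if i = j then c else 0)) = b i / c * b i" if "i \<in> N" for i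
      using N that c by (simp add: if_distrib[of "\<lambda>x. _ * x"] cong: if_cong)
    moreover have "(\<Sum>i\<in>N. \<Sum>j\<in>N. b i / c * (b j / c) * (e i x * e j x)) = (g x)\<^sup>2" for x
      by (simp add: g_def power2_eq_square sum_product mult_ac)
    ultimately show ?thesis by simp
  qed
  have i2: "(\<lambda>x. (g x)\<^sup>2) integrable_on {0..T}" using gg by blast
  have gt: "(\<lambda>x. (g x)\<^sup>2) integrable_on {0..t}"
    by (rule integrable_subinterval_real[OF i2]) (use t in auto)
  have "integral {0..t} (\<lambda>x. (g x)\<^sup>2) \<le> integral {0..T} (\<lambda>x. (g x)\<^sup>2)"
    by (rule integral_subset_le[OF _ gt i2]) (use t in auto)
  also have "\<dots> = (\<Sum>i\<in>N. b i / c * b i)" using gg by (rule integral_unique)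
  finally have gle: "integral {0..t} (\<lambda>x. (g x)\<^sup>2) \<le> (\<Sum>i\<in>N. b i / c * b i)" .
  have f2: "(\<lambda>x. (f x)\<^sup>2) integrable_on {0..t}" using absint_integrable[OF f(2)] t by auto
  have "((\<lambda>x. (f x)\<^sup>2 - 2 * (f x * g x) + (g x)\<^sup>2) has_integral
      (integral {0..t} (\<lambda>x. (f x)\<^sup>2) - 2 * (\<Sum>i\<in>N. b i / c * b i) + integral {0..t} (\<lambda>x. (g x)\<^sup>2))) {0..t}"
    by (intro has_integral_add has_integral_diff has_integral_mult_right fg integrable_integral f2 gt)
  then have "((\<lambda>x. (f x - g x)\<^sup>2) has_integral
      (integral {0..t} (\<lambda>x. (f x)\<^sup>2) - 2 * (\<Sum>i\<in>N. b i / c * b i) + integral {0..t} (\<lambda>x. (g x)\<^sup>2))) {0..t}"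
    by (simp add: power2_diff algebra_simps)
  then have "0 \<le> integral {0..t} (\<lambda>x. (f x)\<^sup>2) - 2 * (\<Sum>i\<in>N. b i / c * b i) + integral {0..t} (\<lambda>x. (g x)\<^sup>2)"
    by (rule has_integral_nonneg) simp
  with gle have "(\<Sum>i\<in>N. b i / c * b i) \<le> integral {0..t} (\<lambda>x. (f x)\<^sup>2)" by linarith
  then have "c * (\<Sum>i\<in>N. b i / c * b i) \<le> c * integral {0..t} (\<lambda>x. (f x)\<^sup>2)"
    using c by simp
  moreover have "c * (\<Sum>i\<in>N. b i / c * b i) = (\<Sum>i\<in>N. (b i)\<^sup>2)"
    using c by (simp add: sum_distrib_left power2_eq_square)
  ultimately show ?thesis by (simp add: b_def)
qed

lemma has_integral_cos_period:
  fixes j :: int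
  assumes "j \<noteq> 0"
  shows "((\<lambda>x. cos (2 * of_int j * x)) has_integral 0) {0..pi}"
proof -
  have "((\<lambda>x. cos (2 * of_int j * x)) has_integral
      (sin (2 * of_int j * pi) / (2 * of_int j) - sin (2 * of_int j * 0) / (2 * of_int j))) {0..pi}"
    using assms by (intro fundamental_theorem_of_calculus)
      (auto intro!: derivative_eq_intros simp flip: has_real_derivative_iff_has_vector_derivative)
  moreover have "sin (2 * of_int j * pi) = 0"
    using sin_int_2pin[of j] by (simp add: mult_ac)
  ultimately show ?thesis by simp
qed

lemma cos_orthogonal:
  fixes i j :: nat
  assumes "i > 0" "j > 0"
  shows "((\<lambda>x. cos (2 * real i * x) * cos (2 * real j * x)) has_integral (if i = j then pi / 2 else 0)) {0..pi}"
proof -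
  have 1: "((\<lambda>x. cos (2 * of_int (int i - int j) * x)) has_integral (if i = j then pi else 0)) {0..pi}"
    using has_integral_cos_period[of "int i - int j"] has_integral_const_real[of "1::real" 0 pi] by auto
  have 2: "((\<lambda>x. cos (2 * of_int (int i + int j) * x)) has_integral 0) {0..pi}"
    using has_integral_cos_period[of "int i + int j"] assms by auto
  have "((\<lambda>x. (cos (2 * of_int (int i - int j) * x) + cos (2 * of_int (int i + int j) * x)) / 2)
     has_integral ((if i = j then pi else 0) + 0) / 2) {0..pi}"
    by (intro has_integral_divide has_integral_add 1 2)
  then show ?thesis
    by (auto simp: cos_times_cos algebra_simps if_distrib[of "\<lambda>x. x / 2"] cong: if_cong)
qed

lemma sin_orthogonal:
  fixes i j :: nat
  assumes "i > 0" "j > 0"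
  shows "((\<lambda>x. sin (2 * real i * x) * sin (2 * real j * x)) has_integral (if i = j then pi / 2 else 0)) {0..pi}"
proof -
  have 1: "((\<lambda>x. cos (2 * of_int (int i - int j) * x)) has_integral (if i = j then pi else 0)) {0..pi}"
    using has_integral_cos_period[of "int i - int j"] has_integral_const_real[of "1::real" 0 pi] by auto
  have 2: "((\<lambda>x. cos (2 * of_int (int i + int j) * x)) has_integral 0) {0..pi}"
    using has_integral_cos_period[of "int i + int j"] assms by auto
  have "((\<lambda>x. (cos (2 * of_int (int i - int j) * x) - cos (2 * of_int (int i + int j) * x)) / 2)
     has_integral ((if i = j then pi else 0) - 0) / 2) {0..pi}"
    by (intro has_integral_divide has_integral_diff 1 2)
  then show ?thesis
    by (auto simp: sin_times_sin algebra_simps if_distrib[of "\<lambda>x. x / 2"] cong: if_cong)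
qed

text \<open>The weighted integral of (x - y c)^2 is a nonnegative quadratic form in x and y. If the
  total weight is zero, nonnegativity forces the mixed coefficient to vanish; otherwise a suitable
  choice of x and y gives the discriminant inequality.\<close>

lemma weighted_cauchy_schwarz:
  fixes a c :: "real \<Rightarrow> real"
  assumes a: "a absolutely_integrable_on {0..T}" "\<And>t. t \<in> {0..T} \<Longrightarrow> 0 \<le> a t" and c: "continuous_on {0..T} c"
  shows "(integral {0..T} (\<lambda>t. a t * c t))\<^sup>2 \<le> integral {0..T} a * integral {0..T} (\<lambda>t. a t * (c t)\<^sup>2)"
proof -
  define I0 I1 I2 where "I0 = integral {0..T} a" and "I1 = integral {0..T} (\<lambda>t. a t * c t)"
    and "I2 = integral {0..T} (\<lambda>t. a t * (c t)\<^sup>2)"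
  have i0: "(a has_integral I0) {0..T}" unfolding I0_def
    by (intro integrable_integral absint_integrable[OF a(1)]) auto
  have i1: "((\<lambda>t. a t * c t) has_integral I1) {0..T}" unfolding I1_def
    by (intro integrable_integral absint_integrable[OF absint_mult_cont[OF a(1) c]]) auto
  have i2: "((\<lambda>t. a t * (c t)\<^sup>2) has_integral I2) {0..T}" unfolding I2_def
    by (intro integrable_integral absint_integrable[OF absint_mult_cont[OF a(1)]] continuous_intros c) auto
  have quad: "0 \<le> x\<^sup>2 * I0 - 2 * x * y * I1 + y\<^sup>2 * I2" for x y
  proof -
    have "((\<lambda>t. x\<^sup>2 * a t - 2 * x * y * (a t * c t) + y\<^sup>2 * (a t * (c t)\<^sup>2)) has_integral
        (x\<^sup>2 * I0 - 2 * x * y * I1 + y\<^sup>2 * I2)) {0..T}"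
      by (intro has_integral_add has_integral_diff has_integral_mult_right i0 i1 i2)
    then have "((\<lambda>t. a t * (x - y * c t)\<^sup>2) has_integral (x\<^sup>2 * I0 - 2 * x * y * I1 + y\<^sup>2 * I2)) {0..T}"
      by (simp add: power2_eq_square algebra_simps)
    then show ?thesis by (rule has_integral_nonneg) (use a(2) in auto)
  qed
  have "I0 \<ge> 0" using i0 by (rule has_integral_nonneg) (use a(2) in auto)
  show ?thesis
  proof (cases "I0 = 0")
    case True
    have "I1 = 0"
    proof (rule ccontr)
      assume "I1 \<noteq> 0"
      with quad[of "(I2 + 1) / (2 * I1)" 1] True show False by simp
    qed
    then show ?thesis using True by (simp add: I0_def I1_def)
  next
    case False
    with \<open>I0 \<ge> 0\<close> have "I0 > 0" by simp
    have "0 \<le> I0 * (I0 * I2 - I1\<^sup>2)" using quad[of I1 I0] by (simp add: power2_eq_square algebra_simps)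
    then have "0 \<le> I0 * I2 - I1\<^sup>2" using \<open>I0 > 0\<close> by (simp add: zero_le_mult_iff)
    then show ?thesis by (simp add: I0_def I1_def I2_def)
  qed
qed

lemma summable_square_add:
  fixes f g :: "nat \<Rightarrow> real"
  assumes "summable (\<lambda>n. (f n)\<^sup>2)" "summable (\<lambda>n. (g n)\<^sup>2)"
  shows "summable (\<lambda>n. (f n + g n)\<^sup>2)"
proof (rule summable_comparison_test)
  have "norm ((f n + g n)\<^sup>2) \<le> 2 * (f n)\<^sup>2 + 2 * (g n)\<^sup>2" for n
  proof -
    have "(f n + g n)\<^sup>2 \<le> 2 * (f n)\<^sup>2 + 2 * (g n)\<^sup>2"
      using sum_squares_bound[of "f n" "g n"] unfolding power2_sum by linarith
    then show ?thesis by simp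
  qed
  then show "\<exists>N. \<forall>n\<ge>N. norm ((f n + g n)\<^sup>2) \<le> 2 * (f n)\<^sup>2 + 2 * (g n)\<^sup>2" by blast
  show "summable (\<lambda>n. 2 * (f n)\<^sup>2 + 2 * (g n)\<^sup>2)"
    by (intro summable_add summable_mult assms)
qed

lemma summable_square_sum:
  fixes f :: "'i \<Rightarrow> nat \<Rightarrow> real"
  assumes "finite J" "\<And>j. j \<in> J \<Longrightarrow> summable (\<lambda>n. (f j n)\<^sup>2)"
  shows "summable (\<lambda>n. (\<Sum>j\<in>J. f j n)\<^sup>2)"
  using assms by (induction J rule: finite_induct) (auto intro: summable_square_add)

lemma summable_bounded_partial_sums:
  fixes f :: "nat \<Rightarrow> real"
  assumes "\<And>n. 0 \<le> f n" "\<And>N. finite N \<Longrightarrow> N \<subseteq> {0<..} \<Longrightarrow> (\<Sum>n\<in>N. f n) \<le> B"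
  shows "summable (\<lambda>n. f (Suc n))"
proof (rule bounded_imp_summable)
  fix n
  have "(\<Sum>k\<le>n. f (Suc k)) = (\<Sum>k\<in>Suc ` {..n}. f k)" by (simp add: sum.reindex)
  also have "\<dots> \<le> B" by (rule assms(2)) auto
  finally show "(\<Sum>k\<le>n. f (Suc k)) \<le> B" .
qed (use assms in auto)

context l2_potential
begin

text \<open>The first series is Bessel's inequality at t = pi. In the second, Cauchy-Schwarz with
  weight \<open>a\<close> moves the square inside the integral, and Bessel's inequality at each
  \<open>t\<close> with the same constant \<open>K\<close> allows summation under the
  integral.\<close>

lemma square_summable_fourier:
  fixes e :: "nat \<Rightarrow> real \<Rightarrow> real" and a :: "real \<Rightarrow> real"
  assumes e: "\<And>i. continuous_on {0..pi} (e i)"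
    and orth: "\<And>i j. i > 0 \<Longrightarrow> j > 0 \<Longrightarrow> ((\<lambda>x. e i x * e j x) has_integral (if i = j then pi / 2 else 0)) {0..pi}"
    and a: "a absolutely_integrable_on {0..pi}" "\<And>t. t \<in> {0..pi} \<Longrightarrow> 0 \<le> a t"
  shows "summable (\<lambda>n. (integral {0..pi} (\<lambda>x. s x * e (Suc n) x))\<^sup>2)"
    and "summable (\<lambda>n. (integral {0..pi} (\<lambda>t. a t * \<bar>integral {0..t} (\<lambda>x. s x * e (Suc n) x)\<bar>))\<^sup>2)"
proof -
  define c where "c n t = integral {0..t} (\<lambda>x. s x * e n x)" for n t
  define K where "K = pi / 2 * integral {0..pi} (\<lambda>x. (s x)\<^sup>2)"
  have bes: "(\<Sum>n\<in>N. (c n t)\<^sup>2) \<le> K" if N: "finite N" "N \<subseteq> {0<..}" and t: "t \<in> {0..pi}" for N t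
  proof -
    have "(\<Sum>n\<in>N. (c n t)\<^sup>2) \<le> pi / 2 * integral {0..t} (\<lambda>x. (s x)\<^sup>2)"
      unfolding c_def using N
      by (intro bessel_inequality[OF N(1) _ t s_absint s2_absint] e orth) auto
    also have "\<dots> \<le> K"
      unfolding K_def using t absint_integrable[OF s2_absint]
      by (intro mult_left_mono integral_subset_le) auto
    finally show ?thesis .
  qed
  show "summable (\<lambda>n. (integral {0..pi} (\<lambda>x. s x * e (Suc n) x))\<^sup>2)"
    using summable_bounded_partial_sums[of "\<lambda>n. (c n pi)\<^sup>2" K] bes[of _ pi] unfolding c_def by simp
  have cc: "continuous_on {0..pi} (c n)" for n
    unfolding c_def by (intro ac_continuous_on[OF ac_integral] absint_mult_cont s_absint e)
  define I where "I = integral {0..pi} a"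
  have I: "I \<ge> 0" unfolding I_def using absint_integral_nonneg[OF a, of pi] by simp
  have "(\<Sum>n\<in>N. (integral {0..pi} (\<lambda>t. a t * \<bar>c n t\<bar>))\<^sup>2) \<le> I * (I * K)"
    if N: "finite N" "N \<subseteq> {0<..}" for N
  proof -
    have ai: "(\<lambda>t. a t * (c n t)\<^sup>2) integrable_on {0..pi}" for n
      by (intro absint_integrable[OF absint_mult_cont[OF a(1)]] continuous_intros cc) auto
    have "(\<Sum>n\<in>N. (integral {0..pi} (\<lambda>t. a t * \<bar>c n t\<bar>))\<^sup>2) \<le> (\<Sum>n\<in>N. I * integral {0..pi} (\<lambda>t. a t * (c n t)\<^sup>2))"
      unfolding I_def using weighted_cauchy_schwarz[OF a continuous_on_rabs[OF cc]]
      by (intro sum_mono) simp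
    also have "\<dots> = I * integral {0..pi} (\<lambda>t. \<Sum>n\<in>N. a t * (c n t)\<^sup>2)"
      by (simp only: sum_distrib_left[of I, symmetric] integral_sum[OF N(1) ai])
    also have "\<dots> \<le> I * integral {0..pi} (\<lambda>t. a t * K)"
    proof (intro mult_left_mono integral_le I)
      show "(\<lambda>t. \<Sum>n\<in>N. a t * (c n t)\<^sup>2) integrable_on {0..pi}" by (intro integrable_sum N ai)
      show "(\<lambda>t. a t * K) integrable_on {0..pi}"
        using absint_integrable[OF a(1)] by (intro integrable_on_mult_left) auto
      fix t assume t: "t \<in> {0..pi}"
      show "(\<Sum>n\<in>N. a t * (c n t)\<^sup>2) \<le> a t * K"
        unfolding sum_distrib_left[symmetric] by (intro mult_left_mono bes N t a(2))
    qed
    also have "\<dots> = I * (I * K)" by (simp add: I_def)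
    finally show ?thesis .
  qed
  from summable_bounded_partial_sums[OF _ this]
  show "summable (\<lambda>n. (integral {0..pi} (\<lambda>t. a t * \<bar>integral {0..t} (\<lambda>x. s x * e (Suc n) x)\<bar>))\<^sup>2)"
    unfolding c_def by simp
qed

text \<open>\<open>\<eta> n\<close> is chosen before r and \<theta>, so it serves every solution in
  the window. The condition n \<ge> 4 ensures r \<ge> n / 2 and r \<ge> 1 there.\<close>

lemma prufer_asymptotics:
  "\<exists>\<eta>. (\<forall>n. 0 \<le> \<eta> n) \<and> summable (\<lambda>n. (\<eta> (Suc n))\<^sup>2) \<and>
     (\<forall>n r \<theta>. n \<ge> 4 \<longrightarrow> \<bar>r - real n\<bar> \<le> 2 \<longrightarrow> prufer r (r\<^sup>2) \<theta> \<longrightarrow> \<bar>\<theta> pi - \<theta> 0 - r * pi\<bar> \<le> \<eta> n)"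
proof -
  \<comment> \<open>Bounds twice the derivative of the slow phase below: |r - n| \<le> 2, and the
    potential terms are at most |s| + s^2 because r \<ge> 1.\<close>
  define a where "a t = 2 * (2 + \<bar>s t\<bar> + (s t)\<^sup>2)" for t
  have a: "a absolutely_integrable_on {0..pi}"
    unfolding a_def[abs_def]
    by (intro set_integrable_mult_right set_integral_add const_absint set_integrable_abs s_absint s2_absint)
  have a0: "0 \<le> a t" for t by (simp add: a_def)
  define C where "C n t = integral {0..t} (\<lambda>x. s x * cos (2 * real n * x))" for n :: nat and t
  define D where "D n t = integral {0..t} (\<lambda>x. s x * sin (2 * real n * x))" for n :: nat and t
  have acC: "ac pi (C n) (\<lambda>x. s x * cos (2 * real n * x))" for n
    unfolding C_def by (intro ac_integral absint_mult_cont s_absint continuous_intros)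
  have acD: "ac pi (D n) (\<lambda>x. s x * sin (2 * real n * x))" for n
    unfolding D_def by (intro ac_integral absint_mult_cont s_absint continuous_intros)
  define S where "S = integral {0..pi} (\<lambda>x. (s x)\<^sup>2)"
  have S: "S \<ge> 0" unfolding S_def using absint_integral_nonneg[OF s2_absint, of pi] by simp
  define aC where "aC n = integral {0..pi} (\<lambda>t. a t * \<bar>C n t\<bar>)" for n
  define aD where "aD n = integral {0..pi} (\<lambda>t. a t * \<bar>D n t\<bar>)" for n
  have iC: "((\<lambda>t. a t * \<bar>C n t\<bar>) has_integral aC n) {0..pi}" for n
    unfolding aC_def
    by (intro integrable_integral absint_integrable[OF absint_mult_cont[OF a]] continuous_intros ac_continuous_on[OF acC]) auto
  have iD: "((\<lambda>t. a t * \<bar>D n t\<bar>) has_integral aD n) {0..pi}" for n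
    unfolding aD_def
    by (intro integrable_integral absint_integrable[OF absint_mult_cont[OF a]] continuous_intros ac_continuous_on[OF acD]) auto
  have aCD0: "aC n \<ge> 0" "aD n \<ge> 0" for n
    using has_integral_nonneg[OF iC] has_integral_nonneg[OF iD] a0 by auto
  define \<eta> where "\<eta> n = \<bar>C n pi\<bar> + \<bar>D n pi\<bar> + aC n + aD n + 2 * S / real n" for n
  have contC: "continuous_on {0..pi} (\<lambda>x. cos (2 * real i * x))"
    and contD: "continuous_on {0..pi} (\<lambda>x. sin (2 * real i * x))" for i
    by (intro continuous_intros)+
  have "summable (\<lambda>n. (C (Suc n) pi)\<^sup>2)" "summable (\<lambda>n. (aC (Suc n))\<^sup>2)"
    using square_summable_fourier[OF contC cos_orthogonal a a0] unfolding C_def aC_def by blast+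
  moreover have "summable (\<lambda>n. (D (Suc n) pi)\<^sup>2)" "summable (\<lambda>n. (aD (Suc n))\<^sup>2)"
    using square_summable_fourier[OF contD sin_orthogonal a a0] unfolding D_def aD_def by blast+
  moreover have "summable (\<lambda>n. (2 * S / real (Suc n))\<^sup>2)"
  proof -
    have "summable (\<lambda>n. 1 / (real (Suc n))\<^sup>2)"
      using inverse_power_summable[of 2, where 'a = real] by (subst summable_Suc_iff) (simp add: inverse_eq_divide)
    then have "summable (\<lambda>n. (2 * S)\<^sup>2 * (1 / (real (Suc n))\<^sup>2))" by (rule summable_mult)
    then show ?thesis by (simp add: power_divide)
  qed
  ultimately have sum: "summable (\<lambda>n. (\<eta> (Suc n))\<^sup>2)"
    unfolding \<eta>_def by (intro summable_square_add) auto
  have bound: "\<bar>\<theta> pi - \<theta> 0 - r * pi\<bar> \<le> \<eta> n"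
    if n: "n \<ge> 4" and r: "\<bar>r - real n\<bar> \<le> 2" and p: "prufer r (r\<^sup>2) \<theta>" for n r \<theta>
  proof -
    have r2: "r \<ge> real n / 2" "r \<ge> 1" using n r by linarith+
    then have rinv: "1 / r \<le> 2 / real n" "1 / r \<le> 1" using n by (auto simp: field_simps)
    define f where "f t = s t * sin (2 * \<theta> t) + (s t)\<^sup>2 / r * (sin (\<theta> t))\<^sup>2" for t
    \<comment> \<open>With scale r and lam = r^2 the large terms combine to r (cos^2 + sin^2) =
      r.\<close>
    have rhs: "prufer_rhs s r (r\<^sup>2) t (\<theta> t) = r + f t" for t
    proof -
      have "r * (cos (\<theta> t))\<^sup>2 + (r\<^sup>2 / r) * (sin (\<theta> t))\<^sup>2 = r"
        using r2 by (simp add: power2_eq_square[of r] distrib_left[symmetric])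
      then show ?thesis unfolding prufer_rhs_def f_def by (simp add: add_divide_distrib algebra_simps)
    qed
    have th: "ac pi \<theta> (\<lambda>t. r + f t)" using p unfolding prufer_def rhs .
    \<comment> \<open>Removing n t leaves a phase whose derivative has an integrable bound
      independent of n; the fast oscillation is carried by sin (2 n t) and cos (2 n t)
      alone.\<close>
    define \<beta> where "\<beta> t = \<theta> t - real n * t" for t
    define \<beta>' where "\<beta>' t = (r + f t) - real n * 1" for t
    have \<beta>: "ac pi \<beta> \<beta>'" unfolding \<beta>_def \<beta>'_def by (intro ac_diff th ac_cmult ac_id)
    have \<beta>2: "ac pi (\<lambda>t. 2 * \<beta> t) (\<lambda>t. 2 * \<beta>' t)" by (rule ac_cmult[OF \<beta>])
    \<comment> \<open>\<open>P\<close> is the boundary term in the integration by parts of \<open>s sin (2 \<theta>)\<close>, where the factors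
      \<open>s cos (2 n t)\<close> and \<open>s sin (2 n t)\<close> are integrated.\<close>
    define P where "P t = D n t * cos (2 * \<beta> t) + C n t * sin (2 * \<beta> t)" for t
    have P: "ac pi P (\<lambda>t. (s t * sin (2 * real n * t) * cos (2 * \<beta> t) + D n t * (- sin (2 * \<beta> t) * (2 * \<beta>' t)))
       + (s t * cos (2 * real n * t) * sin (2 * \<beta> t) + C n t * (cos (2 * \<beta> t) * (2 * \<beta>' t))))"
      unfolding P_def by (intro ac_add ac_mult acC acD ac_cos ac_sin \<beta>2)
    define Q' where "Q' t = (s t)\<^sup>2 / r * (sin (\<theta> t))\<^sup>2 - 2 * \<beta>' t * (C n t * cos (2 * \<beta> t) - D n t * sin (2 * \<beta> t))" for t
    have Q: "ac pi (\<lambda>t. \<theta> t - r * t - P t) Q'"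
    proof (rule ac_cong[OF ac_diff[OF ac_diff[OF th ac_cmult[OF ac_id]] P]])
      fix t
      have "2 * \<theta> t = 2 * real n * t + 2 * \<beta> t" by (simp add: \<beta>_def)
      then have "sin (2 * \<theta> t) = sin (2 * real n * t) * cos (2 * \<beta> t) + cos (2 * real n * t) * sin (2 * \<beta> t)"
        by (simp only: sin_add)
      then show "(r + f t) - r * 1 - ((s t * sin (2 * real n * t) * cos (2 * \<beta> t) + D n t * (- sin (2 * \<beta> t) * (2 * \<beta>' t)))
       + (s t * cos (2 * real n * t) * sin (2 * \<beta> t) + C n t * (cos (2 * \<beta> t) * (2 * \<beta>' t)))) = Q' t"
        unfolding f_def Q'_def by (simp add: algebra_simps)
    qed simp
    have sq1: "(sin x)\<^sup>2 \<le> 1" for x :: real by (simp add: abs_square_le_1)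
    have s2: "(s t)\<^sup>2 / r * (sin x)\<^sup>2 \<le> 1 / r * (s t)\<^sup>2" for t x
      using mult_left_mono[OF sq1[of x], of "(s t)\<^sup>2 / r"] r2 by simp
    have s2': "1 / r * (s t)\<^sup>2 \<le> (s t)\<^sup>2" for t
      using mult_right_mono[OF rinv(2), of "(s t)\<^sup>2"] by simp
    have Qb: "norm (Q' t) \<le> 1 / r * (s t)\<^sup>2 + (a t * \<bar>C n t\<bar> + a t * \<bar>D n t\<bar>)" for t
    proof -
      have "\<bar>s t * sin (2 * \<theta> t)\<bar> \<le> \<bar>s t\<bar>" by (simp add: abs_mult mult_left_le)
      moreover have "\<bar>(s t)\<^sup>2 / r * (sin (\<theta> t))\<^sup>2\<bar> \<le> (s t)\<^sup>2"
        using s2[of t "\<theta> t"] s2'[of t] r2 by simp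
      moreover have "\<bar>2 * ((r + (X + Y)) - real n * 1)\<bar> \<le> 2 * (2 + U + V)"
        if "\<bar>X\<bar> \<le> U" "\<bar>Y\<bar> \<le> V" for X Y U V :: real
        using r that by (auto simp: abs_le_iff)
      ultimately have b': "\<bar>2 * \<beta>' t\<bar> \<le> a t" unfolding \<beta>'_def f_def a_def by blast
      have "\<bar>C n t * cos (2 * \<beta> t) - D n t * sin (2 * \<beta> t)\<bar> \<le> \<bar>C n t * cos (2 * \<beta> t)\<bar> + \<bar>D n t * sin (2 * \<beta> t)\<bar>"
        by (rule abs_triangle_ineq4)
      also have "\<dots> \<le> \<bar>C n t\<bar> + \<bar>D n t\<bar>"
        by (intro add_mono) (auto simp: abs_mult intro!: mult_left_le)
      finally have "\<bar>2 * \<beta>' t * (C n t * cos (2 * \<beta> t) - D n t * sin (2 * \<beta> t))\<bar> \<le> a t * (\<bar>C n t\<bar> + \<bar>D n t\<bar>)"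
        unfolding abs_mult[of "2 * \<beta>' t"] using b' by (intro mult_mono a0) auto
      moreover have "\<bar>(s t)\<^sup>2 / r * (sin (\<theta> t))\<^sup>2\<bar> \<le> 1 / r * (s t)\<^sup>2" using s2[of t "\<theta> t"] r2 by simp
      ultimately show ?thesis
        unfolding Q'_def real_norm_def distrib_left[symmetric]
        by (intro order_trans[OF abs_triangle_ineq4] add_mono)
    qed
    have bi: "((\<lambda>t. 1 / r * (s t)\<^sup>2 + (a t * \<bar>C n t\<bar> + a t * \<bar>D n t\<bar>)) has_integral (1 / r * S + (aC n + aD n))) {0..pi}"
      unfolding S_def using absint_integrable[OF s2_absint]
      by (intro has_integral_add has_integral_mult_right iC iD integrable_integral) auto
    have qi: "(Q' has_integral (\<theta> pi - r * pi - P pi) - (\<theta> 0 - r * 0 - P 0)) {0..pi}"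
      using ac_interval[OF Q, of 0 pi] by simp
    have "norm (integral {0..pi} Q') \<le> integral {0..pi} (\<lambda>t. 1 / r * (s t)\<^sup>2 + (a t * \<bar>C n t\<bar> + a t * \<bar>D n t\<bar>))"
      by (rule integral_norm_bound_integral) (use qi bi Qb in auto)
    moreover have "P 0 = 0" by (simp add: P_def C_def D_def)
    ultimately have "\<bar>\<theta> pi - r * pi - P pi - \<theta> 0\<bar> \<le> 1 / r * S + (aC n + aD n)"
      using integral_unique[OF qi] integral_unique[OF bi] by simp
    moreover have "\<bar>P pi\<bar> \<le> \<bar>C n pi\<bar> + \<bar>D n pi\<bar>"
    proof -
      have "\<bar>P pi\<bar> \<le> \<bar>D n pi * cos (2 * \<beta> pi)\<bar> + \<bar>C n pi * sin (2 * \<beta> pi)\<bar>"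
        unfolding P_def by (rule abs_triangle_ineq)
      also have "\<dots> \<le> \<bar>D n pi\<bar> + \<bar>C n pi\<bar>"
        by (intro add_mono) (auto simp: abs_mult intro!: mult_left_le)
      finally show ?thesis by simp
    qed
    moreover have "1 / r * S \<le> 2 * S / real n" using mult_right_mono[OF rinv(1) S] by simp
    ultimately show ?thesis unfolding \<eta>_def by linarith
  qed
  have "\<forall>n. 0 \<le> \<eta> n" using aCD0 S by (simp add: \<eta>_def)
  with sum bound show ?thesis by blast
qed

end

section \<open>The eigenvalue count as a function of angles, its one-sided limits, and the listing
  of its jumps\<close>

section \<open>Counting with angles\<close>

lemma sin_cos_shift_int_pi:
  fixes x y :: real and k :: int
  shows "sin (x - of_int k * pi) * cos (y - of_int k * pi) = sin x * cos y"
    and "sin (x - of_int k * pi) * sin (y - of_int k * pi) = sin x * sin y"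
proof -
  have "sin (of_int k * pi) = 0" "(cos (of_int k * pi))\<^sup>2 = 1"
    using sin_zero_iff_int2[of "of_int k * pi"] by (auto simp: cos_squared_eq)
  then show "sin (x - of_int k * pi) * cos (y - of_int k * pi) = sin x * cos y"
    "sin (x - of_int k * pi) * sin (y - of_int k * pi) = sin x * sin y"
    by (simp_all add: sin_diff cos_diff power2_eq_square algebra_simps)
qed

lemma cot_shift_int_pi:
  fixes x :: real and k :: int
  shows "cot (x - of_int k * pi) = cot x"
proof -
  have "sin (of_int k * pi) = 0" "(cos (of_int k * pi))\<^sup>2 = 1"
    using sin_zero_iff_int2[of "of_int k * pi"] by (auto simp: cos_squared_eq)
  then show ?thesis by (auto simp: sin_diff cos_diff cot_def)
qed

lemma floor_div_pi:
  fixes x :: real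
  shows "of_int \<lfloor>x / pi\<rfloor> * pi \<le> x" "x < of_int \<lfloor>x / pi\<rfloor> * pi + pi"
proof -
  have "of_int \<lfloor>x / pi\<rfloor> \<le> x / pi" "x / pi < of_int \<lfloor>x / pi\<rfloor> + 1" by linarith+
  then have "of_int \<lfloor>x / pi\<rfloor> * pi \<le> x / pi * pi" "x / pi * pi < (of_int \<lfloor>x / pi\<rfloor> + 1) * pi"
    by (intro mult_right_mono mult_strict_right_mono; simp)+
  then show "of_int \<lfloor>x / pi\<rfloor> * pi \<le> x" "x < of_int \<lfloor>x / pi\<rfloor> * pi + pi"
    by (simp_all add: field_simps)
qed

lemma floor_div_pi_eq:
  fixes x :: real
  shows "\<lfloor>x / pi\<rfloor> = k \<longleftrightarrow> of_int k * pi \<le> x \<and> x < of_int k * pi + pi"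
  by (simp add: floor_eq_iff field_simps)

lemma sin_zero_floor: "sin x = 0 \<longleftrightarrow> x = of_int \<lfloor>x / pi\<rfloor> * pi" for x :: real
proof
  assume "sin x = 0"
  then obtain i :: int where "x = of_int i * pi" by (auto simp: sin_zero_iff_int2)
  then show "x = of_int \<lfloor>x / pi\<rfloor> * pi" by simp
next
  assume "x = of_int \<lfloor>x / pi\<rfloor> * pi"
  then show "sin x = 0" using sin_zero_iff_int2 by blast
qed

text \<open>Equal floors place both angles between the same consecutive poles, where sin x * sin y >
  0 in the identity cot x - cot y = sin (y - x) / (sin x * sin y).\<close>

lemma cot_strict_decreasing:
  fixes x y :: real
  assumes fl: "\<lfloor>x / pi\<rfloor> = \<lfloor>y / pi\<rfloor>" and sx: "sin x \<noteq> 0" and xy: "x < y"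
  shows "sin y \<noteq> 0" "cot y < cot x"
proof -
  define k where "k = \<lfloor>x / pi\<rfloor>"
  have x: "of_int k * pi < x" using floor_div_pi(1)[of x] sx sin_zero_floor[of x] by (simp add: k_def less_le)
  have y: "y < of_int k * pi + pi" using floor_div_pi(2)[of y] fl by (simp add: k_def)
  have "0 < sin (x - of_int k * pi) * sin (y - of_int k * pi)"
    using x y xy by (intro mult_pos_pos sin_gt_zero) auto
  then have pos: "0 < sin x * sin y" by (simp add: sin_cos_shift_int_pi)
  then show sy: "sin y \<noteq> 0" by auto
  have "0 < sin (y - x)" using x y xy by (intro sin_gt_zero) auto
  moreover have "cot x - cot y = sin (y - x) / (sin x * sin y)"
    using sx sy by (simp add: cot_def sin_diff field_simps)
  ultimately have "cot x - cot y > 0" using pos by simp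
  then show "cot y < cot x" by simp
qed

text \<open>For the end angles of the edges at \<open>lam\<close> this is the number of eigenvalues in \<open>(-\<infinity>, lam]\<close>: between
  consecutive poles the sum of cotangents, the Weyl function of the graph, decreases from \<open>\<infinity>\<close> to
  \<open>-\<infinity>\<close>.\<close>

definition angle_count :: "'i set \<Rightarrow> ('i \<Rightarrow> real) \<Rightarrow> int" where
  "angle_count J \<theta> = (\<Sum>j\<in>J. \<lfloor>\<theta> j / pi\<rfloor>) +
     (if (\<forall>j\<in>J. sin (\<theta> j) \<noteq> 0) \<and> (\<Sum>j\<in>J. cot (\<theta> j)) \<le> 0 then 1 else 0)"

text \<open>The correction term is 0 or 1. If some floor rises, the sum of floors gains at least 1
  and makes up for a lost correction; if none does, every angle stays between the same poles, where
  cotangents decrease.\<close>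

lemma angle_count_mono:
  assumes J: "finite J" and le: "\<And>j. j \<in> J \<Longrightarrow> \<theta> j \<le> \<phi> j"
  shows "angle_count J \<theta> \<le> angle_count J \<phi>"
proof -
  have fl: "\<lfloor>\<theta> j / pi\<rfloor> \<le> \<lfloor>\<phi> j / pi\<rfloor>" if "j \<in> J" for j
    using le[OF that] by (intro floor_mono divide_right_mono) auto
  show ?thesis
  proof (cases "\<forall>j\<in>J. \<lfloor>\<theta> j / pi\<rfloor> = \<lfloor>\<phi> j / pi\<rfloor>")
    case True
    have ne: "sin (\<phi> j) \<noteq> 0 \<and> cot (\<phi> j) \<le> cot (\<theta> j)" if "j \<in> J" "sin (\<theta> j) \<noteq> 0" for j
      using cot_strict_decreasing[of "\<theta> j" "\<phi> j"] True that le[OF that(1)]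
      by (cases "\<theta> j = \<phi> j") (auto simp: less_le)
    have "(\<Sum>j\<in>J. cot (\<phi> j)) \<le> (\<Sum>j\<in>J. cot (\<theta> j))" if "\<forall>j\<in>J. sin (\<theta> j) \<noteq> 0"
      using ne that by (intro sum_mono) auto
    moreover have "(\<Sum>j\<in>J. \<lfloor>\<theta> j / pi\<rfloor>) = (\<Sum>j\<in>J. \<lfloor>\<phi> j / pi\<rfloor>)"
      using True by (intro sum.cong) auto
    moreover have "\<forall>j\<in>J. sin (\<phi> j) \<noteq> 0" if "\<forall>j\<in>J. sin (\<theta> j) \<noteq> 0" using ne that by blast
    ultimately show ?thesis unfolding angle_count_def by (auto intro: order_trans)
  next
    case False
    then have "(\<Sum>j\<in>J. \<lfloor>\<theta> j / pi\<rfloor>) < (\<Sum>j\<in>J. \<lfloor>\<phi> j / pi\<rfloor>)"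
      using fl by (intro sum_strict_mono_ex1 J) (auto simp: less_le)
    then show ?thesis by (auto simp: angle_count_def)
  qed
qed

text \<open>Away from poles the relation says cot \<theta> = k cot \<phi>, so the sign of the sum is
  preserved. The floors agree: if a multiple of pi separated two angles less than pi / 2 apart,
  then, measured from it, both cosines would be positive and the sines of different sign, against
  the relation.\<close>

lemma angle_count_rescale:
  assumes k: "k > 0"
    and rel: "\<And>j. j \<in> J \<Longrightarrow> k * sin (\<theta> j) * cos (\<phi> j) = cos (\<theta> j) * sin (\<phi> j)"
    and close: "\<And>j. j \<in> J \<Longrightarrow> \<bar>\<theta> j - \<phi> j\<bar> < pi / 2"
  shows "angle_count J \<theta> = angle_count J \<phi>"
proof -
  have le: "of_int n * pi \<le> \<theta> j \<longleftrightarrow> of_int n * pi \<le> \<phi> j" if j: "j \<in> J" for n :: int and j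
  proof -
    define a b where "a = \<theta> j - of_int n * pi" and "b = \<phi> j - of_int n * pi"
    have ab: "k * (sin a * cos b) = sin b * cos a" "\<bar>a - b\<bar> < pi / 2"
      using rel[OF j] close[OF j] unfolding a_def b_def sin_cos_shift_int_pi by (simp_all add: mult_ac)
    have "\<not> (0 \<le> a \<and> b < 0)"
    proof
      assume *: "0 \<le> a \<and> b < 0"
      then have "0 \<le> sin a" "0 < cos a" "0 < cos b" "0 < sin (- b)"
        using ab(2) by (intro sin_ge_zero cos_gt_zero_pi sin_gt_zero; simp add: abs_less_iff)+
      then have "0 \<le> k * (sin a * cos b)" "sin b * cos a < 0"
        using k by (auto intro!: mult_nonneg_nonneg mult_neg_pos)
      then show False using ab(1) by simp
    qed
    moreover have "\<not> (0 \<le> b \<and> a < 0)"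
    proof
      assume *: "0 \<le> b \<and> a < 0"
      then have "0 \<le> sin b" "0 < cos b" "0 < cos a" "0 < sin (- a)"
        using ab(2) by (intro sin_ge_zero cos_gt_zero_pi sin_gt_zero; simp add: abs_less_iff)+
      then have "k * (sin a * cos b) < 0" "0 \<le> sin b * cos a"
        using k by (auto simp: mult_less_0_iff)
      then show False using ab(1) by simp
    qed
    ultimately show ?thesis by (auto simp: a_def b_def)
  qed
  have fl: "\<lfloor>\<theta> j / pi\<rfloor> = \<lfloor>\<phi> j / pi\<rfloor>" if "j \<in> J" for j
    using le[OF that, of "\<lfloor>\<theta> j / pi\<rfloor>"] le[OF that, of "\<lfloor>\<theta> j / pi\<rfloor> + 1"] floor_div_pi[of "\<theta> j"]
    by (intro sym[OF iffD2[OF floor_div_pi_eq]]) (auto simp: algebra_simps)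
  have s: "sin (\<theta> j) = 0 \<longleftrightarrow> sin (\<phi> j) = 0" if "j \<in> J" for j
  proof
    assume "sin (\<theta> j) = 0"
    then show "sin (\<phi> j) = 0" using rel[OF that] sin_cos_squared_add[of "\<theta> j"] by auto
  next
    assume "sin (\<phi> j) = 0"
    then show "sin (\<theta> j) = 0" using rel[OF that] sin_cos_squared_add[of "\<phi> j"] k by auto
  qed
  have c: "cot (\<theta> j) = k * cot (\<phi> j)" if "j \<in> J" "sin (\<theta> j) \<noteq> 0" for j
    using rel[OF that(1)] that(2) s[OF that(1)] by (simp add: cot_def field_simps)
  have "(\<Sum>j\<in>J. cot (\<theta> j)) \<le> 0 \<longleftrightarrow> (\<Sum>j\<in>J. cot (\<phi> j)) \<le> 0" if "\<forall>j\<in>J. sin (\<theta> j) \<noteq> 0"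
  proof -
    have "(\<Sum>j\<in>J. cot (\<theta> j)) = k * (\<Sum>j\<in>J. cot (\<phi> j))"
      using c that by (simp add: sum_distrib_left)
    then show ?thesis using k by (simp add: mult_le_0_iff)
  qed
  moreover have "(\<forall>j\<in>J. sin (\<theta> j) \<noteq> 0) \<longleftrightarrow> (\<forall>j\<in>J. sin (\<phi> j) \<noteq> 0)" using s by auto
  ultimately have "(\<forall>j\<in>J. sin (\<theta> j) \<noteq> 0) \<and> (\<Sum>j\<in>J. cot (\<theta> j)) \<le> 0 \<longleftrightarrow>
      (\<forall>j\<in>J. sin (\<phi> j) \<noteq> 0) \<and> (\<Sum>j\<in>J. cot (\<phi> j)) \<le> 0" by meson
  moreover have "(\<Sum>j\<in>J. \<lfloor>\<theta> j / pi\<rfloor>) = (\<Sum>j\<in>J. \<lfloor>\<phi> j / pi\<rfloor>)"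
    using fl by (intro sum.cong) auto
  ultimately show ?thesis unfolding angle_count_def by (simp only:)
qed

lemma filterlim_cot_at_right_0: "filterlim cot at_top (at_right (0::real))"
proof -
  have "filterlim (\<lambda>x::real. cos x * inverse (sin x)) at_top (at_right 0)"
  proof (rule filterlim_tendsto_pos_mult_at_top)
    show "(cos \<longlongrightarrow> 1) (at_right (0::real))" by (auto intro!: tendsto_eq_intros)
    show "filterlim (\<lambda>x::real. inverse (sin x)) at_top (at_right 0)"
    proof (rule filterlim_inverse_at_top)
      show "(sin \<longlongrightarrow> 0) (at_right (0::real))" by (auto intro!: tendsto_eq_intros)
      show "\<forall>\<^sub>F x in at_right 0. 0 < sin (x::real)"
        using eventually_at_right_real[OF pi_gt_zero] by eventually_elim (auto intro: sin_gt_zero)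
    qed
  qed simp
  then show ?thesis by (simp add: cot_def[abs_def] divide_inverse)
qed

lemma filterlim_sum_at_top:
  fixes f :: "'i \<Rightarrow> 'a \<Rightarrow> real"
  assumes "finite Z" "Z \<noteq> {}" "\<And>j. j \<in> Z \<Longrightarrow> filterlim (f j) at_top F"
  shows "filterlim (\<lambda>x. \<Sum>j\<in>Z. f j x) at_top F"
  using assms by (induction Z rule: finite_ne_induct) (auto intro: filterlim_at_top_add_at_top)

locale angle_family =
  fixes J :: "'i set" and \<Theta> :: "'i \<Rightarrow> real \<Rightarrow> real"
  assumes fin: "finite J" and nonempty: "J \<noteq> {}"
    and cont: "\<And>j x. j \<in> J \<Longrightarrow> isCont (\<Theta> j) x"
    and strict: "\<And>j x y. j \<in> J \<Longrightarrow> x < y \<Longrightarrow> \<Theta> j x < \<Theta> j y"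
begin

definition zeros :: "real \<Rightarrow> 'i set" where "zeros x = {j\<in>J. sin (\<Theta> j x) = 0}"

text \<open>The expected dimension of the eigenspace. With no end angle at a multiple of pi, an
  eigenfunction is determined by its value at the internal vertex and exists exactly when the
  cotangents sum to zero. Otherwise eigenfunctions vanish at that vertex, each edge in
  \<open>zeros x\<close> offers one coefficient, and the condition on the quasi-derivatives removes
  one.\<close>

definition jump :: "real \<Rightarrow> nat" where
  "jump x = (if zeros x = {} then (if (\<Sum>j\<in>J. cot (\<Theta> j x)) = 0 then 1 else 0) else card (zeros x) - 1)"

lemma tendsto_right: "j \<in> J \<Longrightarrow> (\<Theta> j \<longlongrightarrow> \<Theta> j x) (at_right x)"
  and tendsto_left: "j \<in> J \<Longrightarrow> (\<Theta> j \<longlongrightarrow> \<Theta> j x) (at_left x)"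
  using cont[of j x] by (auto simp: isCont_def intro: tendsto_mono[OF at_le])

lemma eventually_right:
  assumes j: "j \<in> J"
  shows "\<forall>\<^sub>F y in at_right x. \<Theta> j x < \<Theta> j y \<and> \<lfloor>\<Theta> j y / pi\<rfloor> = \<lfloor>\<Theta> j x / pi\<rfloor> \<and> sin (\<Theta> j y) \<noteq> 0"
proof -
  let ?k = "\<lfloor>\<Theta> j x / pi\<rfloor>"
  have "\<forall>\<^sub>F y in at_right x. \<Theta> j y < of_int ?k * pi + pi"
    using order_tendstoD(2)[OF tendsto_right[OF j] floor_div_pi(2)] .
  moreover have "\<forall>\<^sub>F y in at_right x. x < y" by (rule eventually_at_right_less)
  ultimately show ?thesis
  proof eventually_elim
    case (elim y)
    have lt: "\<Theta> j x < \<Theta> j y" using strict[OF j elim(2)] .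
    then have fl: "\<lfloor>\<Theta> j y / pi\<rfloor> = ?k" using elim floor_div_pi(1)[of "\<Theta> j x"] by (intro iffD2[OF floor_div_pi_eq]) auto
    moreover have "sin (\<Theta> j y) \<noteq> 0"
      using fl lt floor_div_pi(1)[of "\<Theta> j x"] sin_zero_floor[of "\<Theta> j y"] by auto
    ultimately show ?case using lt by simp
  qed
qed

text \<open>To the left, an angle sitting at a multiple of pi falls into the preceding interval,
  which costs one in its floor.\<close>

lemma eventually_left:
  assumes j: "j \<in> J"
  shows "\<forall>\<^sub>F y in at_left x. \<Theta> j y < \<Theta> j x \<and>
    \<lfloor>\<Theta> j y / pi\<rfloor> = \<lfloor>\<Theta> j x / pi\<rfloor> - (if j \<in> zeros x then 1 else 0) \<and> sin (\<Theta> j y) \<noteq> 0"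
proof -
  let ?k = "\<lfloor>\<Theta> j x / pi\<rfloor> - (if j \<in> zeros x then 1 else 0)"
  have "of_int ?k * pi < \<Theta> j x"
    using floor_div_pi(1)[of "\<Theta> j x"] sin_zero_floor[of "\<Theta> j x"] j
    by (auto simp: zeros_def algebra_simps less_le add_strict_increasing2)
  then have "\<forall>\<^sub>F y in at_left x. of_int ?k * pi < \<Theta> j y"
    by (rule order_tendstoD(1)[OF tendsto_left[OF j]])
  moreover have "\<forall>\<^sub>F y in at_left x. y < x" by (simp add: eventually_at_filter)
  ultimately show ?thesis
  proof eventually_elim
    case (elim y)
    have lt: "\<Theta> j y < \<Theta> j x" using strict[OF j elim(2)] .
    have "\<Theta> j y < of_int ?k * pi + pi"
      using lt floor_div_pi(2)[of "\<Theta> j x"] sin_zero_floor[of "\<Theta> j x"] j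
      by (auto simp: zeros_def algebra_simps)
    then have fl: "\<lfloor>\<Theta> j y / pi\<rfloor> = ?k" using elim by (intro iffD2[OF floor_div_pi_eq]) auto
    then have "sin (\<Theta> j y) \<noteq> 0"
      using elim(1) sin_zero_floor[of "\<Theta> j y"] by auto
    then show ?case using lt fl by simp
  qed
qed

lemma cot_tendsto_right:
  assumes "j \<in> J - zeros x" shows "((\<lambda>y. cot (\<Theta> j y)) \<longlongrightarrow> cot (\<Theta> j x)) (at_right x)"
  using assms tendsto_right[of j x] unfolding cot_def zeros_def by (auto intro!: tendsto_intros)

lemma cot_tendsto_left:
  assumes "j \<in> J - zeros x" shows "((\<lambda>y. cot (\<Theta> j y)) \<longlongrightarrow> cot (\<Theta> j x)) (at_left x)"
  using assms tendsto_left[of j x] unfolding cot_def zeros_def by (auto intro!: tendsto_intros)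

lemma sum_cot_right:
  assumes "zeros x \<noteq> {}"
  shows "filterlim (\<lambda>y. \<Sum>j\<in>J. cot (\<Theta> j y)) at_top (at_right x)"
proof -
  have "filterlim (\<lambda>y. cot (\<Theta> j y)) at_top (at_right x)" if j: "j \<in> zeros x" for j
  proof -
    have jJ: "j \<in> J" and s: "sin (\<Theta> j x) = 0" using j by (auto simp: zeros_def)
    let ?k = "\<lfloor>\<Theta> j x / pi\<rfloor>"
    have x0: "\<Theta> j x = of_int ?k * pi" using s sin_zero_floor by blast
    have "filterlim (\<lambda>y. \<Theta> j y - of_int ?k * pi) (at_right 0) (at_right x)"
      unfolding filterlim_at
    proof
      show "((\<lambda>y. \<Theta> j y - of_int ?k * pi) \<longlongrightarrow> 0) (at_right x)"
        using tendsto_diff[OF tendsto_right[OF jJ, of x] tendsto_const[of "\<Theta> j x"]] x0 by simp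
      show "\<forall>\<^sub>F y in at_right x. \<Theta> j y - of_int ?k * pi \<in> {0<..} \<and> \<Theta> j y - of_int ?k * pi \<noteq> 0"
        using eventually_right[OF jJ, of x] by eventually_elim (use x0 in auto)
    qed
    from filterlim_compose[OF filterlim_cot_at_right_0 this] show ?thesis
      by (simp add: cot_shift_int_pi)
  qed
  then have 1: "filterlim (\<lambda>y. \<Sum>j\<in>zeros x. cot (\<Theta> j y)) at_top (at_right x)"
    using assms fin by (intro filterlim_sum_at_top) (auto simp: zeros_def)
  have "((\<lambda>y. \<Sum>j\<in>J - zeros x. cot (\<Theta> j y)) \<longlongrightarrow> (\<Sum>j\<in>J - zeros x. cot (\<Theta> j x))) (at_right x)"
    by (intro tendsto_sum cot_tendsto_right)
  from filterlim_tendsto_add_at_top[OF this 1] show ?thesis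
    using fin by (subst sum.subset_diff[of "zeros x"]) (auto simp: zeros_def)
qed

lemma sum_cot_left:
  assumes "zeros x \<noteq> {}"
  shows "filterlim (\<lambda>y. - (\<Sum>j\<in>J. cot (\<Theta> j y))) at_top (at_left x)"
proof -
  have "filterlim (\<lambda>y. - cot (\<Theta> j y)) at_top (at_left x)" if j: "j \<in> zeros x" for j
  proof -
    have jJ: "j \<in> J" and s: "sin (\<Theta> j x) = 0" using j by (auto simp: zeros_def)
    let ?k = "\<lfloor>\<Theta> j x / pi\<rfloor>"
    have x0: "\<Theta> j x = of_int ?k * pi" using s sin_zero_floor by blast
    have "filterlim (\<lambda>y. - (\<Theta> j y - of_int ?k * pi)) (at_right 0) (at_left x)"
      unfolding filterlim_at
    proof
      show "((\<lambda>y. - (\<Theta> j y - of_int ?k * pi)) \<longlongrightarrow> 0) (at_left x)"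
        using tendsto_diff[OF tendsto_const[of "\<Theta> j x"] tendsto_left[OF jJ, of x]] x0 by simp
      show "\<forall>\<^sub>F y in at_left x. - (\<Theta> j y - of_int ?k * pi) \<in> {0<..} \<and> - (\<Theta> j y - of_int ?k * pi) \<noteq> 0"
        using eventually_left[OF jJ, of x] by eventually_elim (use x0 in auto)
    qed
    from filterlim_compose[OF filterlim_cot_at_right_0 this]
    have "filterlim (\<lambda>y. cot (- (\<Theta> j y - of_int ?k * pi))) at_top (at_left x)" .
    moreover have "cot (- (z - of_int ?k * pi)) = - cot z" for z :: real
    proof -
      have "cot (- w) = - cot w" for w :: real by (simp add: cot_def)
      then show ?thesis by (simp only: cot_shift_int_pi)
    qed
    ultimately show ?thesis by simp
  qed
  then have 1: "filterlim (\<lambda>y. \<Sum>j\<in>zeros x. - cot (\<Theta> j y)) at_top (at_left x)"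
    using assms fin by (intro filterlim_sum_at_top) (auto simp: zeros_def)
  have "((\<lambda>y. \<Sum>j\<in>J - zeros x. - cot (\<Theta> j y)) \<longlongrightarrow> (\<Sum>j\<in>J - zeros x. - cot (\<Theta> j x))) (at_left x)"
    by (intro tendsto_sum tendsto_minus cot_tendsto_left)
  from filterlim_tendsto_add_at_top[OF this 1]
  have "filterlim (\<lambda>y. \<Sum>j\<in>J. - cot (\<Theta> j y)) at_top (at_left x)"
    using fin by (subst sum.subset_diff[of "zeros x"]) (auto simp: zeros_def)
  then show ?thesis by (simp add: sum_negf)
qed

definition count :: "real \<Rightarrow> int" where "count x = angle_count J (\<lambda>j. \<Theta> j x)"

lemma count_mono: "x \<le> y \<Longrightarrow> count x \<le> count y"
  unfolding count_def
  by (intro angle_count_mono fin) (use strict in \<open>fastforce simp: le_less\<close>)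

text \<open>Just right of a pole the cotangent sum is large and positive, so the correction is 0 as
  at the pole itself. Elsewhere the sum is continuous and decreasing, so the test sum \<le> 0 keeps
  its outcome to the right.\<close>

lemma count_right: "\<forall>\<^sub>F y in at_right x. count y = count x"
proof -
  have ev: "\<forall>\<^sub>F y in at_right x. \<forall>j\<in>J. \<Theta> j x < \<Theta> j y \<and> \<lfloor>\<Theta> j y / pi\<rfloor> = \<lfloor>\<Theta> j x / pi\<rfloor> \<and> sin (\<Theta> j y) \<noteq> 0"
    using eventually_right by (intro eventually_ball_finite fin) auto
  show ?thesis
  proof (cases "zeros x = {}")
    case True
    then have s0: "\<forall>j\<in>J. sin (\<Theta> j x) \<noteq> 0" by (auto simp: zeros_def)
    have "((\<lambda>y. \<Sum>j\<in>J. cot (\<Theta> j y)) \<longlongrightarrow> (\<Sum>j\<in>J. cot (\<Theta> j x))) (at_right x)"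
      using True by (intro tendsto_sum cot_tendsto_right) auto
    then have "\<forall>\<^sub>F y in at_right x. (\<Sum>j\<in>J. cot (\<Theta> j x)) > 0 \<longrightarrow> (\<Sum>j\<in>J. cot (\<Theta> j y)) > 0"
      using order_tendstoD(1) by (cases "(\<Sum>j\<in>J. cot (\<Theta> j x)) > 0") fastforce+
    with ev show ?thesis
    proof eventually_elim
      case (elim y)
      have "(\<Sum>j\<in>J. cot (\<Theta> j y)) \<le> (\<Sum>j\<in>J. cot (\<Theta> j x))"
        using elim(1) s0 by (intro sum_mono less_imp_le cot_strict_decreasing(2)) auto
      then have "(\<Sum>j\<in>J. cot (\<Theta> j y)) \<le> 0 \<longleftrightarrow> (\<Sum>j\<in>J. cot (\<Theta> j x)) \<le> 0" using elim(2) by linarith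
      moreover have "(\<Sum>j\<in>J. \<lfloor>\<Theta> j y / pi\<rfloor>) = (\<Sum>j\<in>J. \<lfloor>\<Theta> j x / pi\<rfloor>)"
        using elim(1) by (intro sum.cong) auto
      ultimately show ?case using elim(1) s0 by (simp add: count_def angle_count_def)
    qed
  next
    case False
    then have s0: "\<not> (\<forall>j\<in>J. sin (\<Theta> j x) \<noteq> 0)" by (auto simp: zeros_def)
    have "\<forall>\<^sub>F y in at_right x. (\<Sum>j\<in>J. cot (\<Theta> j y)) > 0"
      using sum_cot_right[OF False] by (simp add: filterlim_at_top_dense)
    with ev show ?thesis
    proof eventually_elim
      case (elim y)
      have "(\<Sum>j\<in>J. \<lfloor>\<Theta> j y / pi\<rfloor>) = (\<Sum>j\<in>J. \<lfloor>\<Theta> j x / pi\<rfloor>)"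
        using elim(1) by (intro sum.cong) auto
      then show ?case using elim(2) s0 by (simp add: count_def angle_count_def)
    qed
  qed
qed

text \<open>At a pole each of the \<open>card (zeros x)\<close> floors drops by one, but just to the
  left the cotangent sum is negative and the correction is 1; this is the minus 1 in
  \<open>jump\<close>. Away from poles only a zero of the sum changes the correction.\<close>

lemma count_left: "\<forall>\<^sub>F y in at_left x. count y = count x - int (jump x)"
proof -
  have ev: "\<forall>\<^sub>F y in at_left x. \<forall>j\<in>J. \<Theta> j y < \<Theta> j x \<and>
    \<lfloor>\<Theta> j y / pi\<rfloor> = \<lfloor>\<Theta> j x / pi\<rfloor> - (if j \<in> zeros x then 1 else 0) \<and> sin (\<Theta> j y) \<noteq> 0"
    using eventually_left by (intro eventually_ball_finite fin) auto
  show ?thesis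
  proof (cases "zeros x = {}")
    case True
    then have s0: "\<forall>j\<in>J. sin (\<Theta> j x) \<noteq> 0" by (auto simp: zeros_def)
    have lim: "((\<lambda>y. \<Sum>j\<in>J. cot (\<Theta> j y)) \<longlongrightarrow> (\<Sum>j\<in>J. cot (\<Theta> j x))) (at_left x)"
      using True by (intro tendsto_sum cot_tendsto_left) auto
    have "\<forall>\<^sub>F y in at_left x. (\<Sum>j\<in>J. cot (\<Theta> j x)) < 0 \<longrightarrow> (\<Sum>j\<in>J. cot (\<Theta> j y)) < 0"
      using order_tendstoD(2)[OF lim] by (cases "(\<Sum>j\<in>J. cot (\<Theta> j x)) < 0") fastforce+
    with ev show ?thesis
    proof eventually_elim
      case (elim y)
      have fl: "(\<Sum>j\<in>J. \<lfloor>\<Theta> j y / pi\<rfloor>) = (\<Sum>j\<in>J. \<lfloor>\<Theta> j x / pi\<rfloor>)"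
        using elim(1) True by (intro sum.cong) auto
      have "(\<Sum>j\<in>J. cot (\<Theta> j x)) < (\<Sum>j\<in>J. cot (\<Theta> j y))"
        using elim(1) s0 True nonempty fin by (intro sum_strict_mono cot_strict_decreasing(2)) auto
      then show ?case using elim fl s0 True by (auto simp: count_def angle_count_def jump_def)
    qed
  next
    case False
    then have s0: "\<not> (\<forall>j\<in>J. sin (\<Theta> j x) \<noteq> 0)" by (auto simp: zeros_def)
    have "card (zeros x) > 0" using False fin by (auto simp: zeros_def card_gt_0_iff)
    then have jmp: "int (jump x) = int (card (zeros x)) - 1" using False by (simp add: jump_def)
    have "\<forall>\<^sub>F y in at_left x. - (\<Sum>j\<in>J. cot (\<Theta> j y)) > 0"
      using sum_cot_left[OF False] unfolding filterlim_at_top_dense by blast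
    with ev show ?thesis
    proof eventually_elim
      case (elim y)
      have "(\<Sum>j\<in>J. \<lfloor>\<Theta> j y / pi\<rfloor>) = (\<Sum>j\<in>J. \<lfloor>\<Theta> j x / pi\<rfloor> - (if j \<in> zeros x then 1 else 0))"
        using elim(1) by (intro sum.cong) auto
      also have "\<dots> = (\<Sum>j\<in>J. \<lfloor>\<Theta> j x / pi\<rfloor>) - (\<Sum>j\<in>J. if j \<in> zeros x then 1 else 0)"
        by (rule sum_subtractf)
      also have "(\<Sum>j\<in>J. if j \<in> zeros x then 1 else 0) = int (card (zeros x))"
        using fin by (subst sum.inter_restrict[symmetric]) (auto simp: zeros_def Int_def conj_commute)
      finally show ?case using elim s0 jmp by (auto simp: count_def angle_count_def)
    qed
  qed
qed

end

text \<open>\<open>l\<close> is the generalised inverse of the counting function. Right continuity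
  puts each infimum into its own level set, which gives the equivalence; the left limits then show
  that the indices with l i = x form an interval of \<open>mult x\<close> integers.\<close>

lemma enumerate_count:
  fixes N :: "real \<Rightarrow> int" and mult :: "real \<Rightarrow> nat"
  assumes mono: "\<And>x y. x \<le> y \<Longrightarrow> N x \<le> N y"
    and low: "\<And>y. y \<le> x0 \<Longrightarrow> N y = 0"
    and high: "\<And>i. \<exists>x. N x > int i"
    and right: "\<And>x. \<forall>\<^sub>F y in at_right x. N y = N x"
    and left: "\<And>x. \<forall>\<^sub>F y in at_left x. N y = N x - int (mult x)"
  shows "\<exists>l :: nat \<Rightarrow> real. (\<forall>i x. l i \<le> x \<longleftrightarrow> int i < N x) \<and>
     (\<forall>x. finite {i. l i = x} \<and> card {i. l i = x} = mult x)"
proof -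
  define l where "l i = Inf {x. int i < N x}" for i
  have bdd: "bdd_below {x. int i < N x}" for i
    using low by (intro bdd_belowI[of _ x0]) (metis linorder_not_le mem_Collect_eq nless_le of_nat_0_le_iff)
  have l: "l i \<le> x \<longleftrightarrow> int i < N x" for i x
  proof
    assume "int i < N x"
    then show "l i \<le> x" unfolding l_def by (intro cInf_lower bdd) auto
  next
    have "int i < N (l i)"
    proof -
      obtain b where b: "b > l i" "\<And>y. l i < y \<Longrightarrow> y < b \<Longrightarrow> N y = N (l i)"
        using right[of "l i"] unfolding eventually_at_right_field by blast
      have "{x. int i < N x} \<noteq> {}" using high by auto
      from cInf_lessD[OF this, of b] b(1) obtain z where z: "int i < N z" "z < b"
        by (auto simp: l_def)
      have "l i \<le> z" using z(1) unfolding l_def by (intro cInf_lower bdd) auto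
      then show ?thesis using z b(2)[of z] by (cases "z = l i") auto
    qed
    moreover assume "l i \<le> x"
    ultimately show "int i < N x" using mono by fastforce
  qed
  have "finite {i. l i = x} \<and> card {i. l i = x} = mult x" for x
  proof -
    obtain b where b: "b < x" "\<And>y. b < y \<Longrightarrow> y < x \<Longrightarrow> N y = N x - int (mult x)"
      using left[of x] unfolding eventually_at_left_field by blast
    have Nx: "N y \<ge> 0" for y using mono[of "min y x0" y] low[of "min y x0"] by simp
    have nn: "N x - int (mult x) \<ge> 0" using b(2)[of "(b + x) / 2"] b(1) Nx by (metis field_sum_of_halves less_add_same_cancel2 dense add.commute b)
    have lt: "l i < x \<longleftrightarrow> int i < N x - int (mult x)" for i
    proof
      assume "l i < x"
      then obtain y where y: "max b (l i) < y" "y < x" using dense[of "max b (l i)" x] b(1) by auto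
      then have "l i \<le> y" by simp
      with y b(2)[of y] l show "int i < N x - int (mult x)" by simp
    next
      assume "int i < N x - int (mult x)"
      moreover obtain y where y: "b < y" "y < x" using dense b(1) by blast
      ultimately have "l i \<le> y" using b(2)[of y] l by simp
      then show "l i < x" using y by simp
    qed
    have "l i = x \<longleftrightarrow> i \<in> {nat (N x - int (mult x))..<nat (N x)}" for i
    proof -
      have "l i = x \<longleftrightarrow> l i \<le> x \<and> \<not> l i < x" by auto
      also have "\<dots> \<longleftrightarrow> int i < N x \<and> \<not> int i < N x - int (mult x)" unfolding l lt ..
      also have "\<dots> \<longleftrightarrow> i \<in> {nat (N x - int (mult x))..<nat (N x)}" by auto
      finally show ?thesis .
    qed
    then have "{i. l i = x} = {nat (N x - int (mult x))..<nat (N x)}" by blast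
    then show ?thesis using nn by simp
  qed
  with l show ?thesis by blast
qed

section \<open>Eigenspaces of the star graph, and their dimensions as jumps of the count\<close>

section \<open>Multiplicities on the star graph\<close>

text \<open>Gaussian elimination: an equation with a nonzero coefficient is used to eliminate one
  unknown, which lowers both cardinalities by one. This gives the upper bound on eigenspace
  dimensions.\<close>

lemma homogeneous_system_nontrivial:
  fixes g :: "'i \<Rightarrow> 'e \<Rightarrow> 'a::field"
  assumes "finite E" "finite I" "card E < card I"
  shows "\<exists>c. (\<exists>i\<in>I. c i \<noteq> 0) \<and> (\<forall>e\<in>E. (\<Sum>i\<in>I. c i * g i e) = 0)"
  using assms
proof (induction E arbitrary: I g rule: finite_induct)
  case empty
  then obtain i where "i \<in> I" by fastforce
  then show ?case by (intro exI[of _ "\<lambda>_. 1"]) auto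
next
  case (insert e E)
  show ?case
  proof (cases "\<forall>i\<in>I. g i e = 0")
    case True
    have "card E < card I" using insert by simp
    from insert.IH[OF insert.prems(1) this, of g] show ?thesis using True by auto
  next
    case False
    then obtain k where k: "k \<in> I" "g k e \<noteq> 0" by blast
    define h where "h i x = g i x - g i e / g k e * g k x" for i x
    have "card E < card (I - {k})" using insert k by simp
    from insert.IH[OF _ this, of h] insert.prems(1) obtain c where
      c: "\<exists>i\<in>I - {k}. c i \<noteq> 0" "\<forall>x\<in>E. (\<Sum>i\<in>I - {k}. c i * h i x) = 0" by auto
    define a where "a = (\<Sum>i\<in>I - {k}. c i * (g i e / g k e))"
    define c' where "c' i = (if i = k then - a else c i)" for i
    have expand: "(\<Sum>i\<in>I. c' i * g i x) = (\<Sum>i\<in>I - {k}. c i * h i x)" for x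
    proof -
      have "(\<Sum>i\<in>I. c' i * g i x) = - a * g k x + (\<Sum>i\<in>I - {k}. c i * g i x)"
        using insert.prems(1) k by (subst sum.remove[of _ k]) (auto simp: c'_def)
      also have "\<dots> = (\<Sum>i\<in>I - {k}. c i * h i x)"
        by (simp add: a_def h_def right_diff_distrib sum_subtractf sum_distrib_right mult.assoc)
      finally show ?thesis .
    qed
    have "h i e = 0" for i using k by (simp add: h_def)
    then have "\<forall>x\<in>insert e E. (\<Sum>i\<in>I. c' i * g i x) = 0" using expand c(2) by simp
    moreover have "\<exists>i\<in>I. c' i \<noteq> 0" using c(1) by (auto simp: c'_def)
    ultimately show ?thesis by blast
  qed
qed

text \<open>The two notions differ by absolute integrability of the derivatives, which the gauge
  integral alone does not supply; it follows from continuity of y and w and integrability of s and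
  s^2.\<close>

lemma (in l2_potential) edge_sol_iff_qsol: "edge_sol s lam y w \<longleftrightarrow> qsol s lam y w"
proof
  assume *: "edge_sol s lam y w"
  have cy: "continuous_on {0..pi} y" and cw: "continuous_on {0..pi} w" using * by (auto simp: edge_sol_def)
  have s: "(\<lambda>t. complex_of_real (s t)) absolutely_integrable_on {0..pi}"
    and s2: "(\<lambda>t. complex_of_real ((s t)\<^sup>2)) absolutely_integrable_on {0..pi}"
    using absolutely_integrable_linear[OF s_absint bounded_linear_of_real]
      absolutely_integrable_linear[OF s2_absint bounded_linear_of_real] by (simp_all add: o_def)
  have cont: "f absolutely_integrable_on {0..pi}" if "continuous_on {0..pi} f" for f :: "real \<Rightarrow> complex"
    using that by (rule absolutely_integrable_continuous_real)
  have "(\<lambda>t. complex_of_real (s t) * y t + w t) absolutely_integrable_on {0..pi}"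
    by (intro set_integral_add absint_mult_cont s cy cont cw)
  moreover have "(\<lambda>t. (- w t) * complex_of_real (s t) - complex_of_real ((s t)\<^sup>2) * y t - lam * y t) absolutely_integrable_on {0..pi}"
    by (intro set_integral_diff absint_mult_cont absint_cont_mult s s2 cont continuous_intros cy cw)
  ultimately show "qsol s lam y w"
    using * by (simp add: qsol_def ac_def edge_sol_def mult.commute)
next
  assume "qsol s lam y w"
  then show "edge_sol s lam y w"
    using ac_continuous_on[of pi y] ac_continuous_on[of pi w] unfolding qsol_def edge_sol_def
    by (auto simp: ac_def)
qed

locale star_graph =
  fixes m p :: nat and \<sigma> :: "nat \<Rightarrow> real \<Rightarrow> real"
  assumes p2: "2 \<le> p" and pm: "p + 2 \<le> m"
    and pot: "\<And>j. j \<in> {1..m} \<Longrightarrow> l2_potential (\<sigma> j)"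
begin

lemma L_sol_qsol:
  "L_sol m p \<sigma> lam y \<longleftrightarrow>
     (\<exists>w. (\<forall>j\<in>{1..m}. qsol (\<sigma> j) lam (y j) (w j)) \<and> (\<forall>j\<in>{2..m}. y 1 pi = y j pi) \<and>
        (\<Sum>j=1..m. w j pi) = 0 \<and> (\<forall>j\<in>{1..p}. w j 0 = 0) \<and> (\<forall>j\<in>{p+1..m}. y j 0 = 0))"
proof -
  have "(\<forall>j\<in>{1..m}. edge_sol (\<sigma> j) lam (y j) (w j)) \<longleftrightarrow> (\<forall>j\<in>{1..m}. qsol (\<sigma> j) lam (y j) (w j))" for w
    using l2_potential.edge_sol_iff_qsol[OF pot] by blast
  then show ?thesis unfolding L_sol_def by simp
qed

lemma L_sol_zero: "L_sol m p \<sigma> lam (\<lambda>j t. 0)"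
  unfolding L_sol_qsol by (intro exI[of _ "\<lambda>j t. 0"]) (auto simp: qsol_def ac_const)

lemma L_sol_cmult_add:
  assumes "L_sol m p \<sigma> lam y" "L_sol m p \<sigma> lam z"
  shows "L_sol m p \<sigma> lam (\<lambda>j t. c * y j t + z j t)"
proof -
  obtain w where w: "\<forall>j\<in>{1..m}. qsol (\<sigma> j) lam (y j) (w j)" "\<forall>j\<in>{2..m}. y 1 pi = y j pi"
      "(\<Sum>j=1..m. w j pi) = 0" "\<forall>j\<in>{1..p}. w j 0 = 0" "\<forall>j\<in>{p+1..m}. y j 0 = 0"
    using assms(1) unfolding L_sol_qsol by blast
  obtain v where v: "\<forall>j\<in>{1..m}. qsol (\<sigma> j) lam (z j) (v j)" "\<forall>j\<in>{2..m}. z 1 pi = z j pi"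
      "(\<Sum>j=1..m. v j pi) = 0" "\<forall>j\<in>{1..p}. v j 0 = 0" "\<forall>j\<in>{p+1..m}. z j 0 = 0"
    using assms(2) unfolding L_sol_qsol by blast
  show ?thesis
    unfolding L_sol_qsol
  proof (intro exI[of _ "\<lambda>j t. c * w j t + v j t"] conjI ballI)
    show "(\<Sum>j=1..m. c * w j pi + v j pi) = 0"
      using w(3) v(3) by (simp add: sum.distrib sum_distrib_left[symmetric])
  qed (use w v in \<open>auto intro!: qsol_add qsol_cmult\<close>)
qed

lemma L_sol_sum:
  fixes k :: nat
  assumes "\<And>i. i < k \<Longrightarrow> L_sol m p \<sigma> lam (f i)"
  shows "L_sol m p \<sigma> lam (\<lambda>j t. \<Sum>i<k. c i * f i j t)"
  using assms
proof (induction k)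
  case 0
  then show ?case using L_sol_zero by simp
next
  case (Suc k)
  then have "L_sol m p \<sigma> lam (\<lambda>j t. c k * f k j t + (\<Sum>i<k. c i * f i j t))"
    by (intro L_sol_cmult_add) auto
  then show ?case by (simp add: add.commute)
qed

text \<open>Coordinates on the solution space are values at points, since \<open>y\<close> alone, without its
  quasi-derivative, enters \<open>L_mult\<close>.\<close>

lemma L_mult_eq_card:
  assumes E: "finite E"
    and det: "\<And>y. L_sol m p \<sigma> lam y \<Longrightarrow> (\<And>j x. (j, x) \<in> E \<Longrightarrow> y j x = 0) \<Longrightarrow> (\<forall>j\<in>{1..m}. \<forall>x\<in>{0..pi}. y j x = 0)"
    and E_sub: "E \<subseteq> {1..m} \<times> {0..pi}"
    and dual: "\<And>j x. (j, x) \<in> E \<Longrightarrow> \<exists>y. L_sol m p \<sigma> lam y \<and> y j x \<noteq> 0 \<and>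
        (\<forall>j' x'. (j', x') \<in> E \<longrightarrow> (j', x') \<noteq> (j, x) \<longrightarrow> y j' x' = 0)"
  shows "L_mult m p \<sigma> lam = card E"
  unfolding L_mult_def
proof (rule Greatest_equality)
  obtain e where e: "bij_betw e {..<card E} E"
    using ex_bij_betw_nat_finite[OF E] by (auto simp: atLeast0LessThan)
  have "\<forall>i\<in>{..<card E}. \<exists>y. L_sol m p \<sigma> lam y \<and> y (fst (e i)) (snd (e i)) \<noteq> 0 \<and>
        (\<forall>j' x'. (j', x') \<in> E \<longrightarrow> (j', x') \<noteq> e i \<longrightarrow> y j' x' = 0)"
  proof
    fix i assume "i \<in> {..<card E}"
    then have "(fst (e i), snd (e i)) \<in> E" using bij_betwE[OF e] by simp
    from dual[OF this] show "\<exists>y. L_sol m p \<sigma> lam y \<and> y (fst (e i)) (snd (e i)) \<noteq> 0 \<and>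
        (\<forall>j' x'. (j', x') \<in> E \<longrightarrow> (j', x') \<noteq> e i \<longrightarrow> y j' x' = 0)" by simp
  qed
  from bchoice[OF this] obtain f where f0: "\<forall>i\<in>{..<card E}. L_sol m p \<sigma> lam (f i) \<and>
      f i (fst (e i)) (snd (e i)) \<noteq> 0 \<and>
      (\<forall>j' x'. (j', x') \<in> E \<longrightarrow> (j', x') \<noteq> e i \<longrightarrow> f i j' x' = 0)" by blast
  have f: "L_sol m p \<sigma> lam (f i)" "f i (fst (e i)) (snd (e i)) \<noteq> 0"
      "(j', x') \<in> E \<Longrightarrow> (j', x') \<noteq> e i \<Longrightarrow> f i j' x' = 0" if "i < card E" for i j' x'
    using f0 that by blast+
  have "\<forall>i<card E. c i = 0"
    if c: "\<forall>j\<in>{1..m}. \<forall>x\<in>{0..pi}. (\<Sum>i<card E. c i * f i j x) = 0" for c :: "nat \<Rightarrow> complex"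
  proof (intro allI impI)
    fix i assume i: "i < card E"
    obtain j x where jx: "e i = (j, x)" by fastforce
    then have jxE: "(j, x) \<in> E" using bij_betwE[OF e] i by (metis lessThan_iff)
    have z: "f i' j x = 0" if "i' < card E" "i' \<noteq> i" for i'
      using f(3)[OF that(1) jxE] jx bij_betw_imp_inj_on[OF e] that i by (metis inj_onD lessThan_iff)
    have "0 = (\<Sum>i<card E. c i * f i j x)" using c jxE E_sub by force
    also have "\<dots> = c i * f i j x"
      using z i by (subst sum.remove[of _ i]) (auto intro!: sum.neutral)
    finally show "c i = 0" using f(2)[OF i] jx by simp
  qed
  with f(1) show "\<exists>f. (\<forall>i<card E. L_sol m p \<sigma> lam (f i)) \<and> (\<forall>c :: nat \<Rightarrow> complex.
        (\<forall>j\<in>{1..m}. \<forall>x\<in>{0..pi}. (\<Sum>i<card E. c i * f i j x) = 0) \<longrightarrow> (\<forall>i<card E. c i = 0))"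
    by blast
next
  fix k
  assume "\<exists>f. (\<forall>i<k. L_sol m p \<sigma> lam (f i)) \<and> (\<forall>c :: nat \<Rightarrow> complex.
        (\<forall>j\<in>{1..m}. \<forall>x\<in>{0..pi}. (\<Sum>i<k. c i * f i j x) = 0) \<longrightarrow> (\<forall>i<k. c i = 0))"
  then obtain f where f: "\<And>i. i < k \<Longrightarrow> L_sol m p \<sigma> lam (f i)"
    "\<And>c :: nat \<Rightarrow> complex. (\<forall>j\<in>{1..m}. \<forall>x\<in>{0..pi}. (\<Sum>i<k. c i * f i j x) = 0) \<Longrightarrow> (\<forall>i<k. c i = 0)"
    by blast
  show "k \<le> card E"
  proof (rule ccontr)
    assume "\<not> k \<le> card E"
    then have "card E < card {..<k}" by simp
    \<comment> \<open>With more functions than evaluation points, some nontrivial combination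
      vanishes on \<open>E\<close>, hence everywhere by \<open>det\<close>, against
      independence.\<close>
    from homogeneous_system_nontrivial[OF E _ this, of "\<lambda>i e. f i (fst e) (snd e)"]
    obtain c where c: "\<exists>i\<in>{..<k}. c i \<noteq> 0" "\<forall>e\<in>E. (\<Sum>i<k. c i * f i (fst e) (snd e)) = 0" by auto
    have "\<forall>j\<in>{1..m}. \<forall>x\<in>{0..pi}. (\<Sum>i<k. c i * f i j x) = 0"
      by (rule det[OF L_sol_sum[OF f(1)]]) (use c(2) in auto)
    with f(2) c(1) show False by blast
  qed
qed

text \<open>The Wronskian of y and its conjugate vanishes at each outer end by the boundary
  condition, and its values at the internal vertex sum to zero by the matching conditions. The sum
  is also lam - cnj lam times the squared norm of y, which must therefore be zero.\<close>

lemma L_mult_nonreal: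
  assumes "lam \<notin> \<real>"
  shows "L_mult m p \<sigma> lam = 0"
proof -
  have "\<forall>j\<in>{1..m}. \<forall>x\<in>{0..pi}. y j x = 0" if "L_sol m p \<sigma> lam y" for y
  proof -
    obtain w where w: "\<And>j. j \<in> {1..m} \<Longrightarrow> qsol (\<sigma> j) lam (y j) (w j)" "\<And>j. j \<in> {2..m} \<Longrightarrow> y 1 pi = y j pi"
      "(\<Sum>j=1..m. w j pi) = 0" "\<And>j. j \<in> {1..p} \<Longrightarrow> w j 0 = 0" "\<And>j. j \<in> {p+1..m} \<Longrightarrow> y j 0 = 0"
      using \<open>L_sol m p \<sigma> lam y\<close> unfolding L_sol_qsol by blast
    define W where "W j t = y j t * cnj (w j t) - w j t * cnj (y j t)" for j t
    have W: "ac pi (W j) (\<lambda>t. (lam - cnj lam) * (y j t * cnj (y j t)))" if "j \<in> {1..m}" for j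
      unfolding W_def by (rule qsol_wronskian[OF w(1)[OF that] qsol_cnj[OF w(1)[OF that]]])
    have W0: "W j 0 = 0" if "j \<in> {1..m}" for j
      using w(4,5)[of j] that by (cases "j \<le> p") (auto simp: W_def)
    have V: "y j pi = y 1 pi" if "j \<in> {1..m}" for j using w(2)[of j] that by (cases "j = 1") auto
    have "(\<Sum>j=1..m. W j pi) = (\<Sum>j=1..m. y 1 pi * cnj (w j pi) - w j pi * cnj (y 1 pi))"
    proof (rule sum.cong[OF refl])
      fix j assume "j \<in> {1..m}"
      from V[OF this] show "W j pi = y 1 pi * cnj (w j pi) - w j pi * cnj (y 1 pi)" unfolding W_def by (rule arg_cong)
    qed
    also have "\<dots> = y 1 pi * cnj (\<Sum>j=1..m. w j pi) - (\<Sum>j=1..m. w j pi) * cnj (y 1 pi)"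
      by (simp only: sum_subtractf sum_distrib_left sum_distrib_right cnj_sum)
    finally have sumW: "(\<Sum>j=1..m. W j pi) = 0" unfolding w(3) by simp
    define I where "I j = integral {0..pi} (\<lambda>t. (cmod (y j t))\<^sup>2)" for j
    have cy: "continuous_on {0..pi} (y j)" if "j \<in> {1..m}" for j
      using ac_continuous_on w(1)[OF that] unfolding qsol_def by blast
    have cy2: "continuous_on {0..pi} (\<lambda>t. (cmod (y j t))\<^sup>2)" if "j \<in> {1..m}" for j
      by (intro continuous_intros cy that)
    have WI: "W j pi = (lam - cnj lam) * of_real (I j)" if j: "j \<in> {1..m}" for j
    proof -
      have "((\<lambda>t. (cmod (y j t))\<^sup>2) has_integral I j) {0..pi}"
        unfolding I_def by (intro integrable_integral integrable_continuous_real cy2 j)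
      from has_integral_linear[OF this bounded_linear_of_real[where 'a = complex]]
      have "((\<lambda>t. complex_of_real ((cmod (y j t))\<^sup>2)) has_integral of_real (I j)) {0..pi}" by (simp add: o_def)
      then have "((\<lambda>t. (lam - cnj lam) * complex_of_real ((cmod (y j t))\<^sup>2)) has_integral (lam - cnj lam) * of_real (I j)) {0..pi}"
        by (rule has_integral_mult_right)
      moreover have "((\<lambda>t. (lam - cnj lam) * complex_of_real ((cmod (y j t))\<^sup>2)) has_integral (W j pi)) {0..pi}"
        using ac_interval[OF W[OF j], of 0 pi] W0[OF j] unfolding complex_norm_square by simp
      ultimately show ?thesis using has_integral_unique by blast
    qed
    have "(lam - cnj lam) * of_real (\<Sum>j=1..m. I j) = 0"
      using sumW WI by (simp add: sum_distrib_left)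
    moreover have "lam - cnj lam \<noteq> 0" using assms by (metis Reals_cnj_iff eq_iff_diff_eq_0)
    ultimately have "(\<Sum>j=1..m. I j) = 0" by (metis mult_eq_0_iff of_real_eq_0_iff)
    moreover have "I j \<ge> 0" if "j \<in> {1..m}" for j
      unfolding I_def by (intro integral_nonneg integrable_continuous_real cy2 that) auto
    ultimately have I0: "I j = 0" if "j \<in> {1..m}" for j
      using that by (subst (asm) sum_nonneg_eq_0_iff) auto
    show ?thesis
    proof (intro ballI)
      fix j x assume j: "j \<in> {1..m}" and x: "x \<in> {0..pi}"
      have "\<forall>x\<in>{0..pi}. (cmod (y j x))\<^sup>2 = 0"
        using integral_eq_0_iff[OF cy2[OF j]] I0[OF j] by (auto simp: I_def)
      then show "y j x = 0" using x by auto
    qed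
  qed
  then show ?thesis using L_mult_eq_card[of "{}" lam] by auto
qed

text \<open>The boundary conditions as angles: a vanishing quasi-derivative means cos \<theta> = 0,
  a vanishing function value means sin \<theta> = 0.\<close>

definition \<theta>0 :: "nat \<Rightarrow> real" where "\<theta>0 j = (if j \<le> p then pi / 2 else 0)"

text \<open>The choice is harmless, since the comparison lemmas hold for any solution with this
  initial angle.\<close>

definition angle :: "nat \<Rightarrow> real \<Rightarrow> real \<Rightarrow> real" where
  "angle j lam = (SOME \<theta>. l2_potential.prufer (\<sigma> j) 1 lam \<theta> \<and> \<theta> 0 = \<theta>0 j)"

definition end_angle :: "nat \<Rightarrow> real \<Rightarrow> real" where "end_angle j lam = angle j lam pi"

lemma angle:
  assumes "j \<in> {1..m}"
  shows "l2_potential.prufer (\<sigma> j) 1 lam (angle j lam)" "angle j lam 0 = \<theta>0 j"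
  unfolding angle_def
  using someI_ex[OF l2_potential.prufer_exists[OF pot[OF assms] zero_less_one, of lam "\<theta>0 j"]] by auto

lemma end_angle_strict_mono: "j \<in> {1..m} \<Longrightarrow> x < y \<Longrightarrow> end_angle j x < end_angle j y"
  unfolding end_angle_def using l2_potential.prufer_mono[OF pot] angle by metis

lemma end_angle_cont:
  assumes j: "j \<in> {1..m}"
  shows "isCont (end_angle j) x"
proof -
  define M where "M = \<bar>x\<bar> + 1"
  define K where "K = exp (integral {0..pi} (prufer_lip (\<sigma> j) 1 M)) * pi"
  have lip: "norm (end_angle j y - end_angle j x) \<le> K * \<bar>y - x\<bar>" if y: "\<bar>y - x\<bar> < 1" for y
  proof (cases x y rule: linorder_cases)
    case less
    have "end_angle j y - end_angle j x \<le> K * (y - x)"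
      unfolding end_angle_def K_def using y angle[OF j]
      by (intro l2_potential.prufer_lipschitz_lam[OF pot[OF j]] less) (auto simp: M_def)
    then show ?thesis using end_angle_strict_mono[OF j less] less by simp
  next
    case greater
    have "end_angle j x - end_angle j y \<le> K * (x - y)"
      unfolding end_angle_def K_def using y angle[OF j]
      by (intro l2_potential.prufer_lipschitz_lam[OF pot[OF j]] greater) (auto simp: M_def)
    then show ?thesis using end_angle_strict_mono[OF j greater] greater by simp
  qed simp
  have "((\<lambda>y. end_angle j y - end_angle j x) \<longlongrightarrow> 0) (at x)"
  proof (rule Lim_null_comparison)
    show "\<forall>\<^sub>F y in at x. norm (end_angle j y - end_angle j x) \<le> K * \<bar>y - x\<bar>"
      unfolding eventually_at using lip by (intro exI[of _ 1]) (auto simp: dist_real_def)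
    show "((\<lambda>y. K * \<bar>y - x\<bar>) \<longlongrightarrow> 0) (at x)" by (auto intro!: tendsto_eq_intros)
  qed
  then show ?thesis unfolding isCont_def using LIM_zero_iff by blast
qed

sublocale angle_family "{1..m}" end_angle
  by unfold_locales (use end_angle_cont end_angle_strict_mono p2 pm in auto)

text \<open>The solution on edge j singled out by its boundary condition, with its data at the
  internal vertex expressed by the end angle. The last conjunct supplies a point that can serve as a
  coordinate.\<close>

definition edge_pair :: "real \<Rightarrow> nat \<Rightarrow> (real \<Rightarrow> real) \<Rightarrow> (real \<Rightarrow> real) \<Rightarrow> bool" where
  "edge_pair lam j \<phi> \<psi> \<longleftrightarrow> qsol (\<sigma> j) lam \<phi> \<psi> \<and> (j \<le> p \<longrightarrow> \<psi> 0 = 0 \<and> \<phi> 0 \<noteq> 0) \<and>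
     (\<not> j \<le> p \<longrightarrow> \<phi> 0 = 0 \<and> \<psi> 0 \<noteq> 0) \<and> (\<phi> pi = 0 \<longleftrightarrow> j \<in> zeros lam) \<and>
     (\<phi> pi = 0 \<longrightarrow> \<psi> pi \<noteq> 0) \<and> (\<phi> pi \<noteq> 0 \<longrightarrow> \<psi> pi = \<phi> pi * cot (end_angle j lam)) \<and>
     (\<exists>x\<in>{0..pi}. \<phi> x \<noteq> 0)"

lemma edge_pair_exists: "\<exists>\<phi> \<psi>. \<forall>j\<in>{1..m}. edge_pair lam j (\<phi> j) (\<psi> j)"
proof -
  have "\<exists>\<phi> \<psi>. edge_pair lam j \<phi> \<psi>" if j: "j \<in> {1..m}" for j
  proof -
    obtain r where r: "\<And>t. r t > 0"
      "qsol (\<sigma> j) lam (\<lambda>t. r t / 1 * sin (angle j lam t)) (\<lambda>t. r t * cos (angle j lam t))"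
      using l2_potential.prufer_qsol[OF pot[OF j] zero_less_one angle(1)[OF j]] by blast
    have rn: "r t \<noteq> 0" for t using r(1)[of t] by simp
    have sc: "sin x \<noteq> 0 \<or> cos x \<noteq> 0" for x :: real
      using sin_cos_squared_add[of x] by (metis add.right_neutral power_zero_numeral zero_neq_one)
    define \<phi> \<psi> where "\<phi> t = r t / 1 * sin (angle j lam t)" and "\<psi> t = r t * cos (angle j lam t)" for t
    have init: "angle j lam 0 = \<theta>0 j" by (rule angle(2)[OF j])
    show ?thesis
      unfolding edge_pair_def
    proof (rule exI[of _ \<phi>], rule exI[of _ \<psi>], intro conjI impI)
      show "qsol (\<sigma> j) lam \<phi> \<psi>" using r(2) unfolding \<phi>_def \<psi>_def .
      show "\<psi> 0 = 0" "\<phi> 0 \<noteq> 0" if "j \<le> p" using rn that unfolding \<phi>_def \<psi>_def init \<theta>0_def by simp_all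
      show "\<phi> 0 = 0" "\<psi> 0 \<noteq> 0" if "\<not> j \<le> p" using rn that unfolding \<phi>_def \<psi>_def init \<theta>0_def by simp_all
      show "\<phi> pi = 0 \<longleftrightarrow> j \<in> zeros lam" using rn[of pi] j unfolding zeros_def by (simp add: \<phi>_def end_angle_def)
      show "\<psi> pi \<noteq> 0" if "\<phi> pi = 0" using that rn[of pi] sc[of "angle j lam pi"] by (simp add: \<phi>_def \<psi>_def)
      show "\<psi> pi = \<phi> pi * cot (end_angle j lam)" if "\<phi> pi \<noteq> 0"
      proof -
        have "sin (angle j lam pi) \<noteq> 0" using that by (simp add: \<phi>_def)
        then show ?thesis by (simp add: \<phi>_def \<psi>_def end_angle_def cot_def)
      qed
      obtain x where "x \<in> {0..pi}" "sin (angle j lam x) \<noteq> 0"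
        using l2_potential.prufer_sin_nonzero[OF pot[OF j] angle(1)[OF j]] by blast
      then show "\<exists>x\<in>{0..pi}. \<phi> x \<noteq> 0" using rn by (intro bexI[of _ x]) (simp_all add: \<phi>_def)
    qed
  qed
  then show ?thesis by metis
qed

text \<open>Every solution is c j * \<phi> j on edge j, where c j * \<phi> j pi is the common vertex
  value v and the sum of c j * \<psi> j pi is zero. If \<open>zeros lam\<close> is empty, v
  determines all c j and the last condition reads v times the cotangent sum = 0. Otherwise v = 0,
  only edges in \<open>zeros lam\<close> carry the solution, and the last condition is one
  nontrivial relation among their coefficients.\<close>

lemma L_mult_real: "L_mult m p \<sigma> (complex_of_real lam) = jump lam"
proof -
  obtain \<phi> \<psi> where b: "\<And>j. j \<in> {1..m} \<Longrightarrow> qsol (\<sigma> j) lam (\<phi> j) (\<psi> j)"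
    "\<And>j. j \<in> {1..m} \<Longrightarrow> j \<le> p \<Longrightarrow> \<psi> j 0 = 0 \<and> \<phi> j 0 \<noteq> 0"
    "\<And>j. j \<in> {1..m} \<Longrightarrow> \<not> j \<le> p \<Longrightarrow> \<phi> j 0 = 0 \<and> \<psi> j 0 \<noteq> 0"
    "\<And>j. j \<in> {1..m} \<Longrightarrow> \<phi> j pi = 0 \<longleftrightarrow> j \<in> zeros lam"
    "\<And>j. j \<in> {1..m} \<Longrightarrow> \<phi> j pi = 0 \<Longrightarrow> \<psi> j pi \<noteq> 0"
    "\<And>j. j \<in> {1..m} \<Longrightarrow> \<phi> j pi \<noteq> 0 \<Longrightarrow> \<psi> j pi = \<phi> j pi * cot (end_angle j lam)"
    "\<And>j. j \<in> {1..m} \<Longrightarrow> \<exists>x\<in>{0..pi}. \<phi> j x \<noteq> 0"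
    using edge_pair_exists[of lam] unfolding edge_pair_def by (elim exE) blast
  let ?L = "L_sol m p \<sigma> (complex_of_real lam)"
  have sol_only: "\<exists>c. (\<forall>j\<in>{1..m}. \<forall>t\<in>{0..pi}. y j t = c j * of_real (\<phi> j t)) \<and>
      (\<forall>j\<in>{1..m}. c j * of_real (\<phi> j pi) = y 1 pi) \<and> (\<Sum>j=1..m. c j * of_real (\<psi> j pi)) = 0"
    if "?L y" for y
  proof -
    obtain w where w: "\<And>j. j \<in> {1..m} \<Longrightarrow> qsol (\<sigma> j) (of_real lam) (y j) (w j)" "\<And>j. j \<in> {2..m} \<Longrightarrow> y 1 pi = y j pi"
      "(\<Sum>j=1..m. w j pi) = 0" "\<And>j. j \<in> {1..p} \<Longrightarrow> w j 0 = 0" "\<And>j. j \<in> {p+1..m} \<Longrightarrow> y j 0 = 0"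
      using \<open>?L y\<close> unfolding L_sol_qsol by blast
    have "\<exists>c. \<forall>t\<in>{0..pi}. y j t = c * of_real (\<phi> j t) \<and> w j t = c * of_real (\<psi> j t)" if j: "j \<in> {1..m}" for j
    proof (rule l2_potential.qsol_proportional[OF pot[OF j] w(1)[OF j] b(1)[OF j]])
      show "\<phi> j 0 \<noteq> 0 \<or> \<psi> j 0 \<noteq> 0" using b(2,3)[OF j] by blast
      show "y j 0 * of_real (\<psi> j 0) = w j 0 * of_real (\<phi> j 0)"
        using w(4,5)[of j] b(2,3)[OF j] j by (cases "j \<le> p") simp_all
    qed
    then obtain c where c: "\<And>j t. j \<in> {1..m} \<Longrightarrow> t \<in> {0..pi} \<Longrightarrow> y j t = c j * of_real (\<phi> j t) \<and> w j t = c j * of_real (\<psi> j t)"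
      using bchoice[of "{1..m}" "\<lambda>j c. \<forall>t\<in>{0..pi}. y j t = c * of_real (\<phi> j t) \<and> w j t = c * of_real (\<psi> j t)"] by blast
    have "c j * of_real (\<phi> j pi) = y 1 pi" if j: "j \<in> {1..m}" for j
    proof -
      have "y j pi = c j * of_real (\<phi> j pi)" using c[OF j, of pi] by simp
      moreover have "y 1 pi = y j pi" using w(2)[of j] j by (cases "j = 1") simp_all
      ultimately show ?thesis by simp
    qed
    moreover have "(\<Sum>j=1..m. w j pi) = (\<Sum>j=1..m. c j * of_real (\<psi> j pi))"
    proof (rule sum.cong[OF refl])
      fix j assume "j \<in> {1..m}"
      from c[OF this, of pi] show "w j pi = c j * of_real (\<psi> j pi)" by simp
    qed
    then have "(\<Sum>j=1..m. c j * of_real (\<psi> j pi)) = 0" using w(3) by (rule trans[OF sym])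
    ultimately show ?thesis using c by blast
  qed
  have sol_if: "?L (\<lambda>j t. c j * of_real (\<phi> j t))"
    if "\<And>j. j \<in> {1..m} \<Longrightarrow> c j * of_real (\<phi> j pi) = v" "(\<Sum>j=1..m. c j * of_real (\<psi> j pi)) = 0" for c v
    unfolding L_sol_qsol
  proof (intro exI[of _ "\<lambda>j t. c j * of_real (\<psi> j t)"] conjI ballI qsol_cmult qsol_of_real b(1))
    fix j assume "j \<in> {2..m}"
    then have "1 \<in> {1..m}" "j \<in> {1..m}" by auto
    from that(1)[OF this(1)] that(1)[OF this(2)]
    show "c 1 * of_real (\<phi> 1 pi) = c j * of_real (\<phi> j pi)" by (rule trans[OF _ sym])
  next
    fix j assume "j \<in> {1..p}"
    then show "c j * of_real (\<psi> j 0) = 0" using b(2)[of j] pm by simp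
  next
    fix j assume "j \<in> {p+1..m}"
    then show "c j * of_real (\<phi> j 0) = 0" using b(3)[of j] pm by simp
  next
    show "(\<Sum>j=1..m. c j * of_real (\<psi> j pi)) = 0" by (rule that(2))
  qed assumption
  show ?thesis
  proof (cases "zeros lam = {}")
    case True
    have nz: "\<phi> j pi \<noteq> 0" if "j \<in> {1..m}" for j using b(4)[OF that] True by simp
    let ?S = "\<Sum>j=1..m. cot (end_angle j lam)"
    have S: "(\<Sum>j=1..m. c j * of_real (\<psi> j pi)) = v * of_real ?S"
      if "\<And>j. j \<in> {1..m} \<Longrightarrow> c j * of_real (\<phi> j pi) = v" for c :: "nat \<Rightarrow> complex" and v
    proof -
      have "c j * of_real (\<psi> j pi) = v * of_real (cot (end_angle j lam))" if j: "j \<in> {1..m}" for j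
      proof -
        have "c j * of_real (\<psi> j pi) = (c j * of_real (\<phi> j pi)) * of_real (cot (end_angle j lam))"
          unfolding b(6)[OF j nz[OF j]] of_real_mult by (rule mult.assoc[symmetric])
        then show ?thesis unfolding \<open>\<And>j. j \<in> {1..m} \<Longrightarrow> c j * of_real (\<phi> j pi) = v\<close>[OF j] .
      qed
      then show ?thesis unfolding of_real_sum sum_distrib_left by (rule sum.cong[OF refl])
    qed
    have vanish: "\<forall>j\<in>{1..m}. \<forall>x\<in>{0..pi}. y j x = 0" if y: "?L y" "y 1 pi = 0" for y
    proof -
      obtain c where c: "\<forall>j\<in>{1..m}. \<forall>t\<in>{0..pi}. y j t = c j * of_real (\<phi> j t)"
          "\<forall>j\<in>{1..m}. c j * of_real (\<phi> j pi) = y 1 pi" using sol_only[OF y(1)] by blast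
      have "c j = 0" if j: "j \<in> {1..m}" for j
        using bspec[OF c(2) j] nz[OF j] unfolding y(2) by simp
      with c(1) show ?thesis by simp
    qed
    show ?thesis
    proof (cases "?S = 0")
      case S0: True
      have y1: "?L (\<lambda>j t. (1 / of_real (\<phi> j pi)) * of_real (\<phi> j t))"
      proof (rule sol_if)
        show 1: "(1 / of_real (\<phi> j pi)) * of_real (\<phi> j pi) = (1 :: complex)" if "j \<in> {1..m}" for j
          using nz[OF that] by simp
        from S[of "\<lambda>j. 1 / of_real (\<phi> j pi)", OF 1]
        show "(\<Sum>j=1..m. 1 / of_real (\<phi> j pi) * complex_of_real (\<psi> j pi)) = 0"
          unfolding S0 by simp
      qed
      have "\<exists>y. ?L y \<and> y 1 pi \<noteq> 0" 
        by (intro exI[of _ "\<lambda>j t. (1 / of_real (\<phi> j pi)) * of_real (\<phi> j t)"] conjI y1) (use nz[of 1] pm in simp)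
      \<comment> \<open>The value at the internal vertex, read off on edge 1, is the only
        coordinate.\<close>
      then have "L_mult m p \<sigma> (of_real lam) = card {(1::nat, pi)}"
      proof (intro L_mult_eq_card)
        show "\<forall>j\<in>{1..m}. \<forall>x\<in>{0..pi}. y j x = 0"
          if "?L y" "\<And>j x. (j, x) \<in> {(1, pi)} \<Longrightarrow> y j x = 0" for y
          using vanish[OF that(1)] that(2) by blast
        show "\<exists>y. ?L y \<and> y j x \<noteq> 0 \<and> (\<forall>j' x'. (j', x') \<in> {(1, pi)} \<longrightarrow> (j', x') \<noteq> (j, x) \<longrightarrow> y j' x' = 0)"
          if "(j, x) \<in> {(1, pi)}" for j x
          using that \<open>\<exists>y. ?L y \<and> y 1 pi \<noteq> 0\<close> by simp
      qed (use pm in simp_all)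
      then show ?thesis using True S0 unfolding jump_def by simp
    next
      case S0: False
      have "\<forall>j\<in>{1..m}. \<forall>x\<in>{0..pi}. y j x = 0" if y: "?L y" for y
      proof (rule vanish[OF y])
        obtain c where c: "\<forall>j\<in>{1..m}. c j * of_real (\<phi> j pi) = y 1 pi" "(\<Sum>j=1..m. c j * of_real (\<psi> j pi)) = 0"
          using sol_only[OF y] by blast
        have "y 1 pi * of_real ?S = 0" using S[of c "y 1 pi", OF bspec[OF c(1)]] c(2) by (rule trans[OF sym])
        then show "y 1 pi = 0" using S0 by (metis mult_eq_0_iff of_real_eq_0_iff)
      qed
      then show ?thesis using L_mult_eq_card[of "{}" "of_real lam"] True S0 unfolding jump_def by simp
    qed
  next
    case False
    then obtain j0 where j0: "j0 \<in> zeros lam" by blast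
    have Zsub: "zeros lam \<subseteq> {1..m}" unfolding zeros_def by blast
    have finZ: "finite (zeros lam)" using finite_subset[OF Zsub] by simp
    obtain x where x: "\<And>j. j \<in> {1..m} \<Longrightarrow> x j \<in> {0..pi} \<and> \<phi> j (x j) \<noteq> 0" using b(7) by metis
    \<comment> \<open>On each edge of \<open>zeros lam\<close> other than \<open>j0\<close>, a point
      where the edge solution is nonzero reads off the coefficient; the sum of quasi-derivatives
      then determines the coefficient on \<open>j0\<close>.\<close>
    define E where "E = (\<lambda>j. (j, x j)) ` (zeros lam - {j0})"
    have "L_mult m p \<sigma> (of_real lam) = card E"
    proof (rule L_mult_eq_card)
      show "finite E" using finZ by (simp add: E_def)
      show "E \<subseteq> {1..m} \<times> {0..pi}" using x Zsub by (auto simp: E_def)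
    next
      fix y assume y: "?L y" and E0: "\<And>j t. (j, t) \<in> E \<Longrightarrow> y j t = 0"
      obtain c where c: "\<forall>j\<in>{1..m}. \<forall>t\<in>{0..pi}. y j t = c j * of_real (\<phi> j t)"
          "\<forall>j\<in>{1..m}. c j * of_real (\<phi> j pi) = y 1 pi" "(\<Sum>j=1..m. c j * of_real (\<psi> j pi)) = 0"
        using sol_only[OF y] by blast
      have j0m: "j0 \<in> {1..m}" and p0: "\<phi> j0 pi = 0" using j0 Zsub b(4)[of j0] by blast+
      have v: "y 1 pi = 0" using bspec[OF c(2) j0m] unfolding p0 by simp
      have c0: "c j = 0" if j: "j \<in> {1..m}" "j \<noteq> j0" for j
      proof (cases "j \<in> zeros lam")
        case True
        then have "y j (x j) = 0" using j by (intro E0) (auto simp: E_def)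
        moreover have "y j (x j) = c j * of_real (\<phi> j (x j))" using c(1) x[OF j(1)] j by blast
        ultimately show ?thesis using x[OF j(1)] by simp
      next
        case False
        then show ?thesis using bspec[OF c(2) j(1)] b(4)[OF j(1)] unfolding v by simp
      qed
      have "(\<Sum>j=1..m. c j * of_real (\<psi> j pi)) = c j0 * of_real (\<psi> j0 pi)"
        using c0 j0m by (subst sum.remove[of _ j0]) (simp_all add: sum.neutral)
      moreover have "\<psi> j0 pi \<noteq> 0" using b(4,5)[of j0] j0 Zsub by blast
      ultimately have "c j0 = 0" using c(3) by simp
      with c0 have "c j = 0" if "j \<in> {1..m}" for j using that by (cases "j = j0") auto
      then show "\<forall>j\<in>{1..m}. \<forall>x\<in>{0..pi}. y j x = 0" using c(1) by simp
    next
      fix j t assume "(j, t) \<in> E"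
      then have j: "j \<in> zeros lam" "j \<noteq> j0" "t = x j" by (auto simp: E_def)
      then have jm: "j \<in> {1..m}" and j0m: "j0 \<in> {1..m}" using Zsub j0 by auto
      have psi0: "\<psi> j0 pi \<noteq> 0" using b(4,5)[OF j0m] j0 by blast
      \<comment> \<open>Supported on two edges: edge \<open>j\<close> has coefficient 1, and
        \<open>j0\<close>, which carries no evaluation point, balances the sum of
        quasi-derivatives.\<close>
      define c where "c i = (if i = j then 1 else if i = j0 then - complex_of_real (\<psi> j pi) / of_real (\<psi> j0 pi) else 0)" for i
      have "?L (\<lambda>i t. c i * of_real (\<phi> i t))"
      proof (rule sol_if)
        show "c i * of_real (\<phi> i pi) = 0" if "i \<in> {1..m}" for i
          using b(4)[OF that] j j0 by (auto simp: c_def)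
        have "(\<Sum>i=1..m. c i * of_real (\<psi> i pi)) = c j * of_real (\<psi> j pi) + (c j0 * of_real (\<psi> j0 pi) + (\<Sum>i\<in>{1..m} - {j} - {j0}. c i * of_real (\<psi> i pi)))"
          using jm j0m j by (subst sum.remove[of _ j], simp, simp, subst sum.remove[of _ j0]) auto
        also have "(\<Sum>i\<in>{1..m} - {j} - {j0}. c i * of_real (\<psi> i pi)) = 0"
          by (intro sum.neutral) (auto simp: c_def)
        finally show "(\<Sum>i=1..m. c i * of_real (\<psi> i pi)) = 0" using psi0 j by (simp add: c_def)
      qed
      moreover have "c j * of_real (\<phi> j t) \<noteq> 0" using x[OF jm] j by (simp add: c_def)
      moreover have "c j' * of_real (\<phi> j' t') = 0" if "(j', t') \<in> E" "(j', t') \<noteq> (j, t)" for j' t'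
        using that j by (auto simp: E_def c_def)
      ultimately show "\<exists>y. ?L y \<and> y j t \<noteq> 0 \<and> (\<forall>j' x'. (j', x') \<in> E \<longrightarrow> (j', x') \<noteq> (j, t) \<longrightarrow> y j' x' = 0)"
        by (intro exI[of _ "\<lambda>i t. c i * of_real (\<phi> i t)"]) blast
    qed
    also have "card E = card (zeros lam) - 1"
      unfolding E_def using j0 finZ by (subst card_image) (auto simp: inj_on_def)
    finally show ?thesis using False unfolding jump_def by simp
  qed
qed

end

section \<open>The count for zero potentials, its comparison with the actual count, and the
  numbering by pairs\<close>

section \<open>Eigenvalue asymptotics\<close>

context star_graph
begin

definition \<alpha> :: real where "\<alpha> = arccos (sqrt (real p / real m))"

text \<open>The strict bounds come from 0 < p < m. The identity is tan^2 \<alpha> = (m - p) / p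
  without division, the equation that makes the free cotangent sum vanish.\<close>

lemma \<alpha>_bounds: "0 < \<alpha>" "\<alpha> < pi / 2"
  and \<alpha>_squares: "real p * (sin \<alpha>)\<^sup>2 = (real m - real p) * (cos \<alpha>)\<^sup>2"
proof -
  define x where "x = sqrt (real p / real m)"
  have x: "0 < x" "x < 1" "x\<^sup>2 = real p / real m"
    using p2 pm by (auto simp: x_def)
  show "0 < \<alpha>" "\<alpha> < pi / 2"
    using arccos_less_arccos[of x 1] arccos_less_arccos[of 0 x] x unfolding \<alpha>_def x_def[symmetric] by auto
  have "(cos \<alpha>)\<^sup>2 = real p / real m" "(sin \<alpha>)\<^sup>2 = 1 - real p / real m"
    using x unfolding \<alpha>_def x_def[symmetric] by (simp_all add: sin_squared_eq)
  then show "real p * (sin \<alpha>)\<^sup>2 = (real m - real p) * (cos \<alpha>)\<^sup>2"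
    using pm by (simp only:) (simp add: field_simps)
qed

definition \<omega> :: real where "\<omega> = \<alpha> / pi"

lemma \<omega>_bounds: "0 < \<omega>" "\<omega> < 1 / 2"
  using \<alpha>_bounds by (simp_all add: \<omega>_def field_simps)

text \<open>For zero potential, scale r and lam = r^2, the Pruefer equation is \<theta>' = r, so
  these are the end angles of the free problem.\<close>

definition free_count :: "real \<Rightarrow> int" where
  "free_count r = angle_count {1..m} (\<lambda>j. \<theta>0 j + r * pi)"

definition free_floor :: "real \<Rightarrow> int" where
  "free_floor r = int p * \<lfloor>r + 1/2\<rfloor> + int (m - p) * \<lfloor>r\<rfloor>"

lemma sum_edges:
  fixes a b :: "'a::comm_semiring_1"
  shows "(\<Sum>j=1..m. if j \<le> p then a else b) = of_nat p * a + of_nat (m - p) * b"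
proof -
  have "{1..m} = {1..p} \<union> {p+1..m}" using pm by auto
  then have "(\<Sum>j=1..m. if j \<le> p then a else b) = (\<Sum>j=1..p. if j \<le> p then a else b) + (\<Sum>j=p+1..m. if j \<le> p then a else b)"
    by (simp add: sum.union_disjoint)
  also have "(\<Sum>j=1..p. if j \<le> p then a else b) = (\<Sum>j=1..p. a)" by (intro sum.cong) auto
  also have "(\<Sum>j=p+1..m. if j \<le> p then a else b) = (\<Sum>j=p+1..m. b)" by (intro sum.cong) auto
  finally show ?thesis by simp
qed

lemma floor_free_angle: "\<lfloor>(\<theta>0 j + r * pi) / pi\<rfloor> = (if j \<le> p then \<lfloor>r + 1/2\<rfloor> else \<lfloor>r\<rfloor>)"
  by (simp add: \<theta>0_def add_divide_distrib add.commute)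

lemma sum_floor_free: "(\<Sum>j=1..m. \<lfloor>(\<theta>0 j + r * pi) / pi\<rfloor>) = free_floor r"
  unfolding floor_free_angle sum_edges free_floor_def by simp

lemma sum_cot_free:
  "(\<Sum>j=1..m. cot (\<theta>0 j + r * pi)) = real p * cot (pi / 2 + r * pi) + real (m - p) * cot (r * pi)"
proof -
  have "cot (\<theta>0 j + r * pi) = (if j \<le> p then cot (pi / 2 + r * pi) else cot (r * pi))" for j
    by (simp add: \<theta>0_def)
  then show ?thesis unfolding sum_edges[symmetric] by simp
qed

lemma free_count_bounds: "free_floor r \<le> free_count r" "free_count r \<le> free_floor r + 1"
  unfolding free_count_def angle_count_def sum_floor_free by auto

lemma free_count_mono: "r \<le> r' \<Longrightarrow> free_count r \<le> free_count r'"
  unfolding free_count_def by (intro angle_count_mono) auto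

lemma free_count_at_zero:
  assumes "sin (r * pi) \<noteq> 0" "sin (pi / 2 + r * pi) \<noteq> 0" "(\<Sum>j=1..m. cot (\<theta>0 j + r * pi)) = 0"
  shows "free_count r = free_floor r + 1"
proof -
  have "\<forall>j\<in>{1..m}. sin (\<theta>0 j + r * pi) \<noteq> 0" using assms by (simp add: \<theta>0_def)
  then show ?thesis unfolding free_count_def angle_count_def sum_floor_free assms(3) by simp
qed

text \<open>While all floors stay constant the cotangent sum strictly decreases, so before its zero
  it is positive, unless some edge is at a pole; the correction is 0 in both cases.\<close>

lemma free_count_before_zero:
  assumes 0: "(\<Sum>j=1..m. cot (\<theta>0 j + r * pi)) = 0" and lt: "r' < r"
    and fl: "\<lfloor>r'\<rfloor> = \<lfloor>r\<rfloor>" "\<lfloor>r' + 1/2\<rfloor> = \<lfloor>r + 1/2\<rfloor>"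
  shows "free_count r' = free_floor r'"
proof -
  have "(\<Sum>j=1..m. cot (\<theta>0 j + r * pi)) < (\<Sum>j=1..m. cot (\<theta>0 j + r' * pi))"
    if "\<forall>j\<in>{1..m}. sin (\<theta>0 j + r' * pi) \<noteq> 0"
  proof (rule sum_strict_mono)
    fix j assume "j \<in> {1..m}"
    then show "cot (\<theta>0 j + r * pi) < cot (\<theta>0 j + r' * pi)"
      using that lt fl by (intro cot_strict_decreasing(2)) (auto simp: floor_free_angle)
  qed (use pm in auto)
  then show ?thesis
    unfolding free_count_def angle_count_def sum_floor_free 0 by auto
qed

text \<open>Modulo multiples of pi and up to sign, both sums are (m - p) cot \<alpha> - p tan
  \<alpha>, which vanishes by \<open>\<alpha>_squares\<close>.\<close>

lemma sum_cot_free_zero: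
  fixes N :: int
  shows "(\<Sum>j=1..m. cot (\<theta>0 j + (of_int N + \<omega>) * pi)) = 0"
    and "(\<Sum>j=1..m. cot (\<theta>0 j + (of_int N - \<omega>) * pi)) = 0"
proof -
  have s: "sin \<alpha> > 0" "cos \<alpha> > 0" using \<alpha>_bounds by (auto intro!: sin_gt_zero cos_gt_zero_pi)
  have mp: "real (m - p) = real m - real p" using pm by simp
  have 1: "cot (x + (of_int N + \<omega>) * pi) = cot (x + \<alpha>)" "cot (x + (of_int N - \<omega>) * pi) = cot (x - \<alpha>)" for x
    using cot_shift_int_pi[of "x + (of_int N + \<omega>) * pi" N] cot_shift_int_pi[of "x + (of_int N - \<omega>) * pi" N]
    by (simp_all add: \<omega>_def distrib_right left_diff_distrib)
  have "real p * cot (pi / 2 + \<alpha>) + real (m - p) * cot \<alpha> = (real (m - p) * (cos \<alpha>)\<^sup>2 - real p * (sin \<alpha>)\<^sup>2) / (sin \<alpha> * cos \<alpha>)"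
  proof -
    have "sin (pi / 2 + \<alpha>) = cos \<alpha>" "cos (pi / 2 + \<alpha>) = - sin \<alpha>" by (simp_all add: sin_add cos_add)
    then show ?thesis using s unfolding cot_def by (simp only:) (simp add: field_simps power2_eq_square)
  qed
  then have 2: "real p * cot (pi / 2 + \<alpha>) + real (m - p) * cot \<alpha> = 0" using \<alpha>_squares mp by simp
  have "cot (pi / 2 - \<alpha>) = - cot (pi / 2 + \<alpha>)" "cot (- \<alpha>) = - cot \<alpha>"
    by (simp_all add: cot_def sin_add cos_add sin_diff cos_diff)
  then have 3: "real p * cot (pi / 2 - \<alpha>) + real (m - p) * cot (- \<alpha>) = 0" using 2 by simp
  show "(\<Sum>j=1..m. cot (\<theta>0 j + (of_int N + \<omega>) * pi)) = 0"
    unfolding sum_cot_free using 1[of "pi / 2"] 1[of 0] 2 by simp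
  show "(\<Sum>j=1..m. cot (\<theta>0 j + (of_int N - \<omega>) * pi)) = 0"
    unfolding sum_cot_free using 1[of "pi / 2"] 1[of 0] 3 by simp
qed

text \<open>Unperturbed eigenvalues have \<open>\<rho> = n - 1 + offset q\<close>; the eigenvalue number \<open>(n - 1) m + q\<close>,
  counting from zero, is \<open>\<Lambda> n k\<close> with \<open>q = position k\<close>.\<close>

definition offset :: "nat \<Rightarrow> real" where
  "offset q = (if q = 0 then \<omega> else if q < p then 1 / 2 else if q = p then 1 - \<omega> else 1)"

lemma offset_bounds: "0 < offset q" "offset q \<le> 1"
  using \<omega>_bounds unfolding offset_def by auto

lemma sin_nonzero_between:
  fixes N :: int
  assumes "of_int N < r" "r < of_int N + 1"
  shows "sin (r * pi) \<noteq> 0"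
proof
  assume "sin (r * pi) = 0"
  then obtain i :: int where "r * pi = of_int i * pi" by (auto simp: sin_zero_iff_int2)
  then have "r = of_int i" by simp
  then have "real_of_int N < of_int i" "real_of_int i < of_int (N + 1)" using assms by simp_all
  then show False unfolding of_int_less_iff by simp
qed

text \<open>Over (N, N + 1] the free count rises by 1 at N + \<omega>, by p - 1 at N + 1/2, by 1 at
  N + 1 - \<omega> and by m - p - 1 at N + 1. At N + 1/2, p floors rise while the correction falls
  from 1 to 0, hence p - 1, and similarly at N + 1. Together the claims say that entry N * m + q of
  the free list, counted from zero, is N + offset q.\<close>

lemma free_count_offset:
  fixes N :: int
  assumes q: "q < m"
  shows "N * int m + int q < free_count (of_int N + offset q)"
    and "r < of_int N + offset q \<Longrightarrow> free_count r \<le> N * int m + int q"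
proof -
  note a = \<omega>_bounds
  have mp: "int (m - p) = int m - int p" using pm by simp
  have half: "sin (pi / 2 + r * pi) \<noteq> 0" if "sin ((r + 1/2) * pi) \<noteq> 0" for r :: real
    using that by (simp add: algebra_simps)
  have F: "free_floor r = N * int m" if "\<lfloor>r\<rfloor> = N" "\<lfloor>r + 1/2\<rfloor> = N" for r
    unfolding free_floor_def that mp by (simp add: algebra_simps)
  have F': "free_floor r = N * int m + int p" if "\<lfloor>r\<rfloor> = N" "\<lfloor>r + 1/2\<rfloor> = N + 1" for r
    unfolding free_floor_def that mp by (simp add: algebra_simps)
  have F'': "free_floor r = N * int m + int m" if "\<lfloor>r\<rfloor> = N + 1" "\<lfloor>r + 1/2\<rfloor> = N + 1" for r
    unfolding free_floor_def that mp by (simp add: algebra_simps)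
  have z1: "(\<Sum>j=1..m. cot (\<theta>0 j + (of_int N + \<omega>) * pi)) = 0" by (rule sum_cot_free_zero)
  have z2: "(\<Sum>j=1..m. cot (\<theta>0 j + (of_int N + (1 - \<omega>)) * pi)) = 0"
    using sum_cot_free_zero(2)[of "N + 1"] by (simp add: algebra_simps)
  have fl1: "\<lfloor>r\<rfloor> = N \<and> \<lfloor>r + 1/2\<rfloor> = N" if "of_int N \<le> r" "r < of_int N + 1/2" for r :: real
    using that by (simp add: floor_eq_iff)
  have fl2: "\<lfloor>r\<rfloor> = N \<and> \<lfloor>r + 1/2\<rfloor> = N + 1" if "of_int N + 1/2 \<le> r" "r < of_int N + 1" for r :: real
    using that by (simp add: floor_eq_iff)
  consider (zero) "q = 0" | (low) "0 < q" "q < p" | (mid) "q = p" "q \<noteq> 0" | (high) "p < q" by linarith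
  then show "N * int m + int q < free_count (of_int N + offset q)"
  proof cases
    case zero
    have "free_count (of_int N + \<omega>) = free_floor (of_int N + \<omega>) + 1"
    proof (rule free_count_at_zero[OF _ half z1])
      show "sin ((of_int N + \<omega>) * pi) \<noteq> 0" using a by (intro sin_nonzero_between[of N]) auto
      show "sin ((of_int N + \<omega> + 1/2) * pi) \<noteq> 0" using a by (intro sin_nonzero_between[of N]) auto
    qed
    also have "free_floor (of_int N + \<omega>) = N * int m" using fl1[of "of_int N + \<omega>"] a by (intro F) auto
    finally show ?thesis using zero by (simp add: offset_def)
  next
    case low
    have "N * int m + int p = free_floor (of_int N + 1/2)" using fl2[of "of_int N + 1/2"] by (intro F'[symmetric]) auto
    also have "\<dots> \<le> free_count (of_int N + 1/2)" by (rule free_count_bounds)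
    finally show ?thesis using low by (simp add: offset_def)
  next
    case mid
    have "free_count (of_int N + (1 - \<omega>)) = free_floor (of_int N + (1 - \<omega>)) + 1"
    proof (rule free_count_at_zero[OF _ half z2])
      show "sin ((of_int N + (1 - \<omega>)) * pi) \<noteq> 0" using a by (intro sin_nonzero_between[of N]) auto
      show "sin ((of_int N + (1 - \<omega>) + 1/2) * pi) \<noteq> 0" using a by (intro sin_nonzero_between[of "N + 1"]) auto
    qed
    also have "free_floor (of_int N + (1 - \<omega>)) = N * int m + int p"
      using fl2[of "of_int N + (1 - \<omega>)"] a by (intro F') auto
    finally show ?thesis using mid by (simp add: offset_def)
  next
    case high
    have "N * int m + int m = free_floor (of_int N + 1)" by (intro F''[symmetric]) (auto simp: floor_eq_iff)
    also have "\<dots> \<le> free_count (of_int N + 1)" by (rule free_count_bounds)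
    finally show ?thesis using high q by (simp add: offset_def)
  qed
  assume r: "r < of_int N + offset q"
  consider (zero) "q = 0" | (low) "0 < q" "q < p" | (mid) "q = p" "q \<noteq> 0" | (high) "p < q" by linarith
  then show "free_count r \<le> N * int m + int q"
  proof cases
    case zero
    \<comment> \<open>Monotonicity permits moving r up to where the floors are known; N + \<omega> /
      2 is merely a point between N and the zero N + \<omega>.\<close>
    define r' where "r' = max r (of_int N + \<omega> / 2)"
    have r': "of_int N \<le> r'" "r' < of_int N + \<omega>" "r \<le> r'" using r a zero by (auto simp: r'_def offset_def)
    have "free_count r \<le> free_count r'" by (rule free_count_mono[OF r'(3)])
    also have "\<dots> = free_floor r'"
      using fl1[of r'] fl1[of "of_int N + \<omega>"] r' a by (intro free_count_before_zero[OF z1]) auto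
    also have "\<dots> = N * int m" using fl1[of r'] r' a by (intro F) auto
    finally show ?thesis by simp
  next
    case low
    define r' where "r' = max r (of_int N)"
    have r': "of_int N \<le> r'" "r' < of_int N + 1 / 2" "r \<le> r'" using r low by (auto simp: r'_def offset_def)
    have "free_count r \<le> free_count r'" by (rule free_count_mono[OF r'(3)])
    \<comment> \<open>The crude bound suffices, because q > 0 absorbs a correction of 1.\<close>
    also have "\<dots> \<le> free_floor r' + 1" by (rule free_count_bounds)
    also have "free_floor r' = N * int m" using fl1[of r'] r' by (intro F) auto
    finally show ?thesis using low by simp
  next
    case mid
    define r' where "r' = max r (of_int N + 1/2)"
    have r': "of_int N + 1/2 \<le> r'" "r' < of_int N + (1 - \<omega>)" "r \<le> r'" using r a mid by (auto simp: r'_def offset_def)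
    have "free_count r \<le> free_count r'" by (rule free_count_mono[OF r'(3)])
    also have "\<dots> = free_floor r'"
      using fl2[of r'] fl2[of "of_int N + (1 - \<omega>)"] r' a by (intro free_count_before_zero[OF z2]) auto
    also have "\<dots> = N * int m + int p" using fl2[of r'] r' a by (intro F') auto
    finally show ?thesis using mid by simp
  next
    case high
    define r' where "r' = max r (of_int N + 1/2)"
    have r': "of_int N + 1/2 \<le> r'" "r' < of_int N + 1" "r \<le> r'" using r high p2 by (auto simp: r'_def offset_def)
    have "free_count r \<le> free_count r'" by (rule free_count_mono[OF r'(3)])
    also have "\<dots> \<le> free_floor r' + 1" by (rule free_count_bounds)
    also have "free_floor r' = N * int m + int p" using fl2[of r'] r' by (intro F') auto
    finally show ?thesis using high by simp
  qed
qed

text \<open>Shifting r by the sum \<open>H n\<close> of all edge errors moves each free end angle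
  past the perturbed one, and the count is monotone in the angles. The error bounds concern angles
  at scale r, while \<open>count\<close> uses scale 1; \<open>angle_count_rescale\<close> passes
  between them.\<close>

lemma count_sandwich:
  "\<exists>\<eta>. (\<forall>n. 0 \<le> \<eta> n) \<and> summable (\<lambda>n. (\<eta> (Suc n))\<^sup>2) \<and>
     (\<forall>n r. n \<ge> 4 \<longrightarrow> \<bar>r - real n\<bar> \<le> 2 \<longrightarrow>
        free_count (r - \<eta> n) \<le> count (r\<^sup>2) \<and> count (r\<^sup>2) \<le> free_count (r + \<eta> n))"
proof -
  have "\<forall>j\<in>{1..m}. \<exists>\<eta>. (\<forall>n. 0 \<le> \<eta> n) \<and> summable (\<lambda>n. (\<eta> (Suc n))\<^sup>2) \<and>
     (\<forall>n r \<theta>. n \<ge> 4 \<longrightarrow> \<bar>r - real n\<bar> \<le> 2 \<longrightarrow> l2_potential.prufer (\<sigma> j) r (r\<^sup>2) \<theta> \<longrightarrow> \<bar>\<theta> pi - \<theta> 0 - r * pi\<bar> \<le> \<eta> n)" (is "\<forall>j\<in>_. \<exists>\<eta>. ?P j \<eta>")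
    by (intro ballI l2_potential.prufer_asymptotics[OF pot])
  from bchoice[OF this] obtain \<eta> where P: "\<And>j. j \<in> {1..m} \<Longrightarrow> ?P j (\<eta> j)" by metis
  have \<eta>: "0 \<le> \<eta> j n" "summable (\<lambda>n. (\<eta> j (Suc n))\<^sup>2)"
    "n \<ge> 4 \<Longrightarrow> \<bar>r - real n\<bar> \<le> 2 \<Longrightarrow> l2_potential.prufer (\<sigma> j) r (r\<^sup>2) \<theta> \<Longrightarrow> \<bar>\<theta> pi - \<theta> 0 - r * pi\<bar> \<le> \<eta> j n"
    if "j \<in> {1..m}" for j n r \<theta>
    using P[OF that] by blast+
  define H where "H n = (\<Sum>j=1..m. \<eta> j n)" for n
  have H0: "0 \<le> H n" for n unfolding H_def by (intro sum_nonneg \<eta>(1))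
  have "summable (\<lambda>n. (H (Suc n))\<^sup>2)" unfolding H_def by (intro summable_square_sum \<eta>(2)) simp
  moreover have "free_count (r - H n) \<le> count (r\<^sup>2) \<and> count (r\<^sup>2) \<le> free_count (r + H n)"
    if n: "n \<ge> 4" and r: "\<bar>r - real n\<bar> \<le> 2" for n r
  proof -
    have r0: "r > 0" using n r by linarith
    have "\<forall>j\<in>{1..m}. \<exists>\<theta>. l2_potential.prufer (\<sigma> j) r (r\<^sup>2) \<theta> \<and> \<theta> 0 = \<theta>0 j"
      by (intro ballI l2_potential.prufer_exists[OF pot r0])
    from bchoice[OF this] obtain \<theta> where \<theta>: "\<And>j. j \<in> {1..m} \<Longrightarrow> l2_potential.prufer (\<sigma> j) r (r\<^sup>2) (\<theta> j)"
      "\<And>j. j \<in> {1..m} \<Longrightarrow> \<theta> j 0 = \<theta>0 j" by blast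
    have "angle_count {1..m} (\<lambda>j. end_angle j (r\<^sup>2)) = angle_count {1..m} (\<lambda>j. \<theta> j pi)"
    proof (rule angle_count_rescale[OF r0])
      fix j assume j: "j \<in> {1..m}"
      have eq: "angle j (r\<^sup>2) 0 = \<theta> j 0" using angle(2)[OF j] \<theta>(2)[OF j] by simp
      have 0: "sin (angle j (r\<^sup>2) 0) = 0 \<or> cos (angle j (r\<^sup>2) 0) = 0"
        unfolding angle(2)[OF j] \<theta>0_def by simp
      show "r * sin (end_angle j (r\<^sup>2)) * cos (\<theta> j pi) = cos (end_angle j (r\<^sup>2)) * sin (\<theta> j pi)"
        "\<bar>end_angle j (r\<^sup>2) - \<theta> j pi\<bar> < pi / 2"
        unfolding end_angle_def
        using l2_potential.prufer_rescale[OF pot[OF j] r0 angle(1)[OF j] \<theta>(1)[OF j] eq 0, of pi] by auto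
    qed
    then have c: "count (r\<^sup>2) = angle_count {1..m} (\<lambda>j. \<theta> j pi)" unfolding count_def .
    have close: "\<bar>\<theta> j pi - \<theta>0 j - r * pi\<bar> \<le> H n * pi" if j: "j \<in> {1..m}" for j
    proof -
      have "\<bar>\<theta> j pi - \<theta>0 j - r * pi\<bar> \<le> \<eta> j n"
        using \<eta>(3)[OF j n r \<theta>(1)[OF j]] \<theta>(2)[OF j] by simp
      also have "\<dots> \<le> H n" unfolding H_def using j \<eta>(1) by (intro member_le_sum) auto
      \<comment> \<open>A shift of r by H n moves the free angles by H n * pi, more than is
        required.\<close>
      also have "\<dots> \<le> H n * pi" using H0[of n] pi_gt3 by (simp add: mult_le_cancel_left1)
      finally show ?thesis .
    qed
    show ?thesis
      unfolding c free_count_def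
    proof (intro conjI angle_count_mono)
      fix j assume "j \<in> {1..m}"
      from close[OF this] show "\<theta>0 j + (r - H n) * pi \<le> \<theta> j pi" "\<theta> j pi \<le> \<theta>0 j + (r + H n) * pi"
        unfolding left_diff_distrib distrib_right by linarith+
    qed auto
  qed
  ultimately show ?thesis using H0 by blast
qed

text \<open>For lam low enough every end angle lies in (0, pi / 2), where floors are 0 and
  cotangents positive. So the spectrum is bounded below and can be listed from its bottom.\<close>

lemma count_low: "\<exists>x0. \<forall>y\<le>x0. count y = 0"
proof -
  have "\<forall>j\<in>{1..m}. \<exists>lam. \<forall>\<theta>. l2_potential.prufer (\<sigma> j) 1 lam \<theta> \<and> \<theta> 0 \<le> pi / 2 \<longrightarrow> \<theta> pi < pi / 2"
    by (intro ballI l2_potential.prufer_small_lam[OF pot])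
  from bchoice[OF this] obtain l where l: "\<And>j \<theta>. j \<in> {1..m} \<Longrightarrow> l2_potential.prufer (\<sigma> j) 1 (l j) \<theta> \<Longrightarrow> \<theta> 0 \<le> pi / 2 \<Longrightarrow> \<theta> pi < pi / 2"
    by blast
  define x0 where "x0 = Min (l ` {1..m})"
  have "count y = 0" if y: "y \<le> x0" for y
  proof -
    have e: "0 < end_angle j y \<and> end_angle j y < pi / 2" if j: "j \<in> {1..m}" for j
    proof
      have t0: "0 \<le> \<theta>0 j" "\<theta>0 j \<le> pi / 2" by (auto simp: \<theta>0_def)
      show "0 < end_angle j y"
        unfolding end_angle_def using l2_potential.prufer_pos[OF pot[OF j] angle(1)[OF j]] angle(2)[OF j] t0 by simp
      have "x0 \<le> l j" unfolding x0_def using j by (intro Min_le) auto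
      then have "end_angle j y \<le> end_angle j (l j)"
        using y end_angle_strict_mono[OF j, of y "l j"] by (cases "y = l j") auto
      also have "\<dots> < pi / 2"
        unfolding end_angle_def using angle[OF j] t0 by (intro l[OF j]) simp_all
      finally show "end_angle j y < pi / 2" .
    qed
    have fl: "\<lfloor>end_angle j y / pi\<rfloor> = 0" if "j \<in> {1..m}" for j
      using e[OF that] by (intro iffD2[OF floor_div_pi_eq]) auto
    have "cot (end_angle j y) > 0" if "j \<in> {1..m}" for j
      using e[OF that] by (auto simp: cot_def intro!: divide_pos_pos sin_gt_zero cos_gt_zero_pi)
    then have "(\<Sum>j=1..m. cot (end_angle j y)) > 0" using pm by (intro sum_pos) auto
    then show ?thesis unfolding count_def angle_count_def using fl by simp
  qed
  then show ?thesis by blast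
qed

text \<open>The theorem puts the two families with \<alpha> at k = 1 and k = 2, whereas the
  increasing order in a period is \<omega>, then p - 1 times 1/2, then 1 - \<omega>, then m - p - 1
  times 1. So 2 goes to p, {3..p+1} to {1..p-1} and {p+2..m} to {p+1..m-1}.\<close>

definition position :: "nat \<Rightarrow> nat" where
  "position k = (if k = 1 then 0 else if k = 2 then p else if k \<le> p + 1 then k - 2 else k - 1)"

lemma position_bij: "bij_betw position {1..m} {..<m}"
proof -
  have inj: "inj_on position {1..m}"
    using p2 by (auto simp: inj_on_def position_def split: if_splits)
  have "position ` {1..m} \<subseteq> {..<m}" using p2 pm by (auto simp: position_def)
  then have "position ` {1..m} = {..<m}"
    using card_image[OF inj] by (intro card_subset_eq) auto
  with inj show ?thesis by (simp add: bij_betw_def)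
qed

text \<open>Quotient and remainder modulo m recover n - 1 and the position.\<close>

lemma index_bij: "bij_betw (\<lambda>(n, k). (n - 1) * m + position k) ({1::nat..} \<times> {1..m}) UNIV"
proof (rule bij_betwI')
  have m: "m > 0" using pm by simp
  have pl: "position k < m" if "k \<in> {1..m}" for k using bij_betwE[OF position_bij] that by blast
  fix x y assume xy: "x \<in> {1::nat..} \<times> {1..m}" "y \<in> {1::nat..} \<times> {1..m}"
  obtain a k b l where [simp]: "x = (a, k)" "y = (b, l)" by fastforce
  have k: "k \<in> {1..m}" "l \<in> {1..m}" "a \<ge> 1" "b \<ge> 1" using xy by auto
  have "x = y" if eq: "(a - 1) * m + position k = (b - 1) * m + position l"
  proof -
    have "position k = position l" using arg_cong[OF eq, of "\<lambda>x. x mod m"] pl[OF k(1)] pl[OF k(2)] by simp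
    then have "k = l" using bij_betw_imp_inj_on[OF position_bij] k by (metis inj_onD)
    moreover have "a - 1 = b - 1" using arg_cong[OF eq, of "\<lambda>x. x div m"] pl[OF k(1)] pl[OF k(2)] by simp
    ultimately show ?thesis using k by simp
  qed
  then show "((case x of (n, k) \<Rightarrow> (n - 1) * m + position k) = (case y of (n, k) \<Rightarrow> (n - 1) * m + position k)) = (x = y)"
    by auto
next
  have m: "m > 0" using pm by simp
  fix i :: nat
  have "i mod m \<in> {..<m}" using m by simp
  then obtain k where "k \<in> {1..m}" "position k = i mod m"
    using position_bij unfolding bij_betw_def by (metis imageE)
  then show "\<exists>x\<in>{1::nat..} \<times> {1..m}. i = (case x of (n, k) \<Rightarrow> (n - 1) * m + position k)"
    by (intro bexI[of _ "(i div m + 1, k)"]) auto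
qed simp

text \<open>Square summability depends only on the tail, so finitely many negative eigenvalues with
  imaginary roots do no harm; from \<open>K\<close> on \<open>csqrt\<close> is the real
  root.\<close>

lemma l2seq_of_close:
  fixes x t \<eta> :: "nat \<Rightarrow> real"
  assumes \<eta>: "summable (\<lambda>n. (\<eta> (Suc n))\<^sup>2)"
    and close: "\<And>n. n \<ge> K \<Longrightarrow> 0 \<le> x n \<and> \<bar>sqrt (x n) - t n\<bar> \<le> \<eta> n"
  shows "l2seq (\<lambda>n. csqrt (complex_of_real (x n)) - complex_of_real (t n))"
  unfolding l2seq_def
proof (rule summable_comparison_test[OF _ \<eta>], intro exI[of _ K] allI impI)
  fix n assume "K \<le> n"
  then have c: "0 \<le> x (Suc n)" "\<bar>sqrt (x (Suc n)) - t (Suc n)\<bar> \<le> \<eta> (Suc n)" using close[of "Suc n"] by auto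
  have "cmod (csqrt (complex_of_real (x (Suc n))) - complex_of_real (t (Suc n))) = \<bar>sqrt (x (Suc n)) - t (Suc n)\<bar>"
    unfolding of_real_sqrt[OF c(1), symmetric] of_real_diff[symmetric] by (rule norm_of_real)
  then show "norm ((cmod (csqrt (complex_of_real (x (Suc n))) - complex_of_real (t (Suc n))))\<^sup>2) \<le> (\<eta> (Suc n))\<^sup>2"
    using power_mono[OF c(2), of 2] by simp
qed

text \<open>The listing satisfies \<Lambda> n k \<le> x iff (n - 1) m + q < count x, with q the
  position of k. Inserting the sandwich turns this into a statement about the free count, which
  passes the index (n - 1) m + q exactly at t = n - 1 + offset q.\<close>

lemma eigenvalue_asymptotics:
  "\<exists>(\<Lambda> :: nat \<Rightarrow> nat \<Rightarrow> real) \<eta> K.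
     (\<forall>lam :: complex.
        finite {(n, k). n \<ge> 1 \<and> k \<in> {1..m} \<and> complex_of_real (\<Lambda> n k) = lam} \<and>
        card {(n, k). n \<ge> 1 \<and> k \<in> {1..m} \<and> complex_of_real (\<Lambda> n k) = lam} = L_mult m p \<sigma> lam) \<and>
     summable (\<lambda>n. (\<eta> (Suc n))\<^sup>2) \<and>
     (\<forall>k\<in>{1..m}. \<forall>n\<ge>K. 0 \<le> \<Lambda> n k \<and> \<bar>sqrt (\<Lambda> n k) - (real n - 1 + offset (position k))\<bar> \<le> \<eta> n)"
proof -
  obtain \<eta> where \<eta>: "\<And>n. 0 \<le> \<eta> n" "summable (\<lambda>n. (\<eta> (Suc n))\<^sup>2)"
     "\<And>n r. n \<ge> 4 \<Longrightarrow> \<bar>r - real n\<bar> \<le> 2 \<Longrightarrow> free_count (r - \<eta> n) \<le> count (r\<^sup>2) \<and> count (r\<^sup>2) \<le> free_count (r + \<eta> n)"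
    using count_sandwich by blast
  have "(\<lambda>n. (\<eta> (Suc n))\<^sup>2) \<longlonglongrightarrow> 0" by (rule summable_LIMSEQ_zero[OF \<eta>(2)])
  then have "\<forall>\<^sub>F n in sequentially. (\<eta> (Suc n))\<^sup>2 < 1" by (rule order_tendstoD) simp
  then obtain K0 where K0: "\<And>n. n \<ge> K0 \<Longrightarrow> (\<eta> (Suc n))\<^sup>2 < 1" unfolding eventually_sequentially by blast
  \<comment> \<open>From here on the sandwich applies, and \<eta> n < 1 keeps t + \<eta> n and t -
    \<eta> n within distance 2 of n.\<close>
  define K where "K = max 4 (Suc K0)"
  have small: "\<eta> n < 1" if n: "n \<ge> K" for n
  proof -
    have "(\<eta> (Suc (n - 1)))\<^sup>2 < 1" using n by (intro K0) (simp add: K_def)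
    moreover have "Suc (n - 1) = n" using n by (simp add: K_def)
    ultimately have "(\<eta> n)\<^sup>2 < 1" by simp
    then show ?thesis using \<eta>(1)[of n] by (simp add: abs_square_less_1)
  qed
  have high: "\<exists>x. int i < count x" for i
  proof -
    \<comment> \<open>The count at n^2 is at least the free count at n - \<eta> n \<ge> n - 2 +
      offset 0, which exceeds (n - 2) * m \<ge> n - 2 > i.\<close>
    define n where "n = max K (i + 3)"
    have n: "n \<ge> K" "n \<ge> 4" "n \<ge> i + 3" by (auto simp: n_def K_def)
    have m: "0 < m" using pm by simp
    have "int i < (int n - 2) * int m + int 0"
    proof -
      have "int i < int n - 2" using n by simp
      also have "\<dots> \<le> (int n - 2) * int m" using n m by (simp add: mult_le_cancel_left1)
      finally show ?thesis by simp
    qed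
    also have "\<dots> < free_count (of_int (int n - 2) + offset 0)" by (rule free_count_offset[OF m])
    also have "\<dots> \<le> free_count (real n - \<eta> n)"
      using small[OF n(1)] offset_bounds[of 0] by (intro free_count_mono) simp
    also have "\<dots> \<le> count ((real n)\<^sup>2)" using \<eta>(3)[OF n(2), of "real n"] by simp
    finally show ?thesis by blast
  qed
  obtain x0 where x0: "\<And>y. y \<le> x0 \<Longrightarrow> count y = 0" using count_low by blast
  obtain l where l: "\<And>i x. l i \<le> x \<longleftrightarrow> int i < count x"
     and lc: "\<And>x. finite {i. l i = x} \<and> card {i. l i = x} = jump x"
    using enumerate_count[OF count_mono x0 high count_right count_left] by blast
  define idx where "idx = (\<lambda>(n, k). (n - 1) * m + position k)"
  define \<Lambda> where "\<Lambda> n k = l (idx (n, k))" for n k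
  have bij: "bij_betw idx ({1::nat..} \<times> {1..m}) UNIV" unfolding idx_def by (rule index_bij)
  have mult: "finite {(n, k). n \<ge> 1 \<and> k \<in> {1..m} \<and> complex_of_real (\<Lambda> n k) = lam} \<and>
        card {(n, k). n \<ge> 1 \<and> k \<in> {1..m} \<and> complex_of_real (\<Lambda> n k) = lam} = L_mult m p \<sigma> lam" (is "finite ?A \<and> _") for lam
  proof (cases "lam \<in> \<real>")
    case False
    then have empty: "?A = {}" by auto
    show ?thesis unfolding empty L_mult_nonreal[OF False] by simp
  next
    case True
    then obtain x where x: "lam = complex_of_real x" by (auto elim: Reals_cases)
    have A: "?A \<subseteq> {1..} \<times> {1..m}" by auto
    have inj: "inj_on idx ?A" using inj_on_subset[OF bij_betw_imp_inj_on[OF bij] A] .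
    have "idx ` ?A = {i. l i = x}"
    proof
      show "idx ` ?A \<subseteq> {i. l i = x}" by (auto simp: \<Lambda>_def x)
      show "{i. l i = x} \<subseteq> idx ` ?A"
      proof
        fix i assume i: "i \<in> {i. l i = x}"
        obtain z where z: "z \<in> {1::nat..} \<times> {1..m}" "idx z = i"
          using bij unfolding bij_betw_def by (metis UNIV_I imageE)
        then have "z \<in> ?A" using i by (auto simp: \<Lambda>_def x)
        with z(2) show "i \<in> idx ` ?A" by blast
      qed
    qed
    then have "finite (idx ` ?A)" "card (idx ` ?A) = L_mult m p \<sigma> lam"
      using lc[of x] unfolding x L_mult_real by simp_all
    then show ?thesis unfolding card_image[OF inj] using finite_imageD[OF _ inj] by blast
  qed
  have asym: "0 \<le> \<Lambda> n k \<and> \<bar>sqrt (\<Lambda> n k) - (real n - 1 + offset (position k))\<bar> \<le> \<eta> n"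
    if k: "k \<in> {1..m}" and n: "n \<ge> K" for n k
  proof -
    define q t where "q = position k" and "t = real n - 1 + offset q"
    have q: "q < m" unfolding q_def using bij_betwE[OF position_bij] k by blast
    have n4: "n \<ge> 4" using n by (simp add: K_def)
    have t: "t = of_int (int n - 1) + offset q" by (simp add: t_def)
    have idx: "int (idx (n, k)) = (int n - 1) * int m + int q" using n4 by (simp add: idx_def q_def of_nat_diff)
    have tb: "real n - 1 < t" "t \<le> real n" using offset_bounds[of q] by (auto simp: t_def)
    note e = \<eta>(1)[of n] small[OF n]
    have upper: "\<Lambda> n k \<le> (t + \<eta> n)\<^sup>2"
    proof -
      have "int (idx (n, k)) < free_count t" unfolding idx t by (rule free_count_offset(1)[OF q])
      also have "\<dots> \<le> count ((t + \<eta> n)\<^sup>2)" using \<eta>(3)[OF n4, of "t + \<eta> n"] tb e by simp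
      finally show ?thesis unfolding \<Lambda>_def l .
    qed
    have lower: "t - \<eta> n \<le> sqrt (\<Lambda> n k)"
    proof (rule ccontr)
      assume "\<not> ?thesis"
      then have lt: "sqrt (\<Lambda> n k) < t - \<eta> n" by simp
      \<comment> \<open>Raising the root to at least n - 2 keeps r in the window of the sandwich,
        also for a negative eigenvalue, whose real \<open>sqrt\<close> is negative.\<close>
      define r where "r = max (real n - 2) (sqrt (\<Lambda> n k))"
      have r: "real n - 2 \<le> r" "r < t - \<eta> n" "sqrt (\<Lambda> n k) \<le> r" using lt tb e by (auto simp: r_def)
      have "\<Lambda> n k \<le> r\<^sup>2" using r n4 by (simp add: sqrt_le_D)
      then have "int (idx (n, k)) < count (r\<^sup>2)" unfolding \<Lambda>_def l .
      also have "\<dots> \<le> free_count (r + \<eta> n)" using \<eta>(3)[OF n4, of r] r tb e by (simp add: abs_le_iff)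
      also have "\<dots> \<le> int (idx (n, k))" unfolding idx using r by (intro free_count_offset(2)[OF q]) (simp add: t)
      finally show False by simp
    qed
    have "0 < t - \<eta> n" using tb e n4 by linarith
    then have "0 < sqrt (\<Lambda> n k)" using lower by linarith
    \<comment> \<open>The real \<open>sqrt\<close> is odd, so a positive root excludes a negative
      eigenvalue.\<close>
    then have pos: "0 \<le> \<Lambda> n k" by simp
    have "sqrt (\<Lambda> n k) \<le> t + \<eta> n" using upper tb e n4 by (intro real_le_lsqrt) auto
    then show ?thesis using lower pos unfolding t_def q_def by (simp add: abs_le_iff)
  qed
  show ?thesis by (intro exI[of _ \<Lambda>] exI[of _ \<eta>] exI[of _ K]) (use mult \<eta>(2) asym in blast)
qed

end

theorem theorem1:
  fixes m p :: nat and \<sigma> :: "nat \<Rightarrow> real \<Rightarrow> real"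
  assumes "m \<ge> 4" and "2 \<le> p" and "p \<le> m - 2"
    and "\<forall>j\<in>{1..m}. L2_real (\<sigma> j)"
  shows "\<exists>(\<Lambda> :: nat \<Rightarrow> nat \<Rightarrow> real) (I3 :: nat set) (I4 :: nat set).
     (\<forall>lam :: complex.
        finite {(n, k). n \<ge> 1 \<and> k \<in> {1..m} \<and> complex_of_real (\<Lambda> n k) = lam} \<and>
        card {(n, k). n \<ge> 1 \<and> k \<in> {1..m} \<and> complex_of_real (\<Lambda> n k) = lam} = L_mult m p \<sigma> lam) \<and>
     I3 \<union> I4 = {3..m} \<and> I3 \<inter> I4 = {} \<and> card I3 = p - 1 \<and> card I4 = m - p - 1 \<and>
     (let \<alpha> = arccos (sqrt (real p / real m));
          \<rho> = (\<lambda>n k. csqrt (complex_of_real (\<Lambda> n k)))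
      in l2seq (\<lambda>n. \<rho> n 1 - complex_of_real (real n - 1 + \<alpha> / pi)) \<and>
         l2seq (\<lambda>n. \<rho> n 2 - complex_of_real (real n - \<alpha> / pi)) \<and>
         (\<forall>k\<in>I3. l2seq (\<lambda>n. \<rho> n k - complex_of_real (real n - 1 / 2))) \<and>
         (\<forall>k\<in>I4. l2seq (\<lambda>n. \<rho> n k - complex_of_real (real n))))"
proof -
  interpret star_graph m p \<sigma>
  proof (rule star_graph.intro)
    show "2 \<le> p" "p + 2 \<le> m" using assms by auto
    fix j assume "j \<in> {1..m}"
    then have "L2_real (\<sigma> j)" using assms by blast
    then show "l2_potential (\<sigma> j)"
      \<comment> \<open>The square is nonnegative, so its gauge integrability is absolute.\<close>
      unfolding L2_real_def by unfold_locales (auto intro: nonnegative_absolutely_integrable_1)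
  qed
  obtain \<Lambda> \<eta> K where \<Lambda>: "\<forall>lam :: complex.
        finite {(n, k). n \<ge> 1 \<and> k \<in> {1..m} \<and> complex_of_real (\<Lambda> n k) = lam} \<and>
        card {(n, k). n \<ge> 1 \<and> k \<in> {1..m} \<and> complex_of_real (\<Lambda> n k) = lam} = L_mult m p \<sigma> lam"
    and \<eta>: "summable (\<lambda>n. (\<eta> (Suc n))\<^sup>2)"
    and close: "\<And>k n. k \<in> {1..m} \<Longrightarrow> n \<ge> K \<Longrightarrow> 0 \<le> \<Lambda> n k \<and> \<bar>sqrt (\<Lambda> n k) - (real n - 1 + offset (position k))\<bar> \<le> \<eta> n"
    using eigenvalue_asymptotics by blast
  have l2: "l2seq (\<lambda>n. csqrt (complex_of_real (\<Lambda> n k)) - complex_of_real (f n))"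
    if "k \<in> {1..m}" "\<And>n. f n = real n - 1 + offset (position k)" for k f
    using close[OF that(1)] unfolding that(2) by (intro l2seq_of_close[OF \<eta>])
  \<comment> \<open>These two ranges become \<open>I3\<close> and \<open>I4\<close>:
    \<open>position\<close> maps them to the places with offset 1/2 and 1.\<close>
  have offsets: "k \<in> {3..p+1} \<Longrightarrow> offset (position k) = 1 / 2" "k \<in> {p+2..m} \<Longrightarrow> offset (position k) = 1" for k
    using p2 pm by (auto simp: position_def offset_def)
  have 1: "l2seq (\<lambda>n. csqrt (complex_of_real (\<Lambda> n 1)) - complex_of_real (real n - 1 + \<alpha> / pi))"
    using pm by (intro l2) (auto simp: position_def offset_def \<omega>_def)
  have 2: "l2seq (\<lambda>n. csqrt (complex_of_real (\<Lambda> n 2)) - complex_of_real (real n - \<alpha> / pi))"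
    using p2 pm by (intro l2) (auto simp: position_def offset_def \<omega>_def)
  have 3: "\<forall>k\<in>{3..p+1}. l2seq (\<lambda>n. csqrt (complex_of_real (\<Lambda> n k)) - complex_of_real (real n - 1 / 2))"
    using pm by (intro ballI l2) (auto simp: offsets)
  have 4: "\<forall>k\<in>{p+2..m}. l2seq (\<lambda>n. csqrt (complex_of_real (\<Lambda> n k)) - complex_of_real (real n))"
    by (intro ballI l2) (auto simp: offsets)
  have "{3..p+1} \<union> {p+2..m} = {3..m}" "{3..p+1} \<inter> {p+2..m} = {}" "card {3..p+1} = p - 1" "card {p+2..m} = m - p - 1"
    using p2 pm by auto
  with \<Lambda> 1 2 3 4 show ?thesis
    unfolding Let_def \<alpha>_def[symmetric] by blast
qed

end
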